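(* Let $k \geq 2$ be an integer. For every finite simple graph $G$ we have $\chi'_k(G) \leq 198k - 101$.
   Context: All graphs are finite and simple. A $\chi'_k$-coloring of a graph $G$ is a coloring of the edges of $G$ (each edge receives exactly one color; the coloring need not be proper) in which, for each color used, the subgraph spanned by the edges of that color has all degrees congruent to $1 \pmod k$. Here the subgraph spanned by a set of edges consists of those edges together with the vertices incident with at least one of them; so the condition says that for every color $c$ and every vertex $v$ incident with at least one edge of color $c$, the number of edges of color $c$ incident with $v$ is congruent to $1$ modulo $k$. The number $\chi'_k(G)$ is the minimum number of colors in a $\chi'_k$-coloring of $G$. *)

theory Defs
  imports Main "HOL-Number_Theory.Cong"
begin

definition finite_simple_graph :: "'a set \<Rightarrow> 'a set set \<Rightarrow> bool" where
  "finite_simple_graph V E \<longleftrightarrow> finite V \<and> (\<forall>e\<in>E. e \<subseteq> V \<and> card e = 2)"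

definition edge_degree :: "'a set set \<Rightarrow> 'a \<Rightarrow> nat" where
  "edge_degree F v = card {e \<in> F. v \<in> e}"

definition color_class :: "'a set set \<Rightarrow> ('a set \<Rightarrow> 'c) \<Rightarrow> 'c \<Rightarrow> 'a set set" where
  "color_class E c i = {e \<in> E. c e = i}"

(* The vertices of the subgraph spanned by an edge set F are exactly those in \<Union>F. *)
definition chi'_coloring :: "nat \<Rightarrow> 'a set set \<Rightarrow> ('a set \<Rightarrow> 'c) \<Rightarrow> bool" where
  "chi'_coloring k E c \<longleftrightarrow>
     (\<forall>i \<in> c ` E. \<forall>v \<in> \<Union>(color_class E c i). [edge_degree (color_class E c i) v = 1] (mod k))"

(* Isolated vertices are irrelevant, so only the edge set is a parameter. Natural numbers
   suffice as colors for a finite edge set; the minimum exists by chi'_index_attained. *)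
definition chi'_index :: "nat \<Rightarrow> 'a set set \<Rightarrow> nat" where
  "chi'_index k E = (LEAST n. \<exists>c :: 'a set \<Rightarrow> nat. chi'_coloring k E c \<and> card (c ` E) = n)"

lemma finite_simple_graph_finite_edges:
  assumes "finite_simple_graph (V :: 'a set) E"
  shows "finite E"
  using assms finite_subset[of E "Pow V"] by (auto simp: finite_simple_graph_def)

lemma inj_on_chi'_coloring:
  assumes "inj_on c E"
  shows "chi'_coloring k E c"
  unfolding chi'_coloring_def
proof (intro ballI)
  fix i v assume "i \<in> c ` E" and v: "v \<in> \<Union>(color_class E c i)"
  then obtain e where e: "e \<in> E" "c e = i" by auto
  have "color_class E c i = {e}"
    using assms e by (auto simp: color_class_def inj_on_def)
  moreover from this v have "{f \<in> {e}. v \<in> f} = {e}" by auto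
  ultimately show "[edge_degree (color_class E c i) v = 1] (mod k)"
    by (simp add: edge_degree_def)
qed

lemma chi'_index_attained:
  assumes "finite_simple_graph (V :: 'a set) E"
  shows "\<exists>c :: 'a set \<Rightarrow> nat. chi'_coloring k E c \<and> card (c ` E) = chi'_index k E"
proof -
  obtain c :: "'a set \<Rightarrow> nat" where "inj_on c E"
    using finite_imp_inj_to_nat_seg[OF finite_simple_graph_finite_edges[OF assms]] by auto
  then have "\<exists>n. \<exists>c :: 'a set \<Rightarrow> nat. chi'_coloring k E c \<and> card (c ` E) = n"
    using inj_on_chi'_coloring by blast
  then show ?thesis
    unfolding chi'_index_def by (rule LeastI_ex)
qed

end

theory Submission
  imports Defs
begin

text \<open>
  Let H be a largest edge set all of whose nonzero degrees are 1 modulo k; it becomes one colour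
  class. The remaining graph is O(k)-degenerate: otherwise it contains a subgraph that stays highly
  edge-connected after the deletion of any 2k - 2 vertices, and inside a maximum cut of it one finds
  a nonempty edge set whose degrees are 0 modulo k on the vertices covered by H and 0 or 1 on the
  others, so H was not maximal. The few deleted vertices return as pendant vertices and balance the
  degree sums of the two sides of the cut.

  A degenerate graph is coloured greedily along its ordering, keeping the colours of the edges
  towards earlier vertices distinct: colour the edges of a star towards later vertices so that each
  class has size 0 or 1 modulo k and as many as possible are coloured; then every colour is
  available for at most k - 1 of the uncoloured edges, so only O(k) of them remain, and these get
  distinct colours from a second palette.

  The degree-constrained edge set comes from the theorem that an O(k)-edge-connected multigraph has
  an orientation with prescribed out-degrees modulo k, in the spirit of Thomassen and of Lovasz,
  Thomassen, Wu and Zhang.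
\<close>

subsection \<open>Flows on multigraphs\<close>

text \<open>Put n = k - 1. Extending H requires the degrees prescribed on the two sides of the cut
  to have sums congruent modulo k. A pendant edge changes the sum of one side by one, so k - 1 of
  them at one side correct any discrepancy; by pigeonhole 2k - 2 spare vertices supply them.

  The induction for orientations contracts a vertex set and then has to treat the inside of that
  set, where the boundary edges already have directions. This forces a statement about graphs with
  directed half-edges whose number is kept under control.

  Orientations need cuts of 13n + 5. One more edge pays for an edge fixed in advance and the maximum
  cut costs a factor 2, which gives 26n + 12; a minimum degree of 2(26n + 12 + 2n) = 56n + 24 forces
  a subgraph so connected after deleting 2n vertices. For d = 56n + 24 the first palette has 5d/4 =
  70n + 30 colours and leaves at most 5n edges of a star uncoloured; the second has 2d + 5n.
  Together with the colour of H this makes 187n + 79.\<close>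

definition wdeg :: "('v \<Rightarrow> 'v \<Rightarrow> nat) \<Rightarrow> 'v set \<Rightarrow> 'v \<Rightarrow> nat" where
  "wdeg m V x = (\<Sum>v\<in>V. m x v)"

definition wcut :: "('v \<Rightarrow> 'v \<Rightarrow> nat) \<Rightarrow> 'v set \<Rightarrow> 'v set \<Rightarrow> nat" where
  "wcut m V A = (\<Sum>u\<in>A. \<Sum>v\<in>V - A. m u v)"

definition multigraph :: "('v \<Rightarrow> 'v \<Rightarrow> nat) \<Rightarrow> bool" where
  "multigraph m \<longleftrightarrow> (\<forall>u v. m u v = m v u) \<and> (\<forall>u. m u u = 0)"

text \<open>
  A multigraph is given by its multiplicities. A flow encodes an orientation: \<open>f u v\<close> is the number
  of edges directed from u to v minus the number of those directed from v to u.
\<close>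

definition flow :: "'v set \<Rightarrow> ('v \<Rightarrow> 'v \<Rightarrow> nat) \<Rightarrow> ('v \<Rightarrow> 'v \<Rightarrow> int) \<Rightarrow> bool" where
  "flow V m f \<longleftrightarrow> (\<forall>u\<in>V. \<forall>v\<in>V. f u v = - f v u \<and> \<bar>f u v\<bar> \<le> int (m u v) \<and> even (f u v + int (m u v)))"

definition edge_mult :: "'v \<Rightarrow> 'v \<Rightarrow> 'v \<Rightarrow> 'v \<Rightarrow> nat" where
  "edge_mult x y u v = (if u = x \<and> v = y \<or> u = y \<and> v = x then 1 else 0)"

definition edge_flow :: "'v \<Rightarrow> 'v \<Rightarrow> 'v \<Rightarrow> 'v \<Rightarrow> int" where
  "edge_flow x y u v = (if u = x \<and> v = y then 1 else if u = y \<and> v = x then - 1 else 0)"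

lemma multigraph_sym: "multigraph m \<Longrightarrow> m u v = m v u"
  by (auto simp: multigraph_def)

lemma multigraph_diag: "multigraph m \<Longrightarrow> m u u = 0"
  by (auto simp: multigraph_def)

lemma multigraph_edge_mult: "x \<noteq> y \<Longrightarrow> multigraph (edge_mult x y)"
  by (auto simp: multigraph_def edge_mult_def)

lemma multigraph_add: "multigraph m \<Longrightarrow> multigraph m' \<Longrightarrow> multigraph (\<lambda>u v. m u v + m' u v)"
  by (simp add: multigraph_def)

lemma wdeg_add: "wdeg (\<lambda>u v. m u v + m' u v) V x = wdeg m V x + wdeg m' V x"
  by (simp add: wdeg_def sum.distrib)

lemma wcut_add: "wcut (\<lambda>u v. m u v + m' u v) V A = wcut m V A + wcut m' V A"
  by (simp add: wcut_def sum.distrib)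

lemma wdeg_edge_mult:
  assumes "finite V" "x \<in> V" "y \<in> V" "x \<noteq> y"
  shows "wdeg (edge_mult x y) V u = (if u = x \<or> u = y then 1 else 0)"
proof -
  have "edge_mult x y u v = (if u = x then (if v = y then 1 else 0) else if u = y then (if v = x then 1 else 0) else 0)" for v
    using assms by (auto simp: edge_mult_def)
  then show ?thesis using assms by (simp add: wdeg_def)
qed

lemma wcut_edge_mult_le:
  assumes "finite V" "A \<subseteq> V" "x \<noteq> y" 
  shows "wcut (edge_mult x y) V A \<le> 1"
proof -
  have fA: "finite A" using assms finite_subset by blast
  have inner: "(\<Sum>v\<in>V - A. edge_mult x y u v) \<le> (if u = x then (if y \<in> A then 0 else 1) else 0) + (if u = y then (if x \<in> A then 0 else 1) else 0)"
    (is "_ \<le> ?r u") for u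
  proof -
    have "(\<Sum>v\<in>V - A. edge_mult x y u v) \<le> (\<Sum>v\<in>V - A. (if v = y then (if u = x then 1 else 0) else 0) + (if v = x then (if u = y then 1 else 0) else 0))"
      by (intro sum_mono) (auto simp: edge_mult_def)
    also have "\<dots> \<le> ?r u"
      using assms(1) by (simp add: sum.distrib)
    finally show ?thesis .
  qed
  have "wcut (edge_mult x y) V A \<le> (\<Sum>u\<in>A. ?r u)"
    unfolding wcut_def by (intro sum_mono inner)
  also have "\<dots> \<le> 1"
    using fA by (simp add: sum.distrib)
  finally show ?thesis .
qed

lemma split_edge:
  assumes "multigraph m" "m x y > 0"
  obtains m0 where "multigraph m0" "m = (\<lambda>u v. m0 u v + edge_mult x y u v)" "x \<noteq> y"
proof -
  have xy: "x \<noteq> y" using assms by (auto simp: multigraph_def)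
  let ?m0 = "\<lambda>u v. m u v - edge_mult x y u v"
  have s: "m x y = m y x" using assms(1) by (simp add: multigraph_def)
  have "edge_mult x y u v \<le> m u v" for u v
    using assms(2) s by (auto simp: edge_mult_def)
  then have "m = (\<lambda>u v. ?m0 u v + edge_mult x y u v)" by auto
  moreover have "multigraph ?m0"
    using assms(1) multigraph_edge_mult[OF xy] by (simp add: multigraph_def)
  ultimately show ?thesis using that xy by blast
qed

lemma sum_edge_flow:
  assumes "finite V" "x \<in> V" "y \<in> V" "x \<noteq> y"
  shows "(\<Sum>v\<in>V. edge_flow x y u v) = (if u = x then 1 else if u = y then - 1 else 0)"
proof -
  have "edge_flow x y u v = (if u = x then (if v = y then 1 else 0) else if u = y then (if v = x then - 1 else 0) else 0)" for v
    using assms by (auto simp: edge_flow_def)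
  then show ?thesis using assms by simp
qed

lemma flow_add_edge:
  assumes "flow V m f" "x \<noteq> y" "e = 1 \<or> e = - 1"
  shows "flow V (\<lambda>u v. m u v + edge_mult x y u v) (\<lambda>u v. f u v + e * edge_flow x y u v)"
  unfolding flow_def
proof (intro ballI conjI)
  fix u v assume uv: "u \<in> V" "v \<in> V"
  have f: "f u v = - f v u" "\<bar>f u v\<bar> \<le> int (m u v)" "even (f u v + int (m u v))"
    using assms(1) uv unfolding flow_def by blast+
  show "f u v + e * edge_flow x y u v = - (f v u + e * edge_flow x y v u)"
    using f(1) assms(2) by (auto simp: edge_flow_def)
  show "\<bar>f u v + e * edge_flow x y u v\<bar> \<le> int (m u v + edge_mult x y u v)"
    using f(2) assms(2,3) by (auto simp: edge_flow_def edge_mult_def)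
  show "even (f u v + e * edge_flow x y u v + int (m u v + edge_mult x y u v))"
    using f(3) assms(2,3) by (auto simp: edge_flow_def edge_mult_def)
qed

lemma flow_remove_edge:
  assumes fl: "flow V (\<lambda>u v. m u v + edge_mult x y u v) f" and "x \<noteq> y" "x \<in> V" "y \<in> V"
  obtains e f0 where "e = 1 \<or> e = - 1" "flow V m f0" "f = (\<lambda>u v. f0 u v + e * edge_flow x y u v)"
proof -
  \<comment> \<open>The removed edge is taken in the prevailing direction. A tie means that
    \<open>m x y + 1\<close> is even, so some edge does point from y to x.\<close>
  define e :: int where "e = (if f x y > 0 then 1 else - 1)"
  let ?f0 = "\<lambda>u v. f u v - e * edge_flow x y u v"
  have "flow V m ?f0"
    unfolding flow_def
  proof (intro ballI conjI)
    fix u v assume uv: "u \<in> V" "v \<in> V"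
    have f: "f u v = - f v u" "\<bar>f u v\<bar> \<le> int (m u v + edge_mult x y u v)" "even (f u v + int (m u v + edge_mult x y u v))"
      using fl uv unfolding flow_def by blast+
    have fxy: "f x y = - f y x" using fl assms unfolding flow_def by blast
    show "f u v - e * edge_flow x y u v = - (f v u - e * edge_flow x y v u)"
      using f(1) assms(2) by (auto simp: edge_flow_def)
    show ev: "even (f u v - e * edge_flow x y u v + int (m u v))"
      using f(3) assms(2) by (auto simp: edge_flow_def edge_mult_def e_def)
    consider "u = x \<and> v = y" | "u = y \<and> v = x" | "\<not> (u = x \<and> v = y \<or> u = y \<and> v = x)" by blast
    then show "\<bar>f u v - e * edge_flow x y u v\<bar> \<le> int (m u v)"
    proof cases
      case 1
      then have "\<bar>f x y\<bar> \<le> int (m x y) + 1" "even (f x y + (int (m x y) + 1))"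
        using f(2,3) by (simp_all add: edge_mult_def add_ac)
      then have "\<bar>f x y - e\<bar> \<le> int (m x y)" unfolding e_def by (auto; presburger)
      then show ?thesis using 1 by (simp add: edge_flow_def)
    next
      case 2
      then have "\<bar>f y x\<bar> \<le> int (m y x) + 1" "even (f y x + (int (m y x) + 1))"
        using f(2,3) by (simp_all add: edge_mult_def add_ac)
      then have "\<bar>f y x + e\<bar> \<le> int (m y x)" unfolding e_def fxy by (auto; presburger)
      then show ?thesis using 2 assms(2) by (simp add: edge_flow_def)
    next
      case 3
      then have "edge_flow x y u v = 0" "edge_mult x y u v = 0"
        unfolding edge_flow_def edge_mult_def by argo+
      then show ?thesis using f(2) by simp
    qed
  qed
  moreover have "e = 1 \<or> e = - 1" by (simp add: e_def)
  ultimately show ?thesis using that[of e ?f0] by auto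
qed

text \<open>An edge directed from y to z unfolds to a path from y through x to z. Then x gains one
  edge in and one edge out, so no net outflow changes; this is how solutions are pulled back through
  liftings.\<close>

lemma flow_unlift:
  assumes fl: "flow V (\<lambda>u v. m u v + edge_mult y z u v) f"
    and V: "finite V" "x \<in> V" "y \<in> V" "z \<in> V" and d: "x \<noteq> y" "x \<noteq> z" "y \<noteq> z"
  obtains g where "flow V (\<lambda>u v. m u v + edge_mult x y u v + edge_mult x z u v) g"
    "\<And>u. (\<Sum>v\<in>V. g u v) = (\<Sum>v\<in>V. f u v)"
proof -
  obtain e f0 where e: "e = 1 \<or> e = - 1" and f0: "flow V m f0" and f: "f = (\<lambda>u v. f0 u v + e * edge_flow y z u v)"
    using flow_remove_edge[OF fl d(3) V(3,4)] by blast
  let ?g = "\<lambda>u v. f0 u v + (- e) * edge_flow x y u v + e * edge_flow x z u v"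
  have "flow V (\<lambda>u v. m u v + edge_mult x y u v + edge_mult x z u v) ?g"
    using e by (intro flow_add_edge f0 d) auto
  moreover have "(\<Sum>v\<in>V. ?g u v) = (\<Sum>v\<in>V. f u v)" for u
    unfolding f sum.distrib sum_distrib_left[symmetric]
    using V d by (simp add: sum_edge_flow)
  ultimately show ?thesis using that by blast
qed

text \<open>Serves to distribute the net flow through a contracted bundle of edges over the bundles
  it came from. One of them takes exactly what the others cannot carry, or, if they can carry
  everything, only 0 or 1 in absolute value, as its parity demands.\<close>

lemma split_int:
  fixes m :: "'a \<Rightarrow> nat"
  assumes "finite A" "\<bar>F\<bar> \<le> int (sum m A)" "even (F + int (sum m A))"
  shows "\<exists>f. (\<forall>u\<in>A. \<bar>f u\<bar> \<le> int (m u) \<and> even (f u + int (m u))) \<and> sum f A = F"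
  using assms
proof (induction A arbitrary: F rule: finite_induct)
  case (insert a A)
  define M where "M = int (sum m A)"
  have "\<exists>c. \<bar>c\<bar> \<le> int (m a) \<and> even (c + int (m a)) \<and> \<bar>F - c\<bar> \<le> M"
  proof -
    have M0: "M \<ge> 0" by (simp add: M_def del: of_nat_sum)
    have "int (sum m (insert a A)) = int (m a) + M" using insert.hyps by (simp add: M_def)
    then have h: "\<bar>F\<bar> \<le> int (m a) + M" "even (F + (int (m a) + M))"
      using insert.prems by (simp_all only:)
    consider "F \<ge> M" | "F \<le> - M" | "\<bar>F\<bar> < M" by linarith
    then show ?thesis
    proof cases
      case 1 then show ?thesis using h M0 by (intro exI[of _ "F - M"]) (auto; presburger)
    next
      case 2 then show ?thesis using h M0 by (intro exI[of _ "F + M"]) (auto; presburger)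
    next
      case 3
      show ?thesis
      proof (cases "even (m a)")
        case True then show ?thesis using 3 by (intro exI[of _ 0]) auto
      next
        case False
        then have "m a \<ge> 1" by presburger
        then show ?thesis using 3 False
          by (intro exI[of _ "if F > 0 then 1 else - 1"]) auto
      qed
    qed
  qed
  then obtain c where c: "\<bar>c\<bar> \<le> int (m a)" "even (c + int (m a))" "\<bar>F - c\<bar> \<le> M" by blast
  have "int (sum m (insert a A)) = int (m a) + M" using insert.hyps by (simp add: M_def)
  then have "even (F + (int (m a) + M))" using insert.prems by (simp only:)
  then have "even (F - c + M)" using c(2) by presburger
  then obtain f where f: "\<forall>u\<in>A. \<bar>f u\<bar> \<le> int (m u) \<and> even (f u + int (m u))" "sum f A = F - c"
    using insert.IH c(3) unfolding M_def by blast
  have "sum (f(a := c)) A = sum f A" using insert.hyps by (intro sum.cong) auto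
  then show ?case using f c insert.hyps by (intro exI[of _ "f(a := c)"]) auto
qed auto

lemma bounded_residue:
  fixes x :: int
  shows "\<exists>t. [t = x] (mod 2 * (int n + 1)) \<and> \<bar>t\<bar> \<le> int n + 1"
proof -
  define M where "M = 2 * (int n + 1)"
  define r where "r = x mod M"
  have r: "0 \<le> r" "r < M" by (auto simp: r_def M_def)
  have c: "[r = x] (mod M)" "[r - M = x] (mod M)"
    by (auto simp: r_def cong_def)
  show ?thesis
  proof (cases "r \<le> int n + 1")
    case True then show ?thesis using c r unfolding M_def by (intro exI[of _ r]) auto
  next
    case False then show ?thesis using c r unfolding M_def by (intro exI[of _ "r - M"]) (auto simp: M_def)
  qed
qed

lemma cong_double_parity: "[a = b] (mod 2 * (c::int)) \<Longrightarrow> even a \<longleftrightarrow> even b"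
  by (metis cong_dvd_iff cong_modulus_mult)

text \<open>A bundle of m parallel edges realises the values -m, -m + 2, ..., m, and n + 1
  consecutive ones of these meet every residue of their parity modulo 2(n + 1). A representative of
  size at most n + 1 fits unless m = n and its size is n + 1, which has the wrong parity.\<close>

lemma parallel_residue:
  fixes r :: int and m :: nat
  assumes "n \<le> m" "even (r + int m)"
  shows "\<exists>f. \<bar>f\<bar> \<le> int m \<and> even (f + int m) \<and> [f = r] (mod 2 * (int n + 1))"
proof -
  obtain t where t: "[t = r] (mod 2 * (int n + 1))" "\<bar>t\<bar> \<le> int n + 1" using bounded_residue by blast
  have e: "even (t + int m)" using cong_double_parity[OF t(1)] assms by simp
  have "\<bar>t\<bar> \<le> int m"
  proof (rule ccontr)
    assume "\<not> \<bar>t\<bar> \<le> int m"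
    then have "m = n" "\<bar>t\<bar> = int n + 1" using t assms by auto
    then show False using e by (auto simp: abs_if split: if_splits; presburger)
  qed
  then show ?thesis using t e by blast
qed

subsection \<open>Graphs with stubs and their contraction\<close>

definition solvable :: "nat \<Rightarrow> 'v set \<Rightarrow> ('v \<Rightarrow> 'v \<Rightarrow> nat) \<Rightarrow> ('v \<Rightarrow> int) \<Rightarrow> bool" where
  "solvable n V m \<beta> \<longleftrightarrow>
     (\<exists>f. flow V m f \<and> (\<forall>u\<in>V. [(\<Sum>v\<in>V. f u v) = \<beta> u] (mod 2 * (int n + 1))))"

text \<open>
  The stubs \<open>s x\<close> and \<open>t x\<close> count edges at x whose other end has been removed and which have been
  directed towards x and away from x; \<open>b x\<close> is the net outflow wanted at x including them. With
  k = n + 1 the modulus is 2k because a net outflow has the parity of the degree. Keeping the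
  residue as an integer \<open>b x\<close> in the degree condition makes it harmless to delete an edge directed
  from a vertex with positive to one with negative demand. The separate bounds on \<open>s\<close> and \<open>t\<close>
  matter: vertices are removed at the cost of new stubs only when no stubs of that kind are left.
\<close>

definition stub_graph ::
  "nat \<Rightarrow> 'v set \<Rightarrow> ('v \<Rightarrow> 'v \<Rightarrow> nat) \<Rightarrow> ('v \<Rightarrow> int) \<Rightarrow> ('v \<Rightarrow> nat) \<Rightarrow> ('v \<Rightarrow> nat) \<Rightarrow> bool" where
  "stub_graph n V m b s t \<longleftrightarrow> finite V \<and> multigraph m \<and>
     (\<forall>x\<in>V. 12 * int n + 4 + \<bar>b x\<bar> \<le> int (wdeg m V x + s x + t x)) \<and>
     (\<forall>x\<in>V. even (int (wdeg m V x + s x + t x) + b x)) \<and>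
     [(\<Sum>x\<in>V. b x + int (s x) - int (t x)) = 0] (mod 2 * (int n + 1)) \<and>
     sum s V \<le> 20 * n + 7 \<and> sum t V \<le> 20 * n + 7 \<and> sum s V + sum t V \<le> 22 * n + 9 \<and>
     (\<forall>A\<subseteq>V. 2 \<le> card A \<longrightarrow> A \<noteq> V \<longrightarrow> 13 * n + 5 \<le> wcut m V A + sum s A + sum t A)"

lemma stub_graphD:
  assumes "stub_graph n V m b s t"
  shows "finite V" "multigraph m"
    "\<And>x. x \<in> V \<Longrightarrow> 12 * int n + 4 + \<bar>b x\<bar> \<le> int (wdeg m V x + s x + t x)"
    "\<And>x. x \<in> V \<Longrightarrow> even (int (wdeg m V x + s x + t x) + b x)"
    "[(\<Sum>x\<in>V. b x + int (s x) - int (t x)) = 0] (mod 2 * (int n + 1))"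
    "sum s V \<le> 20 * n + 7" "sum t V \<le> 20 * n + 7" "sum s V + sum t V \<le> 22 * n + 9"
    "\<And>A. A \<subseteq> V \<Longrightarrow> 2 \<le> card A \<Longrightarrow> A \<noteq> V \<Longrightarrow> 13 * n + 5 \<le> wcut m V A + sum s A + sum t A"
  using assms unfolding stub_graph_def by blast+

lemma even_double_sum:
  assumes "multigraph m" "finite A"
  shows "even (\<Sum>u\<in>A. \<Sum>v\<in>A. m u v)"
  using assms(2)
proof (induction A rule: finite_induct)
  case (insert a A)
  have "(\<Sum>u\<in>insert a A. \<Sum>v\<in>insert a A. m u v) = (\<Sum>v\<in>A. m a v) + (\<Sum>u\<in>A. m u a) + (\<Sum>u\<in>A. \<Sum>v\<in>A. m u v)"
    using insert.hyps assms(1) by (simp add: sum.distrib multigraph_def)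
  moreover have "(\<Sum>u\<in>A. m u a) = (\<Sum>v\<in>A. m a v)"
    using assms(1) by (simp add: multigraph_def)
  ultimately show ?case using insert.IH by simp
qed simp

lemma sum_wdeg:
  assumes "finite V" "A \<subseteq> V"
  shows "(\<Sum>u\<in>A. wdeg m V u) = wcut m V A + (\<Sum>u\<in>A. \<Sum>v\<in>A. m u v)"
proof -
  have "wdeg m V u = (\<Sum>v\<in>V - A. m u v) + (\<Sum>v\<in>A. m u v)" for u
    unfolding wdeg_def using sum.subset_diff[OF assms(2,1)] .
  then show ?thesis by (simp add: wcut_def sum.distrib)
qed

text \<open>The new vertex is named by a member \<open>a\<close> of A, so the vertex type does not
  change and the contracted graph lives on \<open>insert a (V - A)\<close>. Edges inside A
  disappear.\<close>

definition contract :: "'v set \<Rightarrow> 'v \<Rightarrow> ('v \<Rightarrow> 'v \<Rightarrow> nat) \<Rightarrow> 'v \<Rightarrow> 'v \<Rightarrow> nat" where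
  "contract A a m u v =
     (if u = a then (if v = a then 0 else \<Sum>w\<in>A. m w v)
      else if v = a then \<Sum>w\<in>A. m w u else m u v)"

lemma multigraph_contract: "multigraph m \<Longrightarrow> multigraph (contract A a m)"
  by (simp add: multigraph_def contract_def)

context
  fixes V A :: "'v set" and a :: 'v and m :: "'v \<Rightarrow> 'v \<Rightarrow> nat"
  assumes fin: "finite V" and AV: "A \<subseteq> V" and aA: "a \<in> A" and mg: "multigraph m"
begin

lemma wdeg_contract_other:
  assumes "u \<in> V - A"
  shows "wdeg (contract A a m) (insert a (V - A)) u = wdeg m V u"
proof -
  have "wdeg (contract A a m) (insert a (V - A)) u = (\<Sum>w\<in>A. m w u) + (\<Sum>v\<in>V - A. m u v)"
    using assms aA fin unfolding wdeg_def
    by (subst sum.insert) (auto simp: contract_def intro!: sum.cong)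
  also have "(\<Sum>w\<in>A. m w u) = (\<Sum>w\<in>A. m u w)"
    using mg by (simp add: multigraph_def)
  finally show ?thesis
    unfolding wdeg_def using sum.subset_diff[OF AV fin, of "m u"] by simp
qed

lemma wdeg_contract_self:
  "wdeg (contract A a m) (insert a (V - A)) a = wcut m V A"
proof -
  have "wdeg (contract A a m) (insert a (V - A)) a = (\<Sum>v\<in>V - A. \<Sum>w\<in>A. m w v)"
    using aA fin unfolding wdeg_def
    by (subst sum.insert) (auto simp: contract_def intro!: sum.cong)
  then show ?thesis unfolding wcut_def by (metis sum.swap)
qed

lemma wcut_contract_without:
  assumes "B \<subseteq> V - A"
  shows "wcut (contract A a m) (insert a (V - A)) B = wcut m V B"
  unfolding wcut_def
proof (rule sum.cong[OF refl])
  fix u assume u: "u \<in> B"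
  have e: "insert a (V - A) - B = insert a (V - A - B)" using aA assms by auto
  have "(\<Sum>v\<in>insert a (V - A) - B. contract A a m u v) = (\<Sum>w\<in>A. m w u) + (\<Sum>v\<in>V - A - B. m u v)"
    using assms u aA fin unfolding e by (subst sum.insert) (auto simp: contract_def intro!: sum.cong)
  also have "(\<Sum>w\<in>A. m w u) = (\<Sum>w\<in>A. m u w)"
    using mg by (simp add: multigraph_def)
  also have "(\<Sum>w\<in>A. m u w) + (\<Sum>v\<in>V - A - B. m u v) = sum (m u) (A \<union> (V - A - B))"
    using fin AV finite_subset[OF AV] by (intro sum.union_disjoint[symmetric]) auto
  also have "A \<union> (V - A - B) = V - B" using AV assms by auto
  finally show "(\<Sum>v\<in>insert a (V - A) - B. contract A a m u v) = (\<Sum>v\<in>V - B. m u v)" .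
qed

lemma wcut_contract_with:
  assumes "B \<subseteq> V - A"
  shows "wcut (contract A a m) (insert a (V - A)) (insert a B) = wcut m V (A \<union> B)"
proof -
  have fB: "finite B" "finite A" using assms fin AV finite_subset by blast+
  have e: "insert a (V - A) - insert a B = V - (A \<union> B)" using aA assms by auto
  have "wcut (contract A a m) (insert a (V - A)) (insert a B) =
      (\<Sum>v\<in>V - (A \<union> B). \<Sum>w\<in>A. m w v) + (\<Sum>u\<in>B. \<Sum>v\<in>V - (A \<union> B). m u v)"
  proof -
    have 1: "(\<Sum>v\<in>V - (A \<union> B). contract A a m a v) = (\<Sum>v\<in>V - (A \<union> B). \<Sum>w\<in>A. m w v)"
      by (rule sum.cong[OF refl]) (use aA in \<open>auto simp: contract_def\<close>)
    have 2: "(\<Sum>v\<in>V - (A \<union> B). contract A a m u v) = (\<Sum>v\<in>V - (A \<union> B). m u v)" if "u \<in> B" for u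
      by (rule sum.cong[OF refl]) (use aA assms that in \<open>auto simp: contract_def\<close>)
    have "a \<notin> B" using aA assms by auto
    then show ?thesis unfolding wcut_def e using fB 1 2 by simp
  qed
  also have "(\<Sum>v\<in>V - (A \<union> B). \<Sum>w\<in>A. m w v) = (\<Sum>w\<in>A. \<Sum>v\<in>V - (A \<union> B). m w v)" by (rule sum.swap)
  finally show ?thesis
    unfolding wcut_def using assms fB by (subst sum.union_disjoint) auto
qed

end

text \<open>The new vertex inherits the whole boundary of A, stubs included, as its degree: at least
  13n + 5 = 12n + 4 + (n + 1), while its demand can be reduced to size at most n + 1. This is the
  origin of the bound on cuts. Its parity is right because edges inside A contribute twice to the
  degree sum, and cuts of the contraction are cuts of the original graph.\<close>

lemma stub_graph_contract:
  assumes st: "stub_graph n V m b s t" and A: "A \<subseteq> V" "2 \<le> card A" "A \<noteq> V" "a \<in> A"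
    and t0: "[t0 = (\<Sum>x\<in>A. b x)] (mod 2 * (int n + 1))" "\<bar>t0\<bar> \<le> int n + 1"
  shows "stub_graph n (insert a (V - A)) (contract A a m) (b(a := t0)) (s(a := sum s A)) (t(a := sum t A))"
proof -
  let ?W = "insert a (V - A)" and ?m = "contract A a m" and ?b = "b(a := t0)" and ?s = "s(a := sum s A)" and ?t = "t(a := sum t A)"
  have fin: "finite V" and mg: "multigraph m" and S: "\<And>x. x \<in> V \<Longrightarrow> 12 * int n + 4 + \<bar>b x\<bar> \<le> int (wdeg m V x + s x + t x)"
    and par: "\<And>x. x \<in> V \<Longrightarrow> even (int (wdeg m V x + s x + t x) + b x)"
    and tot: "[(\<Sum>x\<in>V. b x + int (s x) - int (t x)) = 0] (mod 2 * (int n + 1))"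
    and caps: "sum s V \<le> 20 * n + 7" "sum t V \<le> 20 * n + 7" "sum s V + sum t V \<le> 22 * n + 9"
    and C: "\<And>B. B \<subseteq> V \<Longrightarrow> 2 \<le> card B \<Longrightarrow> B \<noteq> V \<Longrightarrow> 13 * n + 5 \<le> wcut m V B + sum s B + sum t B"
    using st unfolding stub_graph_def by blast+
  note ctx = fin A(1) A(4) mg
  have fA: "finite A" using A fin finite_subset by blast
  have sumW: "sum (h(a := c)) ?W = c + sum h (V - A)" for h :: "'a \<Rightarrow> 'c::comm_monoid_add" and c
  proof -
    have "sum (h(a := c)) (V - A) = sum h (V - A)" using A(4) by (intro sum.cong) auto
    then show ?thesis using fin A(4) by simp
  qed
  have sumB: "sum (h(a := c)) B = sum h B" if "B \<subseteq> V - A" for h :: "'a \<Rightarrow> nat" and c B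
    using that A(4) by (intro sum.cong) auto
  have sumB': "sum (h(a := sum h A)) (insert a B) = sum h (A \<union> B)" if "B \<subseteq> V - A" for h :: "'a \<Rightarrow> nat" and B
  proof -
    have "finite B" "a \<notin> B" "A \<inter> B = {}" using that fin A(4) finite_subset by auto
    then show ?thesis using sumB[OF that] fA by (simp add: sum.union_disjoint)
  qed
  have spl: "sum h V = sum h A + sum h (V - A)" for h :: "'a \<Rightarrow> 'c::comm_monoid_add"
    using sum.subset_diff[OF A(1) fin, of h] by (simp add: add.commute)
  have CA: "13 * n + 5 \<le> wcut m V A + sum s A + sum t A" using C A by blast
  have da: "wdeg ?m ?W a + ?s a + ?t a = wcut m V A + sum s A + sum t A"
    by (simp add: wdeg_contract_self[OF ctx])
  have do: "wdeg ?m ?W x + ?s x + ?t x = wdeg m V x + s x + t x" "?b x = b x" if "x \<in> V - A" for x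
  proof -
    have "x \<noteq> a" using that A(4) by auto
    then show "wdeg ?m ?W x + ?s x + ?t x = wdeg m V x + s x + t x" "?b x = b x"
      by (simp_all add: wdeg_contract_other[OF ctx that])
  qed
  show ?thesis
    unfolding stub_graph_def
  proof (intro conjI ballI allI impI)
    show "finite ?W" using fin by simp
    show "multigraph ?m" by (rule multigraph_contract[OF mg])
    show "12 * int n + 4 + \<bar>?b x\<bar> \<le> int (wdeg ?m ?W x + ?s x + ?t x)" if x: "x \<in> ?W" for x
    proof (cases "x = a")
      case True then show ?thesis unfolding True da using CA t0(2) by (simp del: of_nat_sum)
    next
      case False then show ?thesis using do[of x] S[of x] x by auto
    qed
    show "even (int (wdeg ?m ?W x + ?s x + ?t x) + ?b x)" if x: "x \<in> ?W" for x
    proof (cases "x = a")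
      case True
      have "even (\<Sum>x\<in>A. int (wdeg m V x + s x + t x) + b x)"
        by (intro dvd_sum) (use par A in auto)
      then have "even (int (wcut m V A + (\<Sum>u\<in>A. \<Sum>v\<in>A. m u v) + sum s A + sum t A) + (\<Sum>x\<in>A. b x))"
        unfolding sum.distrib of_nat_sum[symmetric] sum_wdeg[OF fin A(1)] .
      then have "even (int (wcut m V A + sum s A + sum t A) + (\<Sum>x\<in>A. b x))"
        using even_double_sum[OF mg fA] by (simp del: of_nat_sum)
      then show ?thesis unfolding True da using cong_double_parity[OF t0(1)] by simp
    next
      case False then show ?thesis using do[of x] par[of x] x by auto
    qed
    show "[(\<Sum>x\<in>?W. ?b x + int (?s x) - int (?t x)) = 0] (mod 2 * (int n + 1))"
    proof -
      have "(\<Sum>x\<in>?W. ?b x + int (?s x) - int (?t x)) = sum ?b ?W + int (sum ?s ?W) - int (sum ?t ?W)"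
        by (simp only: sum.distrib sum_subtractf of_nat_sum)
      also have "\<dots> = t0 + sum b (V - A) + int (sum s V) - int (sum t V)"
        unfolding sumW spl[of s] spl[of t] by simp
      also have "[\<dots> = sum b A + sum b (V - A) + int (sum s V) - int (sum t V)] (mod 2 * (int n + 1))"
        using t0(1) by (intro cong_add cong_diff cong_refl)
      also have "sum b A + sum b (V - A) + int (sum s V) - int (sum t V) = (\<Sum>x\<in>V. b x + int (s x) - int (t x))"
        by (simp only: sum.distrib sum_subtractf of_nat_sum spl[of b])
      finally show ?thesis using tot cong_trans by blast
    qed
    show "sum ?s ?W \<le> 20 * n + 7" "sum ?t ?W \<le> 20 * n + 7" "sum ?s ?W + sum ?t ?W \<le> 22 * n + 9"
      unfolding sumW using caps spl[of s] spl[of t] by auto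
    fix B assume B: "B \<subseteq> ?W" "2 \<le> card B" "B \<noteq> ?W"
    show "13 * n + 5 \<le> wcut ?m ?W B + sum ?s B + sum ?t B"
    proof (cases "a \<in> B")
      case False
      then have BV: "B \<subseteq> V - A" using B by auto
      then have "B \<noteq> V" using A by auto
      then show ?thesis using C[of B] B(2) BV sumB[OF BV] wcut_contract_without[OF ctx BV] by auto
    next
      case True
      define B0 where "B0 = B - {a}"
      have B0: "B0 \<subseteq> V - A" "B = insert a B0" using B True by (auto simp: B0_def)
      have "A \<union> B0 \<subseteq> V" "A \<union> B0 \<noteq> V" using A B B0 by auto
      moreover have "2 \<le> card (A \<union> B0)"
        using card_mono[of "A \<union> B0" A] fA finite_subset[OF B0(1)] fin A(2) by auto
      ultimately show ?thesis
        unfolding B0(2) wcut_contract_with[OF ctx B0(1)] sumB'[OF B0(1)] using C by blast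
    qed
  qed
qed

text \<open>A solution of the contraction decides the net flow from A to each outside vertex.
  Spreading it over the individual boundary edges turns these into stubs and leaves a problem on A
  alone with the same degrees and boundaries. The caps on stubs are not part of the conclusion: they
  have to come from a small boundary of A, or the inner problem has to be solved directly.\<close>

lemma contraction_extends:
  fixes V :: "'v set"
  assumes st: "stub_graph n V m b s t" and A: "A \<subseteq> V" "2 \<le> card A" "A \<noteq> V"
    and IH: "\<And>(V' :: 'v set) m' b' s' t'. stub_graph n V' m' b' s' t' \<Longrightarrow> card V' < card V \<Longrightarrow>
      solvable n V' m' (\<lambda>x. b' x + int (s' x) - int (t' x))"
  obtains s' t' where
    "\<And>x. x \<in> A \<Longrightarrow> wdeg m A x + s' x + t' x = wdeg m V x + s x + t x"
    "[(\<Sum>x\<in>A. b x + int (s' x) - int (t' x)) = 0] (mod 2 * (int n + 1))"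
    "\<And>B. B \<subseteq> A \<Longrightarrow> wcut m A B + sum s' B + sum t' B = wcut m V B + sum s B + sum t B"
    "solvable n A m (\<lambda>x. b x + int (s' x) - int (t' x)) \<Longrightarrow> solvable n V m (\<lambda>x. b x + int (s x) - int (t x))"
proof -
  have fin: "finite V" and mg: "multigraph m"
    and tot: "[(\<Sum>x\<in>V. b x + int (s x) - int (t x)) = 0] (mod 2 * (int n + 1))"
    using st unfolding stub_graph_def by blast+
  have fA: "finite A" using A fin finite_subset by blast
  obtain a where aA: "a \<in> A" using A(2) by fastforce
  obtain t0 where t0: "[t0 = (\<Sum>x\<in>A. b x)] (mod 2 * (int n + 1))" "\<bar>t0\<bar> \<le> int n + 1"
    using bounded_residue by blast
  let ?W = "insert a (V - A)" and ?m = "contract A a m" and ?b = "b(a := t0)" and ?s = "s(a := sum s A)" and ?t = "t(a := sum t A)"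
  let ?\<beta> = "\<lambda>x. b x + int (s x) - int (t x)"
  have "card ?W < card V"
  proof -
    have "card ?W = card (V - A) + 1" using aA fin by simp
    moreover have "card (V - A) = card V - card A" using A fA by (simp add: card_Diff_subset)
    moreover have "card A \<le> card V" using A fin card_mono by blast
    ultimately show ?thesis using A(2) by simp
  qed
  then have "solvable n ?W ?m (\<lambda>x. ?b x + int (?s x) - int (?t x))"
    by (rule IH[OF stub_graph_contract[OF st A aA t0]])
  then obtain f1 where f1: "flow ?W ?m f1"
    and f1s: "\<And>u. u \<in> ?W \<Longrightarrow> [(\<Sum>v\<in>?W. f1 u v) = ?b u + int (?s u) - int (?t u)] (mod 2 * (int n + 1))"
    unfolding solvable_def by blast
  have "\<exists>g. (\<forall>u\<in>A. \<bar>g u\<bar> \<le> int (m u v) \<and> even (g u + int (m u v))) \<and> sum g A = f1 a v" if v: "v \<in> V - A" for v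
  proof (rule split_int[OF fA])
    have "?m a v = (\<Sum>w\<in>A. m w v)" using v aA by (auto simp: contract_def)
    moreover have "\<bar>f1 a v\<bar> \<le> int (?m a v)" "even (f1 a v + int (?m a v))"
      using f1 v unfolding flow_def by blast+
    ultimately show "\<bar>f1 a v\<bar> \<le> int (\<Sum>w\<in>A. m w v)" "even (f1 a v + int (\<Sum>w\<in>A. m w v))" by simp_all
  qed
  then obtain g where g: "\<And>v u. v \<in> V - A \<Longrightarrow> u \<in> A \<Longrightarrow> \<bar>g v u\<bar> \<le> int (m u v) \<and> even (g v u + int (m u v))"
    and gs: "\<And>v. v \<in> V - A \<Longrightarrow> sum (g v) A = f1 a v"
    by metis
  \<comment> \<open>\<open>g v u\<close> is the net flow from u to v, so \<open>p\<close> counts the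
    edges that leave u and \<open>q\<close> those that enter it. The entering ones join
    \<open>s\<close>, the leaving ones \<open>t\<close>.\<close>
  define p where "p u v = nat ((int (m u v) + g v u) div 2)" for u v
  define q where "q u v = nat ((int (m u v) - g v u) div 2)" for u v
  have pq: "p u v + q u v = m u v" "int (p u v) - int (q u v) = g v u" if "u \<in> A" "v \<in> V - A" for u v
  proof -
    have "\<bar>g v u\<bar> \<le> int (m u v)" "even (g v u + int (m u v))" using g that by blast+
    then have "int (p u v) = (int (m u v) + g v u) div 2" "int (q u v) = (int (m u v) - g v u) div 2"
      "2 * ((int (m u v) + g v u) div 2) = int (m u v) + g v u" "2 * ((int (m u v) - g v u) div 2) = int (m u v) - g v u"
      unfolding p_def q_def by (auto simp: add.commute)
    then show "p u v + q u v = m u v" "int (p u v) - int (q u v) = g v u" by linarith+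
  qed
  define s' where "s' u = s u + (\<Sum>v\<in>V - A. q u v)" for u
  define t' where "t' u = t u + (\<Sum>v\<in>V - A. p u v)" for u
  have st': "s' u + t' u = s u + t u + (\<Sum>v\<in>V - A. m u v)" if "u \<in> A" for u
    unfolding s'_def t'_def using that by (simp add: pq(1)[symmetric] sum.distrib)
  have \<beta>': "b u + int (s' u) - int (t' u) = ?\<beta> u - (\<Sum>v\<in>V - A. g v u)" if "u \<in> A" for u
    unfolding s'_def t'_def using that by (simp add: pq(2)[symmetric] sum_subtractf)
  have f1\<beta>: "[(\<Sum>v\<in>V - A. f1 a v) = (\<Sum>u\<in>A. ?\<beta> u)] (mod 2 * (int n + 1))"
  proof -
    have faa: "f1 a a = 0" using f1 unfolding flow_def by (metis insertI1 equal_neg_zero)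
    have "(\<Sum>v\<in>V - A. f1 a v) = (\<Sum>v\<in>?W. f1 a v)" using fin aA faa by simp
    also have "[\<dots> = ?b a + int (?s a) - int (?t a)] (mod 2 * (int n + 1))" using f1s by blast
    also have "?b a + int (?s a) - int (?t a) = t0 + int (sum s A) - int (sum t A)" by simp
    also have "[\<dots> = (\<Sum>x\<in>A. b x) + int (sum s A) - int (sum t A)] (mod 2 * (int n + 1))"
      using t0(1) by (intro cong_add cong_diff cong_refl)
    also have "(\<Sum>x\<in>A. b x) + int (sum s A) - int (sum t A) = (\<Sum>u\<in>A. ?\<beta> u)"
      by (simp add: sum.distrib sum_subtractf)
    finally show ?thesis .
  qed
  show ?thesis
  proof (rule that)
    show "wdeg m A x + s' x + t' x = wdeg m V x + s x + t x" if "x \<in> A" for x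
      using st'[OF that] sum.subset_diff[OF A(1) fin, of "m x"] unfolding wdeg_def by simp
    show "[(\<Sum>x\<in>A. b x + int (s' x) - int (t' x)) = 0] (mod 2 * (int n + 1))"
    proof -
      have "(\<Sum>x\<in>A. b x + int (s' x) - int (t' x)) = (\<Sum>x\<in>A. ?\<beta> x) - (\<Sum>x\<in>A. \<Sum>v\<in>V - A. g v x)"
        by (subst sum_subtractf[symmetric]) (intro sum.cong refl \<beta>')
      also have "(\<Sum>x\<in>A. \<Sum>v\<in>V - A. g v x) = (\<Sum>v\<in>V - A. f1 a v)"
        by (subst sum.swap) (intro sum.cong refl gs)
      also have "[(\<Sum>x\<in>A. ?\<beta> x) - (\<Sum>v\<in>V - A. f1 a v) = (\<Sum>x\<in>A. ?\<beta> x) - (\<Sum>x\<in>A. ?\<beta> x)] (mod 2 * (int n + 1))"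
        by (intro cong_diff cong_refl f1\<beta>)
      finally show ?thesis by simp
    qed
    show "wcut m A B + sum s' B + sum t' B = wcut m V B + sum s B + sum t B" if B: "B \<subseteq> A" for B
    proof -
      have fB: "finite B" using B fA finite_subset by blast
      have "sum s' B + sum t' B = (\<Sum>u\<in>B. s' u + t' u)" by (simp add: sum.distrib)
      also have "\<dots> = (\<Sum>u\<in>B. s u + t u + (\<Sum>v\<in>V - A. m u v))"
        using B by (intro sum.cong refl st') auto
      finally have 1: "sum s' B + sum t' B = sum s B + sum t B + (\<Sum>u\<in>B. \<Sum>v\<in>V - A. m u v)"
        by (simp add: sum.distrib)
      have "(\<Sum>v\<in>V - B. m u v) = (\<Sum>v\<in>A - B. m u v) + (\<Sum>v\<in>V - A. m u v)" for u
      proof -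
        have "V - B = (A - B) \<union> (V - A)" using A B by auto
        moreover have "sum (m u) ((A - B) \<union> (V - A)) = sum (m u) (A - B) + sum (m u) (V - A)"
          using fin fA by (intro sum.union_disjoint) auto
        ultimately show ?thesis by simp
      qed
      then have "wcut m V B = wcut m A B + (\<Sum>u\<in>B. \<Sum>v\<in>V - A. m u v)"
        unfolding wcut_def by (simp add: sum.distrib)
      then show ?thesis using 1 by simp
    qed
    assume "solvable n A m (\<lambda>x. b x + int (s' x) - int (t' x))"
    then obtain h where h: "flow A m h"
      and hs: "\<And>u. u \<in> A \<Longrightarrow> [(\<Sum>v\<in>A. h u v) = b u + int (s' u) - int (t' u)] (mod 2 * (int n + 1))"
      unfolding solvable_def by blast
    define f where "f u v = (if u \<in> A then (if v \<in> A then h u v else g v u)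
       else if v \<in> A then - g u v else f1 u v)" for u v
    have spl: "sum k V = sum k A + sum k (V - A)" for k :: "'v \<Rightarrow> int"
      using sum.subset_diff[OF A(1) fin, of k] by simp
    have "flow V m f"
      unfolding flow_def
    proof (intro ballI)
      fix u v assume uv: "u \<in> V" "v \<in> V"
      have sym: "m u v = m v u" using mg by (rule multigraph_sym)
      consider "u \<in> A" "v \<in> A" | "u \<in> A" "v \<in> V - A" | "u \<in> V - A" "v \<in> A" | "u \<in> V - A" "v \<in> V - A"
        using uv by blast
      then show "f u v = - f v u \<and> \<bar>f u v\<bar> \<le> int (m u v) \<and> even (f u v + int (m u v))"
      proof cases
        case 1
        then have "h u v = - h v u \<and> \<bar>h u v\<bar> \<le> int (m u v) \<and> even (h u v + int (m u v))"
          using h unfolding flow_def by blast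
        then show ?thesis using 1 unfolding f_def by argo
      next
        case 2 then show ?thesis using g[OF 2(2,1)] by (simp add: f_def)
      next
        case 3 then show ?thesis using g[OF 3(1,2)] sym by (simp add: f_def)
      next
        case 4
        then have ne: "u \<noteq> a" "v \<noteq> a" using aA by auto
        have "f1 u v = - f1 v u \<and> \<bar>f1 u v\<bar> \<le> int (?m u v) \<and> even (f1 u v + int (?m u v))"
          using f1 4 unfolding flow_def by blast
        moreover have "?m u v = m u v" using ne by (simp add: contract_def)
        moreover have "f u v = f1 u v" "f v u = f1 v u" using 4 by (auto simp: f_def)
        ultimately show ?thesis by metis
      qed
    qed
    moreover have "[(\<Sum>v\<in>V. f u v) = ?\<beta> u] (mod 2 * (int n + 1))" if u: "u \<in> V" for u
    proof (cases "u \<in> A")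
      case True
      have "(\<Sum>v\<in>V. f u v) = (\<Sum>v\<in>A. h u v) + (\<Sum>v\<in>V - A. g v u)"
        unfolding spl using True by (intro arg_cong2[of _ _ _ _ "(+)"] sum.cong) (auto simp: f_def)
      also have "[\<dots> = (b u + int (s' u) - int (t' u)) + (\<Sum>v\<in>V - A. g v u)] (mod 2 * (int n + 1))"
        by (intro cong_add cong_refl hs True)
      finally show ?thesis using \<beta>'[OF True] by simp
    next
      case False
      then have uVA: "u \<in> V - A" using u by blast
      have ne: "u \<noteq> a" using False aA by auto
      have "(\<Sum>v\<in>V. f u v) = (\<Sum>v\<in>A. - g u v) + (\<Sum>v\<in>V - A. f1 u v)"
        unfolding spl using False by (intro arg_cong2[of _ _ _ _ "(+)"] sum.cong) (auto simp: f_def)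
      also have "(\<Sum>v\<in>A. - g u v) = f1 u a"
      proof -
        have "f1 a u = - f1 u a" using f1 uVA unfolding flow_def by blast
        then show ?thesis using gs[OF uVA] by (simp add: sum_negf)
      qed
      also have "f1 u a + (\<Sum>v\<in>V - A. f1 u v) = (\<Sum>v\<in>?W. f1 u v)" using fin aA by simp
      also have "[\<dots> = ?b u + int (?s u) - int (?t u)] (mod 2 * (int n + 1))" using f1s uVA by blast
      finally show ?thesis using ne by simp
    qed
    ultimately show "solvable n V m ?\<beta>" unfolding solvable_def by blast
  qed
qed

text \<open>Lifting always uses the two neighbours with the largest multiplicities. This keeps every
  multiplicity at x at most half the degree, rounded up: the two largest drop along with the degree,
  and any other is at most a third of it. Hence two different neighbours remain available until the
  target degree is reached.\<close>

lemma lift_to_degree: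
  assumes "finite V" "x \<in> V" "multigraph m" "\<And>y. y \<in> V \<Longrightarrow> 2 * m x y \<le> wdeg m V x + 1"
    and "j \<le> wdeg m V x" "even (wdeg m V x + j)"
  shows "\<exists>m'. multigraph m' \<and> wdeg m' V x = j \<and> (\<forall>y\<in>V. y \<noteq> x \<longrightarrow> wdeg m' V y = wdeg m V y) \<and>
     (\<forall>u v. u \<noteq> x \<longrightarrow> v \<noteq> x \<longrightarrow> m u v \<le> m' u v) \<and>
     (\<forall>f'. flow V m' f' \<longrightarrow> (\<exists>f. flow V m f \<and> (\<forall>u. (\<Sum>v\<in>V. f u v) = (\<Sum>v\<in>V. f' u v))))"
  using assms(3-6)
proof (induction "wdeg m V x" arbitrary: m rule: less_induct)
  case less
  show ?case
  proof (cases "j = wdeg m V x")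
    case True
    then show ?thesis using less.prems by (intro exI[of _ m]) auto
  next
    case False
    define d where "d = wdeg m V x"
    have d: "j + 2 \<le> d" using False less.prems(3,4) unfolding d_def[symmetric] by presburger
    have diag: "m x x = 0" using less.prems(1) by (simp add: multigraph_def)
    have "V \<noteq> {}" using assms(2) by blast
    then obtain y where y: "y \<in> V" "\<And>w. w \<in> V \<Longrightarrow> m x w \<le> m x y"
      using obtains_MAX[OF assms(1), of "m x"] by (metis Max_ge assms(1) finite_imageI imageI)
    have dsum: "d = m x y + (\<Sum>w\<in>V - {y}. m x w)"
      unfolding d_def wdeg_def using assms(1) y(1) by (simp add: sum.remove)
    have my: "2 * m x y \<le> d + 1" using less.prems(2) y(1) by (simp add: d_def)
    then have "(\<Sum>w\<in>V - {y}. m x w) > 0" using dsum d by linarith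
    then have ne: "V - {y} \<noteq> {}" and "\<exists>w\<in>V - {y}. m x w > 0"
      by (metis less_numeral_extra(3) sum.empty, metis gr0I less_numeral_extra(3) sum.neutral)
    then obtain w0 where w0: "w0 \<in> V - {y}" "m x w0 > 0" by blast
    have fy: "finite (V - {y})" using assms(1) by simp
    obtain z where z: "z \<in> V - {y}" "\<And>w. w \<in> V - {y} \<Longrightarrow> m x w \<le> m x z"
      using obtains_MAX[OF fy ne, of "m x"] by (metis Max_ge fy finite_imageI imageI)
    have pz: "m x z > 0" using z(2)[OF w0(1)] w0(2) by simp
    have py: "m x y > 0" using y(2)[of z] z pz by simp
    obtain m1 where m1: "multigraph m1" "m = (\<lambda>u v. m1 u v + edge_mult x y u v)" "x \<noteq> y"
      using split_edge[OF less.prems(1) py] by blast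
    have "m1 x z = m x z" using z m1(3) by (auto simp: m1(2) edge_mult_def)
    then obtain m0 where m0: "multigraph m0" "m1 = (\<lambda>u v. m0 u v + edge_mult x z u v)" "x \<noteq> z"
      using split_edge[OF m1(1)] pz by metis
    have yz: "y \<noteq> z" using z by blast
    define m' where "m' = (\<lambda>u v. m0 u v + edge_mult y z u v)"
    have mm: "m = (\<lambda>u v. m0 u v + edge_mult x y u v + edge_mult x z u v)"
      unfolding m1(2) m0(2) by (auto simp: add_ac)
    have mg': "multigraph m'" unfolding m'_def
      by (intro multigraph_add m0(1) multigraph_edge_mult yz)
    have zV: "z \<in> V" using z by blast
    have degx: "wdeg m V x = wdeg m' V x + 2" unfolding mm m'_def wdeg_add
      using assms(1,2) y(1) zV m1(3) m0(3) yz by (simp add: wdeg_edge_mult)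
    have degu: "wdeg m' V u = wdeg m V u" if "u \<noteq> x" for u unfolding mm m'_def wdeg_add
      using assms(1,2) y(1) zV m1(3) m0(3) yz that by (simp add: wdeg_edge_mult)
    have m'x: "m' x w + (if w = y then 1 else 0) + (if w = z then 1 else 0) = m x w" if "w \<noteq> x" for w
      using that m1(3) m0(3) yz unfolding mm m'_def by (simp add: edge_mult_def)
    have ge: "m u v \<le> m' u v" if "u \<noteq> x" "v \<noteq> x" for u v
      unfolding mm m'_def using that by (simp add: edge_mult_def)
    have mult: "2 * m' x w \<le> wdeg m' V x + 1" if w: "w \<in> V" for w
    proof -
      consider "w = x" | "w = y" | "w = z" | "w \<noteq> x" "w \<noteq> y" "w \<noteq> z" by blast
      then show ?thesis
      proof cases
        case 1 then show ?thesis using mg' by (simp add: multigraph_def)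
      next
        case 2 then show ?thesis using m'x[of y] m1(3) yz my degx d_def by simp
      next
        case 3 then show ?thesis using m'x[of z] m0(3) yz my degx d_def y(2)[OF zV] by simp
      next
        case 4
        have "(\<Sum>w\<in>V - {y}. m x w) = m x z + (\<Sum>w\<in>V - {y} - {z}. m x w)"
          using assms(1) z(1) by (subst sum.remove) auto
        moreover have "m x w \<le> (\<Sum>w\<in>V - {y} - {z}. m x w)"
          using assms(1) w 4 by (intro member_le_sum) auto
        moreover have "m x w \<le> m x z" "m x z \<le> m x y" using z(2)[of w] w 4 y(2)[OF zV] by auto
        ultimately have "3 * m x w \<le> d" using dsum by linarith
        moreover have "m' x w = m x w" using m'x[OF 4(1)] 4 by simp
        ultimately show ?thesis using d degx d_def by linarith
      qed
    qed
    have "wdeg m' V x < wdeg m V x" "j \<le> wdeg m' V x" "even (wdeg m' V x + j)"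
      using degx d less.prems(4) unfolding d_def by simp_all
    then obtain m2 where m2: "multigraph m2" "wdeg m2 V x = j" "\<And>y. y \<in> V \<Longrightarrow> y \<noteq> x \<Longrightarrow> wdeg m2 V y = wdeg m' V y"
      "\<And>u v. u \<noteq> x \<Longrightarrow> v \<noteq> x \<Longrightarrow> m' u v \<le> m2 u v"
      "\<And>f'. flow V m2 f' \<Longrightarrow> (\<exists>f. flow V m' f \<and> (\<forall>u. (\<Sum>v\<in>V. f u v) = (\<Sum>v\<in>V. f' u v)))"
      using less.hyps[OF _ mg' mult] by blast
    show ?thesis
    proof (intro exI[of _ m2] conjI ballI allI impI)
      show "multigraph m2" "wdeg m2 V x = j" by fact+
      show "wdeg m2 V y = wdeg m V y" if "y \<in> V" "y \<noteq> x" for y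
        using that m2(3) degu by simp
      show "m u v \<le> m2 u v" if "u \<noteq> x" "v \<noteq> x" for u v
        using that m2(4) ge le_trans by blast
      fix f' assume "flow V m2 f'"
      then obtain f where f: "flow V m' f" "\<And>u. (\<Sum>v\<in>V. f u v) = (\<Sum>v\<in>V. f' u v)" using m2(5) by blast
      obtain g where "flow V m g" "\<And>u. (\<Sum>v\<in>V. g u v) = (\<Sum>v\<in>V. f u v)"
        using flow_unlift[OF f(1)[unfolded m'_def] assms(1,2) y(1) zV m1(3) m0(3) yz] unfolding mm by blast
      then show "\<exists>f. flow V m f \<and> (\<forall>u. (\<Sum>v\<in>V. f u v) = (\<Sum>v\<in>V. f' u v))" using f(2) by metis
    qed
  qed
qed

subsection \<open>Orientations with prescribed out-degrees\<close>

text \<open>A set violating this has at most 20n + 7 boundary edges and stubs. That is the cap on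
  either kind of stub, so after a contraction its inside is a legal stub graph however the boundary
  gets directed.\<close>

definition rigid :: "nat \<Rightarrow> 'v set \<Rightarrow> ('v \<Rightarrow> 'v \<Rightarrow> nat) \<Rightarrow> ('v \<Rightarrow> nat) \<Rightarrow> ('v \<Rightarrow> nat) \<Rightarrow> bool" where
  "rigid n V m s t \<longleftrightarrow>
     (\<forall>A\<subseteq>V. 2 \<le> card A \<longrightarrow> A \<noteq> V \<longrightarrow> 20 * n + 8 \<le> wcut m V A + sum s A + sum t A)"

text \<open>
  All edges at x but \<open>\<bar>\<nu>\<bar>\<close> are lifted in pairs, the others become stubs, so that degrees and demands
  elsewhere do not change. For a set A the cut survives because A and \<open>insert x A\<close> are both beyond
  the contraction threshold, and the edges from x to A and to its complement are together few.
\<close>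

lemma remove_vertex:
  assumes st: "stub_graph n V m b s t" and rig: "rigid n V m s t" and x: "x \<in> V"
    and \<nu>: "[\<nu> = b x + int (s x) - int (t x)] (mod 2 * (int n + 1))" "\<bar>\<nu>\<bar> \<le> int (wdeg m V x)"
    and mult: "\<And>y. y \<in> V \<Longrightarrow> 2 * m x y \<le> wdeg m V x + 1"
    and small: "wdeg m V x + s x + t x \<le> 13 * n + 6"
    and caps: "sum s (V - {x}) + nat \<nu> \<le> 20 * n + 7" "sum t (V - {x}) + nat (- \<nu>) \<le> 20 * n + 7"
      "sum s (V - {x}) + sum t (V - {x}) + nat \<bar>\<nu>\<bar> \<le> 22 * n + 9"
  obtains m' s' t' where "stub_graph n (V - {x}) m' b s' t'"
    "solvable n (V - {x}) m' (\<lambda>y. b y + int (s' y) - int (t' y)) \<Longrightarrow>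
     solvable n V m (\<lambda>y. b y + int (s y) - int (t y))"
proof -
  have fin: "finite V" and mg: "multigraph m" and S: "\<And>x. x \<in> V \<Longrightarrow> 12 * int n + 4 + \<bar>b x\<bar> \<le> int (wdeg m V x + s x + t x)"
    and par: "\<And>x. x \<in> V \<Longrightarrow> even (int (wdeg m V x + s x + t x) + b x)"
    and tot: "[(\<Sum>x\<in>V. b x + int (s x) - int (t x)) = 0] (mod 2 * (int n + 1))"
    using st unfolding stub_graph_def by blast+
  have ev: "even (wdeg m V x + nat \<bar>\<nu>\<bar>)"
    using par[OF x] cong_double_parity[OF \<nu>(1)] by (auto simp: even_nat_iff; presburger)
  have "nat \<bar>\<nu>\<bar> \<le> wdeg m V x" using \<nu>(2) by linarith
  from lift_to_degree[OF fin x mg mult this ev]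
  obtain m' where mg': "multigraph m'" and dx: "wdeg m' V x = nat \<bar>\<nu>\<bar>"
    and dy: "\<And>y. y \<in> V \<Longrightarrow> y \<noteq> x \<Longrightarrow> wdeg m' V y = wdeg m V y"
    and ge: "\<And>u v. u \<noteq> x \<Longrightarrow> v \<noteq> x \<Longrightarrow> m u v \<le> m' u v"
    and unlift: "\<And>f'. flow V m' f' \<Longrightarrow> (\<exists>f. flow V m f \<and> (\<forall>u. (\<Sum>v\<in>V. f u v) = (\<Sum>v\<in>V. f' u v)))"
    by blast
  \<comment> \<open>The edges kept at x all point the same way, away from x for nonnegative
    \<open>\<nu>\<close>, so only one kind of stub is created.\<close>
  define s' where "s' y = s y + (if \<nu> \<ge> 0 then m' x y else 0)" for y
  define t' where "t' y = t y + (if \<nu> \<ge> 0 then 0 else m' x y)" for y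
  define sg :: int where "sg = (if \<nu> \<ge> 0 then 1 else - 1)"
  let ?U = "V - {x}"
  have st': "s' y + t' y = s y + t y + m' x y" for y by (simp add: s'_def t'_def)
  have \<beta>': "b y + int (s' y) - int (t' y) = b y + int (s y) - int (t y) + sg * int (m' x y)" for y
    by (simp add: s'_def t'_def sg_def)
  have degU: "wdeg m' V y = wdeg m' ?U y + m' x y" for y
    unfolding wdeg_def using fin x mg' by (simp add: sum.remove[of V x] multigraph_sym[of m' x])
  have dUx: "(\<Sum>y\<in>?U. m' x y) = nat \<bar>\<nu>\<bar>"
    using dx fin x mg' by (simp add: wdeg_def sum.remove[of V x] multigraph_diag)
  have sgnu: "sg * int (nat \<bar>\<nu>\<bar>) = \<nu>" by (simp add: sg_def)
  have dd: "wdeg m' ?U y + s' y + t' y = wdeg m V y + s y + t y" if "y \<in> ?U" for y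
    using degU[of y] dy[of y] that st'[of y] by auto
  have "stub_graph n ?U m' b s' t'"
    unfolding stub_graph_def
  proof (intro conjI ballI allI impI)
    show "finite ?U" using fin by simp
    show "multigraph m'" by fact
    show "12 * int n + 4 + \<bar>b y\<bar> \<le> int (wdeg m' ?U y + s' y + t' y)" if "y \<in> ?U" for y
      using dd[OF that] S[of y] that by simp
    show "even (int (wdeg m' ?U y + s' y + t' y) + b y)" if "y \<in> ?U" for y
      using dd[OF that] par[of y] that by simp
    show "[(\<Sum>y\<in>?U. b y + int (s' y) - int (t' y)) = 0] (mod 2 * (int n + 1))"
    proof -
      have "(\<Sum>y\<in>?U. b y + int (s' y) - int (t' y)) = (\<Sum>y\<in>?U. b y + int (s y) - int (t y)) + sg * int (\<Sum>y\<in>?U. m' x y)"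
        unfolding \<beta>' by (simp add: sum.distrib sum_distrib_left)
      also have "\<dots> = (\<Sum>y\<in>?U. b y + int (s y) - int (t y)) + \<nu>" by (simp only: dUx sgnu)
      also have "[\<dots> = (\<Sum>y\<in>?U. b y + int (s y) - int (t y)) + (b x + int (s x) - int (t x))] (mod 2 * (int n + 1))"
        by (intro cong_add cong_refl \<nu>)
      also have "(\<Sum>y\<in>?U. b y + int (s y) - int (t y)) + (b x + int (s x) - int (t x)) = (\<Sum>y\<in>V. b y + int (s y) - int (t y))"
        using fin x by (simp add: sum.remove[of V x])
      finally show ?thesis using tot cong_trans by blast
    qed
    have "sum s' ?U = sum s ?U + nat \<nu>" "sum t' ?U = sum t ?U + nat (- \<nu>)"
      using dUx by (cases "\<nu> \<ge> 0"; simp add: s'_def t'_def sum.distrib)+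
    then show "sum s' ?U \<le> 20 * n + 7" "sum t' ?U \<le> 20 * n + 7" "sum s' ?U + sum t' ?U \<le> 22 * n + 9"
      using caps by auto
    fix A assume A: "A \<subseteq> ?U" "2 \<le> card A" "A \<noteq> ?U"
    have fA: "finite A" using A fin finite_subset by blast
    define c where "c = (\<Sum>v\<in>?U - A. m x v)"
    define a where "a = (\<Sum>v\<in>A. m x v)"
    define w where "w = (\<Sum>u\<in>A. \<Sum>v\<in>?U - A. m u v)"
    have VA: "V - A = insert x (?U - A)" using A x by auto
    have "wcut m V A = a + w"
      unfolding wcut_def VA a_def w_def using fin by (simp add: sum.distrib multigraph_sym[OF mg, of _ x])
    moreover have "A \<subseteq> V" "A \<noteq> V" using A x by auto
    ultimately have 1: "20 * n + 8 \<le> a + w + sum s A + sum t A"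
      using rig A(2) unfolding rigid_def by metis
    have VxA: "V - insert x A = ?U - A" by auto
    have "x \<notin> A" using A by auto
    then have "wcut m V (insert x A) = c + w" "sum s (insert x A) = s x + sum s A" "sum t (insert x A) = t x + sum t A"
      unfolding wcut_def VxA c_def w_def using fA by simp_all
    moreover have "insert x A \<subseteq> V" "insert x A \<noteq> V" using A x by auto
    moreover have "2 \<le> card (insert x A)" using A(2) fA by (simp add: card_insert_if)
    ultimately have 2: "20 * n + 8 \<le> c + w + s x + sum s A + t x + sum t A"
      using rig unfolding rigid_def by (metis (no_types, lifting) add.assoc)
    have "wdeg m V x = a + c"
    proof -
      have "V = insert x (A \<union> (?U - A))" using A x by auto
      then have "wdeg m V x = sum (m x) (insert x (A \<union> (?U - A)))" by (simp add: wdeg_def)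
      also have "\<dots> = sum (m x) (A \<union> (?U - A))"
        using fin fA \<open>x \<notin> A\<close> by (subst sum.insert) (auto simp: multigraph_diag[OF mg])
      also have "\<dots> = sum (m x) A + sum (m x) (?U - A)"
        using fin fA by (intro sum.union_disjoint) auto
      finally show ?thesis by (simp add: a_def c_def)
    qed
    then have 3: "a + c + s x + t x \<le> 13 * n + 6" using small by simp
    have "w \<le> wcut m' ?U A"
      unfolding w_def wcut_def by (intro sum_mono ge) (use A in auto)
    moreover have "sum s A \<le> sum s' A" "sum t A \<le> sum t' A"
      by (auto intro!: sum_mono simp: s'_def t'_def)
    \<comment> \<open>Adding \<open>1\<close> and \<open>2\<close> and inserting \<open>3\<close>:
      twice the sum of w and the stubs in A is at least 2(20n + 8) - (13n + 6) = 27n + 10.\<close>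
    ultimately show "13 * n + 5 \<le> wcut m' ?U A + sum s' A + sum t' A"
      using 1 2 3 by linarith
  qed
  moreover have "solvable n V m (\<lambda>y. b y + int (s y) - int (t y))"
    if sv: "solvable n ?U m' (\<lambda>y. b y + int (s' y) - int (t' y))"
  proof -
    obtain f where f: "flow ?U m' f"
      and fs: "\<And>u. u \<in> ?U \<Longrightarrow> [(\<Sum>v\<in>?U. f u v) = b u + int (s' u) - int (t' u)] (mod 2 * (int n + 1))"
      using sv unfolding solvable_def by blast
    define h where "h u v = (if u = x then sg * int (m' x v) else if v = x then - sg * int (m' x u) else f u v)" for u v
    have sg: "sg = 1 \<or> sg = - 1" by (auto simp: sg_def)
    have "flow V m' h"
      unfolding flow_def
    proof (intro ballI)
      fix u v assume uv: "u \<in> V" "v \<in> V"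
      have sym: "m' u x = m' x u" by (rule multigraph_sym[OF mg'])
      have diag: "m' x x = 0" by (rule multigraph_diag[OF mg'])
      consider "u = x" "v = x" | "u = x" "v \<noteq> x" | "u \<noteq> x" "v = x" | "u \<noteq> x" "v \<noteq> x" by blast
      then show "h u v = - h v u \<and> \<bar>h u v\<bar> \<le> int (m' u v) \<and> even (h u v + int (m' u v))"
      proof cases
        case 1 then show ?thesis using diag by (simp add: h_def)
      next
        case 2 then show ?thesis using sg by (auto simp: h_def)
      next
        case 3 then show ?thesis using sg sym by (auto simp: h_def)
      next
        case 4
        then have "f u v = - f v u \<and> \<bar>f u v\<bar> \<le> int (m' u v) \<and> even (f u v + int (m' u v))"
          using f uv unfolding flow_def by blast
        moreover have "h u v = f u v" "h v u = f v u" using 4 by (auto simp: h_def)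
        ultimately show ?thesis by metis
      qed
    qed
    then obtain g where g: "flow V m g" "\<And>u. (\<Sum>v\<in>V. g u v) = (\<Sum>v\<in>V. h u v)" using unlift by blast
    have "[(\<Sum>v\<in>V. h u v) = b u + int (s u) - int (t u)] (mod 2 * (int n + 1))" if u: "u \<in> V" for u
    proof (cases "u = x")
      case True
      have "(\<Sum>v\<in>V. h u v) = sg * int (wdeg m' V x)"
        unfolding True h_def wdeg_def by (simp add: sum_distrib_left)
      then show ?thesis using \<nu>(1) dx sgnu True by simp
    next
      case False
      have "(\<Sum>v\<in>V. h u v) = - sg * int (m' x u) + (\<Sum>v\<in>?U. f u v)"
        using fin x False by (simp add: sum.remove[of V x] h_def)
      also have "[\<dots> = - sg * int (m' x u) + (b u + int (s' u) - int (t' u))] (mod 2 * (int n + 1))"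
        using False u by (intro cong_add cong_refl fs) auto
      finally show ?thesis unfolding \<beta>' by simp
    qed
    then show ?thesis unfolding solvable_def using g by auto
  qed
  ultimately show ?thesis by (rule that)
qed

section \<open>Reductions that keep the vertex set\<close>

definition weight :: "'v set \<Rightarrow> ('v \<Rightarrow> 'v \<Rightarrow> nat) \<Rightarrow> ('v \<Rightarrow> int) \<Rightarrow> ('v \<Rightarrow> nat) \<Rightarrow> ('v \<Rightarrow> nat) \<Rightarrow> nat" where
  "weight V m b s t = (\<Sum>x\<in>V. 2 * (wdeg m V x + s x + t x) + nat \<bar>b x\<bar>)"

text \<open>Degrees count twice in \<open>weight\<close>, so that trading a stub for a change of the
  demand by one is progress even when the size of the demand grows.\<close>

definition reducible :: "nat \<Rightarrow> 'v set \<Rightarrow> ('v \<Rightarrow> 'v \<Rightarrow> nat) \<Rightarrow> ('v \<Rightarrow> int) \<Rightarrow> ('v \<Rightarrow> nat) \<Rightarrow> ('v \<Rightarrow> nat) \<Rightarrow> bool" where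
  "reducible n V m b s t \<longleftrightarrow> (\<exists>m' b' s' t'. stub_graph n V m' b' s' t' \<and>
     weight V m' b' s' t' < weight V m b s t \<and>
     (solvable n V m' (\<lambda>x. b' x + int (s' x) - int (t' x)) \<longrightarrow>
      solvable n V m (\<lambda>x. b x + int (s x) - int (t x))))"

text \<open>Rigidity leaves room in the cuts: after a loss of 2 there remain 20n + 6 \<ge> 13n + 5.
  Since stubs are only removed, the caps survive as well, and what limits a reduction is the degree
  condition at single vertices.\<close>

lemma reducibleI:
  assumes st: "stub_graph n V m b s t" and rig: "rigid n V m s t"
    and mg': "multigraph m'"
    and S: "\<And>y. y \<in> V \<Longrightarrow> 12 * int n + 4 + \<bar>b' y\<bar> \<le> int (wdeg m' V y + s' y + t' y)"
    and par: "\<And>y. y \<in> V \<Longrightarrow> even (int (wdeg m' V y + s' y + t' y) + b' y)"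
    and tot: "[(\<Sum>x\<in>V. b' x + int (s' x) - int (t' x)) = (\<Sum>x\<in>V. b x + int (s x) - int (t x))] (mod 2 * (int n + 1))"
    and le: "\<And>y. s' y \<le> s y" "\<And>y. t' y \<le> t y"
    and cut: "\<And>A. A \<subseteq> V \<Longrightarrow> wcut m V A + sum s A + sum t A \<le> wcut m' V A + sum s' A + sum t' A + 2"
    and wt: "\<And>y. y \<in> V \<Longrightarrow> 2 * int (wdeg m' V y + s' y + t' y) + \<bar>b' y\<bar> \<le> 2 * int (wdeg m V y + s y + t y) + \<bar>b y\<bar>"
      "x \<in> V" "2 * int (wdeg m' V x + s' x + t' x) + \<bar>b' x\<bar> < 2 * int (wdeg m V x + s x + t x) + \<bar>b x\<bar>"
    and solv: "solvable n V m' (\<lambda>x. b' x + int (s' x) - int (t' x)) \<Longrightarrow>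
      solvable n V m (\<lambda>x. b x + int (s x) - int (t x))"
  shows "reducible n V m b s t"
  unfolding reducible_def
proof (intro exI conjI impI)
  have fin: "finite V" and tot0: "[(\<Sum>x\<in>V. b x + int (s x) - int (t x)) = 0] (mod 2 * (int n + 1))"
    and caps: "sum s V \<le> 20 * n + 7" "sum t V \<le> 20 * n + 7" "sum s V + sum t V \<le> 22 * n + 9"
    using st unfolding stub_graph_def by blast+
  have "sum s' V \<le> sum s V" "sum t' V \<le> sum t V" using le by (auto intro: sum_mono)
  moreover have "13 * n + 5 \<le> wcut m' V A + sum s' A + sum t' A" if "A \<subseteq> V" "2 \<le> card A" "A \<noteq> V" for A
  proof -
    have "20 * n + 8 \<le> wcut m V A + sum s A + sum t A" using rig that unfolding rigid_def by blast
    then show ?thesis using cut[OF that(1)] by linarith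
  qed
  ultimately show "stub_graph n V m' b' s' t'"
    unfolding stub_graph_def using fin mg' S par cong_trans[OF tot tot0] caps by auto
  show "weight V m' b' s' t' < weight V m b s t"
    unfolding weight_def
  proof (rule sum_strict_mono_ex1[OF fin])
    show "\<forall>y\<in>V. 2 * (wdeg m' V y + s' y + t' y) + nat \<bar>b' y\<bar> \<le> 2 * (wdeg m V y + s y + t y) + nat \<bar>b y\<bar>"
      using wt(1) by fastforce
    show "\<exists>y\<in>V. 2 * (wdeg m' V y + s' y + t' y) + nat \<bar>b' y\<bar> < 2 * (wdeg m V y + s y + t y) + nat \<bar>b y\<bar>"
      using wt(2,3) by (intro bexI[of _ x]) linarith+
  qed
qed (rule solv)

lemma solvable_cong:
  assumes "solvable n V m \<beta>" "\<And>x. x \<in> V \<Longrightarrow> [\<beta> x = \<beta>' x] (mod 2 * (int n + 1))"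
  shows "solvable n V m \<beta>'"
  using assms unfolding solvable_def by (meson cong_trans)

lemma sum_upd_le:
  fixes s :: "'a \<Rightarrow> nat"
  shows "sum s A \<le> sum (s(x := s x - 1)) A + 1"
proof (cases "finite A \<and> x \<in> A")
  case True
  then have "sum (s(x := s x - 1)) A = s x - 1 + sum s (A - {x})" "sum s A = s x + sum s (A - {x})"
    by (auto simp: sum.remove[of A x])
  then show ?thesis by simp
next
  case False
  then have "sum (s(x := s x - 1)) A = sum s A" by (cases "finite A") (auto intro: sum.cong)
  then show ?thesis by simp
qed

context
  fixes n :: nat and V :: "'v set" and m :: "'v \<Rightarrow> 'v \<Rightarrow> nat" and b :: "'v \<Rightarrow> int" and s t :: "'v \<Rightarrow> nat"
  assumes st: "stub_graph n V m b s t" and rig: "rigid n V m s t"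
begin

private lemmas fin = stub_graphD(1)[OF st] and mg = stub_graphD(2)[OF st]
  and S = stub_graphD(3)[OF st] and par = stub_graphD(4)[OF st]

text \<open>Beyond half the modulus, a demand shrinks when it is moved by one modulus towards zero,
  and its residue and parity stay the same.\<close>

lemma reducible_shift:
  assumes x: "x \<in> V" and big: "\<bar>b x\<bar> > int n + 1"
  shows "reducible n V m b s t"
proof -
  define c where "c = b x - sgn (b x) * (2 * (int n + 1))"
  have c: "\<bar>c\<bar> < \<bar>b x\<bar>" "even (c + b x)" "[c = b x] (mod 2 * (int n + 1))"
    using big unfolding c_def by (auto simp: sgn_if abs_if cong_iff_dvd_diff split: if_splits)
  have cg: "[(b(x := c)) y + int (s y) - int (t y) = b y + int (s y) - int (t y)] (mod 2 * (int n + 1))" for y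
    using c(3) by (intro cong_add cong_diff cong_refl) auto
  show ?thesis
  proof (rule reducibleI[OF st rig mg, where b' = "b(x := c)" and s' = s and t' = t and x = x])
    show "12 * int n + 4 + \<bar>(b(x := c)) y\<bar> \<le> int (wdeg m V y + s y + t y)" if "y \<in> V" for y
      using S[OF that] c(1) by (cases "y = x") auto
    show "even (int (wdeg m V y + s y + t y) + (b(x := c)) y)" if "y \<in> V" for y
      using par[OF that] c(2) by (cases "y = x") auto
    show "[(\<Sum>y\<in>V. (b(x := c)) y + int (s y) - int (t y)) = (\<Sum>x\<in>V. b x + int (s x) - int (t x))] (mod 2 * (int n + 1))"
      by (intro cong_sum cg)
    show "solvable n V m (\<lambda>y. (b(x := c)) y + int (s y) - int (t y)) \<Longrightarrow> solvable n V m (\<lambda>x. b x + int (s x) - int (t x))"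
      by (erule solvable_cong) (rule cg)
  qed (use c x in auto)
qed

text \<open>Dropping an incoming stub while raising the demand by one leaves the net outflow
  required from the actual edges unchanged. For negative \<open>b x\<close> the hypothesis
  \<open>ok\<close> follows from the degree condition, because degree and size of the demand fall
  together.\<close>

lemma reducible_stub_in:
  assumes x: "x \<in> V" "s x > 0" and ok: "12 * int n + 5 + \<bar>b x + 1\<bar> \<le> int (wdeg m V x + s x + t x)"
  shows "reducible n V m b s t"
proof -
  let ?s = "s(x := s x - 1)" and ?b = "b(x := b x + 1)"
  have eq: "(\<lambda>y. ?b y + int (?s y) - int (t y)) = (\<lambda>y. b y + int (s y) - int (t y))"
    using x(2) by (auto simp: fun_eq_iff of_nat_diff)
  show ?thesis
  proof (rule reducibleI[OF st rig mg, where b' = ?b and s' = ?s and t' = t and x = x])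
    show "12 * int n + 4 + \<bar>?b y\<bar> \<le> int (wdeg m V y + ?s y + t y)" if "y \<in> V" for y
      using S[OF that] ok x(2) by (cases "y = x") (auto simp: of_nat_diff)
    show "even (int (wdeg m V y + ?s y + t y) + ?b y)" if "y \<in> V" for y
      using par[OF that] x(2) by (cases "y = x") (auto simp: of_nat_diff)
    show "wcut m V A + sum s A + sum t A \<le> wcut m V A + sum ?s A + sum t A + 2" for A
      using sum_upd_le[of s A x] by simp
    show "[(\<Sum>y\<in>V. ?b y + int (?s y) - int (t y)) = (\<Sum>x\<in>V. b x + int (s x) - int (t x))] (mod 2 * (int n + 1))"
      unfolding eq by simp
    show "solvable n V m (\<lambda>y. ?b y + int (?s y) - int (t y)) \<Longrightarrow> solvable n V m (\<lambda>x. b x + int (s x) - int (t x))"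
      unfolding eq .
  qed (use x in \<open>auto simp: of_nat_diff\<close>)
qed

lemma reducible_stub_out:
  assumes x: "x \<in> V" "t x > 0" and ok: "12 * int n + 5 + \<bar>b x - 1\<bar> \<le> int (wdeg m V x + s x + t x)"
  shows "reducible n V m b s t"
proof -
  let ?t = "t(x := t x - 1)" and ?b = "b(x := b x - 1)"
  have eq: "(\<lambda>y. ?b y + int (s y) - int (?t y)) = (\<lambda>y. b y + int (s y) - int (t y))"
    using x(2) by (auto simp: fun_eq_iff of_nat_diff)
  show ?thesis
  proof (rule reducibleI[OF st rig mg, where b' = ?b and s' = s and t' = ?t and x = x])
    show "12 * int n + 4 + \<bar>?b y\<bar> \<le> int (wdeg m V y + s y + ?t y)" if "y \<in> V" for y
      using S[OF that] ok x(2) by (cases "y = x") (auto simp: of_nat_diff)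
    show "even (int (wdeg m V y + s y + ?t y) + ?b y)" if "y \<in> V" for y
      using par[OF that] x(2) by (cases "y = x") (auto simp: of_nat_diff)
    show "wcut m V A + sum s A + sum t A \<le> wcut m V A + sum s A + sum ?t A + 2" for A
      using sum_upd_le[of t A x] by simp
    show "[(\<Sum>y\<in>V. ?b y + int (s y) - int (?t y)) = (\<Sum>x\<in>V. b x + int (s x) - int (t x))] (mod 2 * (int n + 1))"
      unfolding eq by simp
    show "solvable n V m (\<lambda>y. ?b y + int (s y) - int (?t y)) \<Longrightarrow> solvable n V m (\<lambda>x. b x + int (s x) - int (t x))"
      unfolding eq .
  qed (use x in \<open>auto simp: of_nat_diff\<close>)
qed

text \<open>Lifting lowers the degree of x by two and no other degree, and a cut loses at most two
  edges; so a surplus of two at x is enough.\<close>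

lemma reducible_lift:
  assumes x: "x \<in> V" and big: "12 * int n + 6 + \<bar>b x\<bar> \<le> int (wdeg m V x + s x + t x)"
    and yz: "y \<in> V" "z \<in> V" "y \<noteq> z" "m x y > 0" "m x z > 0"
  shows "reducible n V m b s t"
proof -
  obtain m1 where m1: "multigraph m1" "m = (\<lambda>u v. m1 u v + edge_mult x y u v)" "x \<noteq> y"
    using split_edge[OF mg yz(4)] by blast
  have xz: "x \<noteq> z" using yz(5) multigraph_diag[OF mg] by auto
  have "m1 x z = m x z" using xz yz(3) m1(3) by (auto simp: m1(2) edge_mult_def)
  then obtain m0 where m0: "multigraph m0" "m1 = (\<lambda>u v. m0 u v + edge_mult x z u v)"
    using split_edge[OF m1(1)] yz(5) by metis
  define m' where "m' = (\<lambda>u v. m0 u v + edge_mult y z u v)"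
  have mm: "m = (\<lambda>u v. m0 u v + edge_mult x y u v + edge_mult x z u v)"
    unfolding m1(2) m0(2) by (auto simp: add_ac)
  have deg: "wdeg m V u = wdeg m' V u + (if u = x then 2 else 0)" for u
    unfolding mm m'_def wdeg_add using fin x yz m1(3) xz by (simp add: wdeg_edge_mult)
  show ?thesis
  proof (rule reducibleI[OF st rig, where m' = m' and b' = b and s' = s and t' = t and x = x])
    show "multigraph m'" unfolding m'_def by (intro multigraph_add m0(1) multigraph_edge_mult yz)
    show "12 * int n + 4 + \<bar>b u\<bar> \<le> int (wdeg m' V u + s u + t u)" if "u \<in> V" for u
      using S[OF that] big deg[of u] by (cases "u = x") auto
    show "even (int (wdeg m' V u + s u + t u) + b u)" if "u \<in> V" for u
      using par[OF that] deg[of u] by (cases "u = x") auto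
    show "wcut m V A + sum s A + sum t A \<le> wcut m' V A + sum s A + sum t A + 2" if "A \<subseteq> V" for A
      using wcut_edge_mult_le[OF fin that m1(3)] wcut_edge_mult_le[OF fin that xz]
      unfolding mm m'_def wcut_add by simp
    show "solvable n V m (\<lambda>x. b x + int (s x) - int (t x))" if sv: "solvable n V m' (\<lambda>x. b x + int (s x) - int (t x))"
    proof -
      obtain f where f: "flow V m' f" "\<forall>u\<in>V. [(\<Sum>v\<in>V. f u v) = b u + int (s u) - int (t u)] (mod 2 * (int n + 1))"
        using sv unfolding solvable_def by blast
      obtain g where "flow V m g" "\<And>u. (\<Sum>v\<in>V. g u v) = (\<Sum>v\<in>V. f u v)"
        using flow_unlift[OF f(1)[unfolded m'_def] fin x yz(1,2) m1(3) xz yz(3)] unfolding mm by blast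
      then show ?thesis using f(2) unfolding solvable_def by auto
    qed
  qed (use x deg in auto)
qed

lemma reducible_delete:
  assumes xy: "x \<in> V" "y \<in> V" "m x y > 0" and pos: "b x > 0" "b y < 0"
  shows "reducible n V m b s t"
proof -
  obtain m0 where m0: "multigraph m0" "m = (\<lambda>u v. m0 u v + edge_mult x y u v)" "x \<noteq> y"
    using split_edge[OF mg xy(3)] by blast
  let ?b = "b(x := b x - 1, y := b y + 1)"
  have deg: "wdeg m V u = wdeg m0 V u + (if u = x \<or> u = y then 1 else 0)" for u
    unfolding m0(2) wdeg_add using fin xy m0(3) by (simp add: wdeg_edge_mult)
  have beq: "?b u + int (s u) - int (t u) + (if u = x then 1 else if u = y then - 1 else 0) = b u + int (s u) - int (t u)" for u
    using m0(3) by simp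
  show ?thesis
  proof (rule reducibleI[OF st rig m0(1), where b' = ?b and s' = s and t' = t and x = x])
    show "12 * int n + 4 + \<bar>?b u\<bar> \<le> int (wdeg m0 V u + s u + t u)" if "u \<in> V" for u
      using S[OF that] deg[of u] pos m0(3) by (cases "u = x"; cases "u = y") auto
    show "even (int (wdeg m0 V u + s u + t u) + ?b u)" if "u \<in> V" for u
      using par[OF that] deg[of u] m0(3) by (cases "u = x"; cases "u = y") auto
    show "wcut m V A + sum s A + sum t A \<le> wcut m0 V A + sum s A + sum t A + 2" if "A \<subseteq> V" for A
      using wcut_edge_mult_le[OF fin that m0(3)] unfolding m0(2) wcut_add by simp
    show "[(\<Sum>u\<in>V. ?b u + int (s u) - int (t u)) = (\<Sum>x\<in>V. b x + int (s x) - int (t x))] (mod 2 * (int n + 1))"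
    proof -
      have "(\<Sum>u\<in>V. b u + int (s u) - int (t u)) = (\<Sum>u\<in>V. ?b u + int (s u) - int (t u)) + (\<Sum>u\<in>V. if u = x then 1 else if u = y then - 1 else 0)"
        by (subst sum.distrib[symmetric]) (simp only: beq)
      also have "(\<Sum>u\<in>V. if u = x then 1 else if u = y then - 1 else (0::int)) = 0"
      proof -
        have "(if u = x then 1 else if u = y then - 1 else (0::int)) = (if u = x then 1 else 0) - (if u = y then 1 else 0)" for u
          using m0(3) by auto
        then show ?thesis using fin xy by (simp add: sum_subtractf)
      qed
      finally have eq: "(\<Sum>u\<in>V. b u + int (s u) - int (t u)) = (\<Sum>u\<in>V. ?b u + int (s u) - int (t u)) + 0" .
      show ?thesis by (subst eq) (simp only: add_0_right cong_refl)
    qed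
    show "solvable n V m (\<lambda>x. b x + int (s x) - int (t x))" if sv: "solvable n V m0 (\<lambda>u. ?b u + int (s u) - int (t u))"
    proof -
      obtain f where f: "flow V m0 f" "\<And>u. u \<in> V \<Longrightarrow> [(\<Sum>v\<in>V. f u v) = ?b u + int (s u) - int (t u)] (mod 2 * (int n + 1))"
        using sv unfolding solvable_def by blast
      let ?g = "\<lambda>u v. f u v + 1 * edge_flow x y u v"
      have "flow V m ?g" unfolding m0(2) by (rule flow_add_edge[OF f(1) m0(3)]) simp
      moreover have "[(\<Sum>v\<in>V. ?g u v) = b u + int (s u) - int (t u)] (mod 2 * (int n + 1))" if u: "u \<in> V" for u
      proof -
        have "(\<Sum>v\<in>V. ?g u v) = (\<Sum>v\<in>V. f u v) + (if u = x then 1 else if u = y then - 1 else 0)"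
          using sum_edge_flow[OF fin xy(1,2) m0(3), of u] by (simp add: sum.distrib)
        also have "[\<dots> = ?b u + int (s u) - int (t u) + (if u = x then 1 else if u = y then - 1 else 0)] (mod 2 * (int n + 1))"
          by (intro cong_add cong_refl f(2) u)
        finally show ?thesis unfolding beq .
      qed
      ultimately show ?thesis unfolding solvable_def by blast
    qed
  qed (use xy deg pos m0(3) in auto)
qed

end

section \<open>Pairs of vertices, irreducible graphs and the induction\<close>

lemma solvable_pair:
  assumes "multigraph m" "x \<noteq> y" "n \<le> m x y" "even (\<beta> x + int (m x y))"
    "[\<beta> x + \<beta> y = 0] (mod 2 * (int n + 1))"
  shows "solvable n {x, y} m \<beta>"
proof -
  obtain c where c: "\<bar>c\<bar> \<le> int (m x y)" "even (c + int (m x y))" "[c = \<beta> x] (mod 2 * (int n + 1))"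
    using parallel_residue[OF assms(3,4)] by blast
  define f where "f u v = (if u = v then 0 else if u = x then c else - c)" for u v
  have diag: "m x x = 0" "m y y = 0" "m y x = m x y" using assms(1) by (auto simp: multigraph_def)
  have "flow {x, y} m f"
    unfolding flow_def f_def using assms(2) c(1,2) diag by auto
  moreover have "[- c = \<beta> y] (mod 2 * (int n + 1))"
  proof -
    have "[- c = - \<beta> x] (mod 2 * (int n + 1))" using c(3) by (simp add: cong_minus_minus_iff)
    moreover have "[- \<beta> x = \<beta> y] (mod 2 * (int n + 1))"
      using assms(5) by (simp add: cong_iff_dvd_diff algebra_simps) (metis dvd_minus_iff minus_add_distrib minus_diff_eq diff_minus_eq_add add.commute)
    ultimately show ?thesis by (rule cong_trans)
  qed
  ultimately show ?thesis
    unfolding solvable_def using assms(2) c(3) by (intro exI[of _ f]) (auto simp: f_def)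
qed

lemma solvable_subsingleton:
  assumes "multigraph m" "finite V" "card V \<le> 1" "[sum \<beta> V = 0] (mod 2 * (int n + 1))"
  shows "solvable n V m \<beta>"
proof -
  have "V = {} \<or> (\<exists>x. V = {x})" using assms(2,3) by (metis card_0_eq card_1_singletonE le_eq_less_or_eq less_one)
  then show ?thesis
    using assms(1,4) unfolding solvable_def flow_def
    by (intro exI[of _ "\<lambda>_ _. 0"]) (auto simp: multigraph_diag cong_sym_eq)
qed

text \<open>Irreducibility bounds demands and degrees, ties the kind of the stubs at a vertex to the
  sign of its demand, and forbids edges between opposite signs. Then some vertex can be removed
  within the caps: one of demand zero, whose own stubs make room, or, if there is none, any vertex,
  because all demands then share one sign and one kind of stub is absent.\<close>

lemma solvable_irreducible:
  fixes V :: "'v set"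
  assumes st: "stub_graph n V m b s t" and rig: "rigid n V m s t" and irr: "\<not> reducible n V m b s t"
    and thin: "\<And>x y. x \<in> V \<Longrightarrow> y \<in> V \<Longrightarrow> x \<noteq> y \<Longrightarrow> m x y < n" and card: "2 \<le> card V"
    and IH: "\<And>(V' :: 'v set) m' b' s' t'. stub_graph n V' m' b' s' t' \<Longrightarrow> card V' < card V \<Longrightarrow>
      solvable n V' m' (\<lambda>x. b' x + int (s' x) - int (t' x))"
  shows "solvable n V m (\<lambda>x. b x + int (s x) - int (t x))"
proof -
  note fin = stub_graphD(1)[OF st] and mg = stub_graphD(2)[OF st]
    and S = stub_graphD(3)[OF st] and caps = stub_graphD(6-8)[OF st]
  have n: "n > 0"
  proof -
    have "\<not> card V \<le> Suc 0" using card by simp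
    then obtain x y where "x \<in> V" "y \<in> V" "x \<noteq> y"
      using card_le_Suc0_iff_eq[OF fin] by blast
    then show ?thesis using thin by (metis gr0I not_less0)
  qed
  have m_le: "m x y + 1 \<le> n" if "x \<in> V" "y \<in> V" for x y
    using thin[OF that] n multigraph_diag[OF mg] by (cases "x = y") auto
  have b_le: "\<bar>b x\<bar> \<le> int n + 1" if "x \<in> V" for x
    using reducible_shift[OF st rig that] irr by linarith
  have s_pos: "b x \<ge> 0" if "x \<in> V" "s x > 0" for x
  proof (rule ccontr)
    assume "\<not> b x \<ge> 0"
    then show False using reducible_stub_in[OF st rig that] irr S[OF that(1)] by auto
  qed
  have t_pos: "b x \<le> 0" if "x \<in> V" "t x > 0" for x
  proof (rule ccontr)
    assume "\<not> b x \<le> 0"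
    then show False using reducible_stub_out[OF st rig that] irr S[OF that(1)] by auto
  qed
  \<comment> \<open>Above 13n + 6 there is room for every reduction at x. A stub could be traded;
    without stubs x has two different neighbours, as no multiplicity reaches n, and a pair of edges
    could be lifted.\<close>
  have d_le: "wdeg m V x + s x + t x \<le> 13 * n + 6" if x: "x \<in> V" for x
  proof (rule ccontr)
    assume "\<not> ?thesis"
    then have big: "12 * int n + 6 + \<bar>b x\<bar> \<le> int (wdeg m V x + s x + t x)" and
      big': "13 * n + 6 < wdeg m V x + s x + t x" using b_le[OF x] by linarith+
    have s0: "s x = 0"
    proof (rule ccontr)
      assume "s x \<noteq> 0"
      then show False using reducible_stub_in[OF st rig x] irr big by linarith
    qed
    have t0: "t x = 0"
    proof (rule ccontr)
      assume "t x \<noteq> 0"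
      then show False using reducible_stub_out[OF st rig x] irr big by linarith
    qed
    have "wdeg m V x > 0" using big' s0 t0 by simp
    then obtain y where y: "y \<in> V" "m x y > 0" unfolding wdeg_def by (metis gr0I less_numeral_extra(3) sum.neutral)
    have "wdeg m V x = m x y + sum (m x) (V - {y})" unfolding wdeg_def using fin y by (simp add: sum.remove)
    then have "sum (m x) (V - {y}) > 0" using big' s0 t0 m_le[OF x y(1)] by linarith
    then obtain z where z: "z \<in> V - {y}" "m x z > 0" by (metis gr0I less_numeral_extra(3) sum.neutral)
    show False using reducible_lift[OF st rig x big y(1), of z] y z irr by auto
  qed
  have opp: "m x y = 0" if "x \<in> V" "y \<in> V" "b x > 0" "b y < 0" for x y
    using reducible_delete[OF st rig that(1,2)] that irr by blast
  \<comment> \<open>Two vertices need a total degree of 2(12n + 4) = 24n + 8, but at most n - 1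
    parallel edges and 22n + 9 stubs give only 24n + 7.\<close>
  have "card V \<noteq> 2"
  proof
    assume "card V = 2"
    then obtain x y where V: "V = {x, y}" "x \<noteq> y" by (auto simp: card_2_iff)
    have "wdeg m V x = m x y" "wdeg m V y = m x y"
      unfolding wdeg_def V(1) using V(2) mg by (auto simp: multigraph_def)
    moreover have "sum s V = s x + s y" "sum t V = t x + t y" unfolding V(1) using V(2) by auto
    ultimately show False
      using S[of x] S[of y] caps(3) m_le[of x y] V(1) by simp
  qed
  then have card3: "3 \<le> card V" using card by linarith
  \<comment> \<open>Of at most 22n + 9 stubs, at least 12n + 4 - \<open>wdeg m V x\<close> sit at x.
    The boundary of the other vertices consists of the remaining stubs and of the edges at x; as it
    is at least 20n + 8, the bound follows. It leaves enough edges at x for any residue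
    \<open>\<nu>\<close> and for lifting.\<close>
  have deg: "10 * n + 3 \<le> 2 * wdeg m V x" if x: "x \<in> V" for x
  proof -
    have "V - (V - {x}) = {x}" using x by auto
    then have "wcut m V (V - {x}) = (\<Sum>u\<in>V - {x}. m x u)"
      unfolding wcut_def by (simp add: multigraph_sym[OF mg, of _ x])
    also have "\<dots> = wdeg m V x"
      unfolding wdeg_def using fin x mg by (simp add: sum.remove[of V x] multigraph_diag)
    finally have c: "wcut m V (V - {x}) = wdeg m V x" .
    have "2 \<le> card (V - {x})" using card3 x fin by simp
    then have "20 * n + 8 \<le> wdeg m V x + sum s (V - {x}) + sum t (V - {x})"
      using rig x unfolding rigid_def c[symmetric] by blast
    moreover have "sum s V = s x + sum s (V - {x})" "sum t V = t x + sum t (V - {x})"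
      using fin x by (auto simp: sum.remove)
    ultimately show ?thesis using caps(3) S[OF x] by linarith
  qed
  have remove: ?thesis if x: "x \<in> V" and \<nu>: "[\<nu> = b x + int (s x) - int (t x)] (mod 2 * (int n + 1))" "\<bar>\<nu>\<bar> < 2 * (int n + 1)"
    and c: "sum s (V - {x}) + nat \<nu> \<le> 20 * n + 7" "sum t (V - {x}) + nat (- \<nu>) \<le> 20 * n + 7"
      "sum s (V - {x}) + sum t (V - {x}) + nat \<bar>\<nu>\<bar> \<le> 22 * n + 9" for x \<nu>
  proof -
    have "int (10 * n + 3) \<le> int (2 * wdeg m V x)" using deg[OF x] by (simp only: of_nat_le_iff)
    then have \<nu>': "\<bar>\<nu>\<bar> \<le> int (wdeg m V x)" using \<nu>(2) by simp
    have mult: "2 * m x y \<le> wdeg m V x + 1" if "y \<in> V" for y using m_le[OF x that] deg[OF x] by linarith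
    obtain m' s' t' where st': "stub_graph n (V - {x}) m' b s' t'"
      "solvable n (V - {x}) m' (\<lambda>y. b y + int (s' y) - int (t' y)) \<Longrightarrow> ?thesis"
      using remove_vertex[OF st rig x \<nu>(1) \<nu>' mult d_le[OF x] c] by blast
    moreover have "card (V - {x}) < card V" using fin x by (meson card_Diff1_less)
    ultimately show ?thesis using IH by blast
  qed
  have spl: "sum s V = s x + sum s (V - {x})" "sum t V = t x + sum t (V - {x})" if "x \<in> V" for x
    using fin that by (auto simp: sum.remove)
  define M where "M = 2 * (int n + 1)"
  have M: "M > 0" by (simp add: M_def)
  have up: "[c mod M = c] (mod 2 * (int n + 1))" "0 \<le> c mod M" "c mod M < M" for c
    using M by (auto simp: M_def)
  have down: "[- ((- c) mod M) = c] (mod 2 * (int n + 1))" "0 \<le> (- c) mod M" "(- c) mod M < M" for c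
    using up(2,3)[of "- c"] cong_minus_minus_iff[of "(- c) mod M" "- c" "2 * (int n + 1)"] up(1)[of "- c"] by auto
  show ?thesis
  proof (cases "\<exists>x\<in>V. b x = 0")
    case True
    then obtain x where x: "x \<in> V" "b x = 0" by blast
    define c where "c = int (s x) - int (t x)"
    show ?thesis
    proof (cases "c \<ge> 0")
      case True
      \<comment> \<open>So \<open>\<nu>\<close> lies between 0 and \<open>s x - t x\<close>: the new
        stubs do not outnumber those that vanish with x.\<close>
      then have "c mod M \<le> c" by (simp add: zmod_le_nonneg_dividend)
      then show ?thesis
        using up[of c] x caps spl[OF x(1)] unfolding M_def[symmetric]
        by (intro remove[of x "c mod M"]) (auto simp: c_def M_def)
    next
      case False
      then have "(- c) mod M \<le> - c" by (simp add: zmod_le_nonneg_dividend)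
      then show ?thesis
        using down[of c] x caps spl[OF x(1)] unfolding M_def[symmetric]
        by (intro remove[of x "- ((- c) mod M)"]) (auto simp: c_def M_def)
    qed
  next
    case False
    \<comment> \<open>If both signs occur, no edge leaves the set P of positive demands, and P has
      no stubs of kind \<open>t\<close>. Its boundary is then at most the cap 20n + 7 on
      \<open>s\<close> alone, against rigidity; a single vertex would have degree 0.\<close>
    have same: False if "x \<in> V" "b x > 0" "y \<in> V" "b y < 0" for x y
    proof -
      define P where "P = {v \<in> V. b v > 0}"
      have "y \<notin> P" using that by (simp add: P_def)
      then have "P \<noteq> V" using that(3) by blast
      then have P: "P \<subseteq> V" "P \<noteq> V" "finite P" "x \<in> P" using that(1,2) fin unfolding P_def by simp_all
      have zero: "m u v = 0" if "u \<in> P" "v \<in> V - P" for u v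
        using that opp[of u v] False unfolding P_def by force
      show False
      proof (cases "2 \<le> card P")
        case True
        have "wcut m V P = 0" unfolding wcut_def using zero by simp
        moreover have "t v = 0" if "v \<in> P" for v
          using t_pos[of v] that unfolding P_def by (cases "t v = 0") auto
        then have "sum t P = 0" by simp
        moreover have "sum s P \<le> sum s V" using P fin by (intro sum_mono2) auto
        moreover have "20 * n + 8 \<le> wcut m V P + sum s P + sum t P"
          using rig P True unfolding rigid_def by blast
        ultimately show False using caps(1) by linarith
      next
        case False
        then have "card P \<le> Suc 0" by linarith
        then have "P = {x}" using P(3,4) card_le_Suc0_iff_eq by blast
        then have "m x v = 0" if "v \<in> V" for v
          using zero[of x v] multigraph_diag[OF mg, of x] that by (cases "v = x") auto
        then have "wdeg m V x = 0" unfolding wdeg_def by simp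
        then show False using deg[OF that(1)] by simp
      qed
    qed
    obtain x where x: "x \<in> V" using card3 by fastforce
    define c where "c = b x + int (s x) - int (t x)"
    show ?thesis
    proof (cases "b x > 0")
      case True
      \<comment> \<open>All demands are positive, so stubs of kind \<open>t\<close> are absent. A
        representative of the residue that is not positive creates at most 2n + 1 of them, and (20n
        + 7) + (2n + 1) stays below the joint cap 22n + 9.\<close>
      then have "b y > 0" if "y \<in> V" for y using same[OF x True that] False that by (meson linorder_cases)
      then have "t y = 0" if "y \<in> V" for y using t_pos[of y] that by force
      then have "sum t V = 0" by simp
      moreover obtain r where "[- r = c] (mod 2 * (int n + 1))" "0 \<le> r" "r < 2 * (int n + 1)"
        using down[of c] unfolding M_def by blast
      ultimately show ?thesis
        using x caps spl[OF x] by (intro remove[of x "- r"]) (auto simp: c_def)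
    next
      case neg: False
      then have bx: "b x < 0" using False x by (meson linorder_cases)
      have "b y < 0" if "y \<in> V" for y using same[OF that _ x bx] False that by (meson linorder_cases)
      then have "s y = 0" if "y \<in> V" for y using s_pos[of y] that by force
      then have "sum s V = 0" by simp
      moreover obtain r where "[r = c] (mod 2 * (int n + 1))" "0 \<le> r" "r < 2 * (int n + 1)"
        using up[of c] unfolding M_def by blast
      ultimately show ?thesis
        using x caps spl[OF x] by (intro remove[of x r]) (auto simp: c_def)
    qed
  qed
qed

text \<open>The inside of the contracted set has as many stubs in total as the set has boundary, at
  most 20n + 7, which meets all three caps for any directions. Both the contraction and the inside
  have fewer vertices.\<close>

lemma not_rigid_solvable:
  fixes V :: "'v set"
  assumes st: "stub_graph n V m b s t" and nr: "\<not> rigid n V m s t"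
    and IH: "\<And>(V' :: 'v set) m' b' s' t'. stub_graph n V' m' b' s' t' \<Longrightarrow> card V' < card V \<Longrightarrow>
      solvable n V' m' (\<lambda>x. b' x + int (s' x) - int (t' x))"
  shows "solvable n V m (\<lambda>x. b x + int (s x) - int (t x))"
proof -
  have fin: "finite V" and mg: "multigraph m" and S: "\<And>x. x \<in> V \<Longrightarrow> 12 * int n + 4 + \<bar>b x\<bar> \<le> int (wdeg m V x + s x + t x)"
    and par: "\<And>x. x \<in> V \<Longrightarrow> even (int (wdeg m V x + s x + t x) + b x)"
    and C: "\<And>B. B \<subseteq> V \<Longrightarrow> 2 \<le> card B \<Longrightarrow> B \<noteq> V \<Longrightarrow> 13 * n + 5 \<le> wcut m V B + sum s B + sum t B"
    using st unfolding stub_graph_def by blast+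
  obtain A where A: "A \<subseteq> V" "2 \<le> card A" "A \<noteq> V" and "\<not> 20 * n + 8 \<le> wcut m V A + sum s A + sum t A"
    using nr unfolding rigid_def by blast
  then have A4: "wcut m V A + sum s A + sum t A \<le> 20 * n + 7" by linarith
  obtain s' t' where d: "\<And>x. x \<in> A \<Longrightarrow> wdeg m A x + s' x + t' x = wdeg m V x + s x + t x"
    and tot: "[(\<Sum>x\<in>A. b x + int (s' x) - int (t' x)) = 0] (mod 2 * (int n + 1))"
    and cut: "\<And>B. B \<subseteq> A \<Longrightarrow> wcut m A B + sum s' B + sum t' B = wcut m V B + sum s B + sum t B"
    and ext: "solvable n A m (\<lambda>x. b x + int (s' x) - int (t' x)) \<Longrightarrow> solvable n V m (\<lambda>x. b x + int (s x) - int (t x))"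
    by (rule contraction_extends[OF st A]) (rule IH, assumption, assumption, rule that)
  have "wcut m A A = 0" by (simp add: wcut_def)
  then have "sum s' A + sum t' A \<le> 20 * n + 7" using cut[of A] A4 by simp
  moreover have "13 * n + 5 \<le> wcut m A B + sum s' B + sum t' B" if "B \<subseteq> A" "2 \<le> card B" "B \<noteq> A" for B
    using cut[OF that(1)] C[of B] that A by auto
  moreover have "12 * int n + 4 + \<bar>b x\<bar> \<le> int (wdeg m A x + s' x + t' x)" "even (int (wdeg m A x + s' x + t' x) + b x)"
    if "x \<in> A" for x
    using d[OF that] S[of x] par[of x] that A by auto
  ultimately have "stub_graph n A m b s' t'"
    unfolding stub_graph_def using mg tot finite_subset[OF A(1) fin] by auto
  moreover have "card A < card V" using A fin by (simp add: psubset_card_mono psubset_eq)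
  ultimately show ?thesis using IH ext by blast
qed

text \<open>The boundary of the pair may exceed the caps, so the inside need not be a legal stub
  graph. Its n parallel edges realise whatever residue the contraction leaves, so induction is only
  applied to the contraction.\<close>

lemma thick_pair_solvable:
  fixes V :: "'v set"
  assumes st: "stub_graph n V m b s t" and xy: "x \<in> V" "y \<in> V" "x \<noteq> y" "n \<le> m x y"
    and IH: "\<And>(V' :: 'v set) m' b' s' t'. stub_graph n V' m' b' s' t' \<Longrightarrow> card V' < card V \<Longrightarrow>
      solvable n V' m' (\<lambda>x. b' x + int (s' x) - int (t' x))"
  shows "solvable n V m (\<lambda>x. b x + int (s x) - int (t x))"
proof -
  have fin: "finite V" and mg: "multigraph m" 
    and par: "\<And>x. x \<in> V \<Longrightarrow> even (int (wdeg m V x + s x + t x) + b x)"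
    and tot: "[(\<Sum>x\<in>V. b x + int (s x) - int (t x)) = 0] (mod 2 * (int n + 1))"
    using st unfolding stub_graph_def by blast+
  have dxy: "wdeg m {x, y} x = m x y" using xy(3) mg by (simp add: wdeg_def multigraph_diag)
  show ?thesis
  proof (cases "{x, y} = V")
    case True
    have "even (int (m x y + s x + t x) + b x)" using par[OF xy(1)] dxy True by simp
    then have "even (b x + int (s x) - int (t x) + int (m x y))" by (simp; blast)
    then show ?thesis
      using solvable_pair[of m x y n "\<lambda>x. b x + int (s x) - int (t x)"] mg xy tot True[symmetric] by simp
  next
    case False
    have A: "{x, y} \<subseteq> V" "2 \<le> card {x, y}" "{x, y} \<noteq> V" using xy False by auto
    obtain s' t' where d: "\<And>z. z \<in> {x, y} \<Longrightarrow> wdeg m {x, y} z + s' z + t' z = wdeg m V z + s z + t z"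
      and tot': "[(\<Sum>x\<in>{x, y}. b x + int (s' x) - int (t' x)) = 0] (mod 2 * (int n + 1))"
      and ext: "solvable n {x, y} m (\<lambda>x. b x + int (s' x) - int (t' x)) \<Longrightarrow> solvable n V m (\<lambda>x. b x + int (s x) - int (t x))"
      by (rule contraction_extends[OF st A]) (rule IH, assumption, assumption, rule that)
    have "even (int (m x y + s' x + t' x) + b x)" using par[OF xy(1)] d[of x] dxy by simp
    then have "even (b x + int (s' x) - int (t' x) + int (m x y))" by (simp; blast)
    then show ?thesis
      using solvable_pair[of m x y n "\<lambda>x. b x + int (s' x) - int (t' x)"] mg xy tot' ext by simp
  qed
qed

text \<open>Contraction and vertex removal decrease the number of vertices; the other reductions
  keep the vertex set and decrease \<open>weight\<close>. Hence two nested inductions.\<close>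

theorem stub_graph_solvable:
  fixes V :: "'v set"
  assumes "stub_graph n V m b s t"
  shows "solvable n V m (\<lambda>x. b x + int (s x) - int (t x))"
  using assms
proof (induction "card V" arbitrary: V m b s t rule: less_induct)
  case (less V)
  note IH = less.hyps[OF _ , rotated]
  show ?case using less.prems
  proof (induction "weight V m b s t" arbitrary: m b s t rule: less_induct)
    case (less m b s t)
    note IH' = less.hyps and st = less.prems
    have fin: "finite V" and mg: "multigraph m"
      and tot: "[(\<Sum>x\<in>V. b x + int (s x) - int (t x)) = 0] (mod 2 * (int n + 1))"
      using st unfolding stub_graph_def by blast+
    show ?case
    proof (cases "2 \<le> card V")
      case False
      then show ?thesis using solvable_subsingleton[OF mg fin _ tot] by simp
    next
      case True
      show ?thesis
      proof (cases "rigid n V m s t")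
        case False
        show ?thesis by (rule not_rigid_solvable[OF st False]) (rule IH)
      next
        case rig: True
        show ?thesis
        proof (cases "\<exists>x\<in>V. \<exists>y\<in>V. x \<noteq> y \<and> n \<le> m x y")
          case True
          then obtain x y where "x \<in> V" "y \<in> V" "x \<noteq> y" "n \<le> m x y" by blast
          then show ?thesis by (rule thick_pair_solvable[OF st]) (rule IH)
        next
          case thin: False
          show ?thesis
          proof (cases "reducible n V m b s t")
            case True
            then show ?thesis using IH' unfolding reducible_def by blast
          next
            case irr: False
            show ?thesis
              by (rule solvable_irreducible[OF st rig irr _ True]) (use thin in force, rule IH)
          qed
        qed
      qed
    qed
  qed
qed

text \<open>The start has no stubs. Cuts around single vertices give degrees of at least 13n + 5,
  which is enough for demands reduced to size at most n + 1.\<close>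

corollary orientation_mod:
  fixes m :: "'v \<Rightarrow> 'v \<Rightarrow> nat" and \<beta> :: "'v \<Rightarrow> int"
  assumes "finite V" "multigraph m"
    and conn: "\<And>A. A \<subseteq> V \<Longrightarrow> A \<noteq> {} \<Longrightarrow> A \<noteq> V \<Longrightarrow> 13 * n + 5 \<le> wcut m V A"
    and par: "\<And>x. x \<in> V \<Longrightarrow> even (int (wdeg m V x) + \<beta> x)"
    and tot: "[sum \<beta> V = 0] (mod 2 * (int n + 1))"
  shows "solvable n V m \<beta>"
proof (cases "card V \<le> 1")
  case True
  then show ?thesis using solvable_subsingleton[OF assms(2,1) _ tot] by simp
next
  case False
  have "\<exists>c. [c = \<beta> x] (mod 2 * (int n + 1)) \<and> \<bar>c\<bar> \<le> int n + 1" for x by (rule bounded_residue)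
  then obtain b where b: "\<And>x. [b x = \<beta> x] (mod 2 * (int n + 1))" "\<And>x. \<bar>b x\<bar> \<le> int n + 1" by metis
  have deg: "13 * n + 5 \<le> wdeg m V x" if x: "x \<in> V" for x
  proof -
    have "{x} \<noteq> V" using False by auto
    then have "13 * n + 5 \<le> wcut m V {x}" using conn x by blast
    also have "wcut m V {x} \<le> wdeg m V x" unfolding wcut_def wdeg_def using assms(1) by (simp add: sum_mono2)
    finally show ?thesis .
  qed
  have "stub_graph n V m b (\<lambda>_. 0) (\<lambda>_. 0)"
    unfolding stub_graph_def
  proof (intro conjI ballI allI impI)
    show "12 * int n + 4 + \<bar>b x\<bar> \<le> int (wdeg m V x + 0 + 0)" if "x \<in> V" for x
      using deg[OF that] b(2)[of x] by simp
    show "even (int (wdeg m V x + 0 + 0) + b x)" if "x \<in> V" for x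
      using par[OF that] cong_double_parity[OF b(1)[of x]] by simp
    show "[(\<Sum>x\<in>V. b x + int 0 - int 0) = 0] (mod 2 * (int n + 1))"
      using cong_trans[OF cong_sum[of V b \<beta>, OF b(1)] tot] by simp
    show "13 * n + 5 \<le> wcut m V A + (\<Sum>_\<in>A. 0) + (\<Sum>_\<in>A. 0)" if "A \<subseteq> V" "2 \<le> card A" "A \<noteq> V" for A
    proof -
      have "A \<noteq> {}" using that(2) by auto
      then show ?thesis using conn[of A] that by simp
    qed
  qed (use assms in auto)
  from stub_graph_solvable[OF this] show ?thesis
    by (rule solvable_cong) (use b(1) in simp)
qed

subsection \<open>Highly connected bipartite subgraphs\<close>

definition cross :: "('v \<Rightarrow> 'v \<Rightarrow> nat) \<Rightarrow> 'v set \<Rightarrow> ('v \<Rightarrow> 'v \<Rightarrow> nat)" where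
  "cross m A u v = (if (u \<in> A) \<noteq> (v \<in> A) then m u v else 0)"

lemma multigraph_cross: "multigraph m \<Longrightarrow> multigraph (cross m A)"
  by (auto simp: multigraph_def cross_def)

lemma sum_sym_swap:
  assumes "multigraph m"
  shows "(\<Sum>u\<in>A. \<Sum>v\<in>B. m u v) = (\<Sum>u\<in>B. \<Sum>v\<in>A. m u v)"
  by (subst sum.swap) (simp add: multigraph_sym[OF assms])

lemma sum_sum_split:
  assumes "multigraph m" "finite J" "Y \<subseteq> J"
  shows "(\<Sum>u\<in>J. \<Sum>v\<in>J. m u v) =
    (\<Sum>u\<in>Y. \<Sum>v\<in>Y. m u v) + (\<Sum>u\<in>J - Y. \<Sum>v\<in>J - Y. m u v) + 2 * (\<Sum>u\<in>Y. \<Sum>v\<in>J - Y. m u v)"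
proof -
  have "(\<Sum>v\<in>J. h v) = (\<Sum>v\<in>Y. h v) + (\<Sum>v\<in>J - Y. h v)" for h :: "'a \<Rightarrow> nat"
    using sum.subset_diff[OF assms(3,2), of h] by simp
  then show ?thesis
    using sum_sym_swap[OF assms(1), of "J - Y" Y] by (simp add: sum.distrib)
qed

text \<open>Moving Y to the other side exchanges crossing and non-crossing edges between Y and its
  complement and affects no others. In a maximum cut at least half of them therefore cross, for
  every Y at once.\<close>

lemma max_cut:
  assumes mg: "multigraph m" and fin: "finite J"
  obtains A where "A \<subseteq> J" "\<And>Y. Y \<subseteq> J \<Longrightarrow> wcut m J Y \<le> 2 * wcut (cross m A) J Y"
proof -
  define c where "c A = (\<Sum>u\<in>J. \<Sum>v\<in>J. cross m A u v)" for A
  have "finite (Pow J)" "Pow J \<noteq> {}" using fin by auto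
  then obtain A where A: "A \<in> Pow J" "Max (c ` Pow J) = c A" by (rule obtains_MAX)
  then have max: "c A' \<le> c A" if "A' \<subseteq> J" for A'
    unfolding A(2)[symmetric] using that fin by (intro Max_ge) auto
  have "wcut m J Y \<le> 2 * wcut (cross m A) J Y" if Y: "Y \<subseteq> J" for Y
  proof -
    define A' where "A' = (A - Y) \<union> (Y - A)"
    have "A' \<subseteq> J" using A Y by (auto simp: A'_def)
    have 1: "(\<Sum>u\<in>Y. \<Sum>v\<in>Y. cross m A' u v) = (\<Sum>u\<in>Y. \<Sum>v\<in>Y. cross m A u v)"
      by (intro sum.cong) (auto simp: cross_def A'_def)
    have 2: "(\<Sum>u\<in>J - Y. \<Sum>v\<in>J - Y. cross m A' u v) = (\<Sum>u\<in>J - Y. \<Sum>v\<in>J - Y. cross m A u v)"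
      by (intro sum.cong) (auto simp: cross_def A'_def)
    have "(\<Sum>u\<in>Y. \<Sum>v\<in>J - Y. cross m A' u v) + (\<Sum>u\<in>Y. \<Sum>v\<in>J - Y. cross m A u v) = (\<Sum>u\<in>Y. \<Sum>v\<in>J - Y. m u v)"
      unfolding sum.distrib[symmetric] by (intro sum.cong) (auto simp: cross_def A'_def)
    moreover have "c A' \<le> c A" using max \<open>A' \<subseteq> J\<close> .
    ultimately show ?thesis
      unfolding c_def wcut_def sum_sum_split[OF multigraph_cross[OF mg] fin Y] 1 2 by linarith
  qed
  then show ?thesis using that A by blast
qed

text \<open>
  Mader's argument: take a smallest vertex set of size at least 4n + 2 spanning more than
  a(|W| - 2n - 1) edges; both sides of a small cut, together with X, would be smaller examples.
\<close>

lemma highly_connected_subgraph: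
  assumes mg: "multigraph m" and simple: "\<And>u v. m u v \<le> 1"
    and fin: "finite W0" "W0 \<noteq> {}" and deg: "\<And>v. v \<in> W0 \<Longrightarrow> 56 * n + 24 \<le> wdeg m W0 v"
  obtains W where "W \<subseteq> W0" "4 * n + 2 \<le> card W"
    "\<And>X Y. X \<subseteq> W \<Longrightarrow> card X \<le> 2 * n \<Longrightarrow> Y \<subseteq> W - X \<Longrightarrow> Y \<noteq> {} \<Longrightarrow> Y \<noteq> W - X \<Longrightarrow> 26 * n + 12 \<le> wcut m (W - X) Y"
proof -
  \<comment> \<open>\<open>a\<close> is 26n + 12 plus 2n, the bound on the size of X, so a vertex of
    degree above \<open>a\<close> keeps more than 26n + 12 neighbours outside X. Since
    \<open>e\<close> counts ordered pairs, \<open>a\<close> enters \<open>P\<close> with a factor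
    2.\<close>
  define a where "a = 28 * n + 12"
  define e where "e W = (\<Sum>u\<in>W. \<Sum>v\<in>W. m u v)" for W
  define P where "P W \<longleftrightarrow> W \<subseteq> W0 \<and> 4 * n + 2 \<le> card W \<and> 2 * a * card W < e W + 2 * a * (2 * n + 1)" for W
  have le_card: "(\<Sum>v\<in>B. m u v) \<le> card B" for u B
    using sum_bounded_above[of B "m u" 1] simple by simp
  have "P W0"
  proof -
    obtain v where "v \<in> W0" using fin by blast
    then have "56 * n + 24 \<le> card W0" using deg[of v] le_card[of v W0] unfolding wdeg_def by linarith
    moreover have "card W0 * (2 * a) \<le> e W0"
      unfolding e_def using deg sum_bounded_below[of W0 "2 * a" "\<lambda>u. \<Sum>v\<in>W0. m u v"]
      by (simp add: a_def wdeg_def)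
    ultimately show ?thesis unfolding P_def by (simp add: a_def mult.commute)
  qed
  then obtain W where W: "P W" and min: "\<And>W'. card W' < card W \<Longrightarrow> \<not> P W'"
    using exists_least_iff[of "\<lambda>c. \<exists>W. P W \<and> card W = c"] by blast
  have WW0: "W \<subseteq> W0" and cW: "4 * n + 2 \<le> card W" and eW: "2 * a * card W < e W + 2 * a * (2 * n + 1)"
    using W unfolding P_def by auto
  have fW: "finite W" using WW0 fin finite_subset by blast
  have small: "e W' + 2 * a * (2 * n + 1) \<le> 2 * a * card W'" if "W' \<subset> W" "4 * n + 2 \<le> card W'" for W'
    using min[of W'] psubset_card_mono[OF fW that(1)] that WW0 unfolding P_def by (meson not_less order_trans psubset_imp_subset)
  \<comment> \<open>Deleting a vertex of degree at most \<open>a\<close> would give a smaller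
    example. It cannot fall below the size 4n + 2, because a graph of exactly that size has too few
    edges even if complete.\<close>
  have mindeg: "a + 1 \<le> wdeg m W v" if v: "v \<in> W" for v
  proof -
    have "card W \<noteq> 4 * n + 2"
    proof
      assume c: "card W = 4 * n + 2"
      have "e W \<le> card W * card W"
        unfolding e_def using sum_bounded_above[of W "\<lambda>u. \<Sum>v\<in>W. m u v" "card W"] le_card by simp
      then have "2 * a * (4 * n + 2) < (4 * n + 2) * (4 * n + 2) + 2 * a * (2 * n + 1)" using eW c by simp
      then have "a * (4 * n + 2) < 2 * (2 * n + 1) * (4 * n + 2)" by (simp add: algebra_simps)
      then have "a < 2 * (2 * n + 1)" by (simp only: mult_less_cancel2)
      then show False by (simp add: a_def)
    qed
    then have "4 * n + 2 \<le> card (W - {v})" using cW v fW by simp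
    then have 1: "e (W - {v}) + 2 * a * (2 * n + 1) \<le> 2 * a * card (W - {v})" using small v by blast
    have "e W = e (W - {v}) + 2 * wdeg m W v"
    proof -
      have "e W = e {v} + e (W - {v}) + 2 * (\<Sum>u\<in>W - {v}. m v u)"
        unfolding e_def using sum_sum_split[OF mg fW, of "{v}"] v by simp
      moreover have "wdeg m W v = (\<Sum>u\<in>W - {v}. m v u)"
        unfolding wdeg_def using v fW mg by (simp add: sum.remove[of W v] multigraph_diag)
      moreover have "e {v} = 0" using mg by (simp add: e_def multigraph_diag)
      ultimately show ?thesis by simp
    qed
    moreover have "2 * a * card W = 2 * a * card (W - {v}) + 2 * a"
      unfolding card.remove[OF fW v] by (simp only: mult_Suc_right add.commute)
    ultimately show ?thesis using 1 eW by linarith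
  qed
  have cut: "26 * n + 12 \<le> wcut m (W - X) Y"
    if X: "X \<subseteq> W" "card X \<le> 2 * n" and Y: "Y \<subseteq> W - X" "Y \<noteq> {}" "Y \<noteq> W - X" for X Y
  proof (rule ccontr)
    assume neg: "\<not> ?thesis"
    define Z where "Z = W - X - Y"
    have fX: "finite X" "finite Y" "finite Z"
      using finite_subset[OF X(1) fW] finite_subset[OF Y(1)] fW unfolding Z_def by simp_all
    define c where "c = (\<Sum>u\<in>Y. \<Sum>v\<in>Z. m u v)"
    have c: "c < 26 * n + 12" using neg unfolding c_def wcut_def Z_def by simp
    have c': "(\<Sum>u\<in>Z. \<Sum>v\<in>Y. m u v) = c" unfolding c_def by (rule sum_sym_swap[OF mg])
    \<comment> \<open>A side with y \<le> 4n + 1 vertices sends at least y(26n + 13 - y) edges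
      across, by \<open>mindeg\<close> and simplicity. The factors are positive with sum 26n + 13,
      so their product is at least 26n + 12.\<close>
    have large: "4 * n + 2 \<le> card A" if A: "A \<noteq> {}" "A \<subseteq> W" "finite A" "finite B" "W = A \<union> X \<union> B" "A \<inter> X = {}" "B \<inter> A = {}" "B \<inter> X = {}"
      and "(\<Sum>u\<in>A. \<Sum>v\<in>B. m u v) = c" for A B
    proof (rule ccontr)
      assume small: "\<not> ?thesis"
      define y where "y = card A"
      have y: "1 \<le> y" "y \<le> 4 * n + 1" using A small by (auto simp: y_def Suc_le_eq card_gt_0_iff)
      have "wdeg m W u \<le> y + 2 * n + (\<Sum>v\<in>B. m u v)" for u
      proof -
        have "wdeg m W u = (\<Sum>v\<in>A. m u v) + (\<Sum>v\<in>X. m u v) + (\<Sum>v\<in>B. m u v)"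
        proof -
          have "(A \<union> X) \<inter> B = {}" using A by blast
          then have "sum (m u) (A \<union> X \<union> B) = sum (m u) (A \<union> X) + sum (m u) B"
            using A(3,4) fX(1) by (intro sum.union_disjoint) auto
          also have "sum (m u) (A \<union> X) = sum (m u) A + sum (m u) X"
            using A(3,6) fX(1) by (intro sum.union_disjoint)
          finally show ?thesis unfolding wdeg_def A(5) .
        qed
        then show ?thesis using le_card[of u A] le_card[of u X] X(2) by (simp add: y_def)
      qed
      then have "a + 1 \<le> y + 2 * n + (\<Sum>v\<in>B. m u v)" if "u \<in> A" for u
        using mindeg[of u] that A(2) by (meson le_trans subsetD)
      then have "card A * (a + 1) \<le> (\<Sum>u\<in>A. y + 2 * n + (\<Sum>v\<in>B. m u v))"
        using sum_bounded_below[of A "a + 1"] by simp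
      also have "\<dots> = y * (y + 2 * n) + c"
        using that(9) by (simp add: sum.distrib y_def algebra_simps)
      finally have less: "y * (a + 1) < y * (y + 2 * n) + (26 * n + 12)" using c by (simp add: y_def)
      obtain z where z: "a + 1 = y + 2 * n + z" "z + y = 26 * n + 13" 
        using y(2) that[of "26 * n + 13 - y"] by (simp add: a_def)
      have "y * (y + 2 * n) + y * z < y * (y + 2 * n) + (26 * n + 12)"
        using less unfolding z(1) distrib_left[of y "y + 2 * n" z] .
      then have "y * z < 26 * n + 12" by (simp only: add_less_cancel_left)
      moreover have "y + z \<le> y * z + 1"
      proof -
        have "1 \<le> z" using z y by linarith
        then obtain y' z' where "y = Suc y'" "z = Suc z'" using y(1) by (metis Suc_le_D One_nat_def)
        then show ?thesis by simp
      qed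
      ultimately show False using z(2) by linarith
    qed
    have Zne: "Z \<noteq> {}" using Y unfolding Z_def by blast
    have WU: "W = Y \<union> X \<union> Z" "W = Z \<union> X \<union> Y" using X Y by (auto simp: Z_def)
    have dis: "Y \<inter> X = {}" "Z \<inter> Y = {}" "Z \<inter> X = {}" "Y \<inter> Z = {}" using X Y by (auto simp: Z_def)
    have lY: "4 * n + 2 \<le> card Y" by (rule large[of Y Z]) (use Y WU dis fX c_def in auto)
    have lZ: "4 * n + 2 \<le> card Z" by (rule large[of Z Y]) (use Zne WU dis fX c' in auto)
    have cards: "card (Y \<union> X) = card Y + card X" "card (Z \<union> X) = card Z + card X" "card W = card Y + card X + card Z"
    proof -
      show YX: "card (Y \<union> X) = card Y + card X" using fX dis by (intro card_Un_disjoint) auto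
      show "card (Z \<union> X) = card Z + card X" using fX dis by (intro card_Un_disjoint) auto
      have "card (Y \<union> X \<union> Z) = card (Y \<union> X) + card Z" using fX dis by (intro card_Un_disjoint) auto
      then show "card W = card Y + card X + card Z" using WU(1) YX by simp
    qed
    have sub: "Y \<union> X \<subset> W" "Z \<union> X \<subset> W" using WU dis Zne Y(2) by blast+
    have 1: "e (Y \<union> X) + 2 * a * (2 * n + 1) \<le> 2 * a * (card Y + card X)"
      using small[OF sub(1)] lY cards by simp
    have 2: "e (Z \<union> X) + 2 * a * (2 * n + 1) \<le> 2 * a * (card Z + card X)"
      using small[OF sub(2)] lZ cards by simp
    have "e W = e (Y \<union> X) + e Z + 2 * (\<Sum>u\<in>Y \<union> X. \<Sum>v\<in>Z. m u v)"
    proof -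
      have "W - (Y \<union> X) = Z" by (auto simp: Z_def)
      then show ?thesis unfolding e_def using sum_sum_split[OF mg fW, of "Y \<union> X"] sub by auto
    qed
    also have "(\<Sum>u\<in>Y \<union> X. \<Sum>v\<in>Z. m u v) = c + (\<Sum>u\<in>X. \<Sum>v\<in>Z. m u v)"
      unfolding c_def using fX dis by (simp add: sum.union_disjoint)
    finally have 3: "e W = e (Y \<union> X) + e Z + 2 * c + 2 * (\<Sum>u\<in>X. \<Sum>v\<in>Z. m u v)" by simp
    have "Z \<union> X - X = Z" using dis by auto
    then have "e (Z \<union> X) = e X + e Z + 2 * (\<Sum>u\<in>X. \<Sum>v\<in>Z. m u v)"
      unfolding e_def using sum_sum_split[OF mg, of "Z \<union> X" X] fX by simp
    \<comment> \<open>The edges inside X are counted on both sides, which only helps. Combined with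
      \<open>1\<close>, \<open>2\<close>, \<open>eW\<close> and the bound 2n on X, this would force
      c > a, although c < 26n + 12.\<close>
    then have 4: "e W \<le> e (Y \<union> X) + e (Z \<union> X) + 2 * c" using 3 by simp
    have "a * card X \<le> a * (2 * n)" using X(2) by simp
    then show False using 1 2 4 eW c unfolding cards by (simp add: algebra_simps a_def)
  qed
  show ?thesis using that[OF WW0 cW cut] by blast
qed

section \<open>Edge sets with prescribed degrees modulo n + 1\<close>

lemma edge_degree_rel:
  "edge_degree {{u, v} |u v. R u v} x = card {w. R x w \<or> R w x}"
proof -
  have "{e \<in> {{u, v} |u v. R u v}. x \<in> e} = (\<lambda>w. {x, w}) ` {w. R x w \<or> R w x}"
    by (auto simp: insert_commute)
  moreover have "inj_on (\<lambda>w. {x, w}) {w. R x w \<or> R w x}" by (auto simp: inj_on_def doubleton_eq_iff)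
  ultimately show ?thesis unfolding edge_degree_def by (simp add: card_image)
qed

lemma sum_pm_one:
  fixes f :: "'a \<Rightarrow> int"
  assumes "finite N" "\<And>v. v \<in> N \<Longrightarrow> f v = 1 \<or> f v = - 1"
  shows "sum f N = 2 * int (card {v \<in> N. f v = 1}) - int (card N)"
proof -
  have "sum f N = (\<Sum>v\<in>N. 2 * (if f v = 1 then 1 else 0) - 1)"
    by (intro sum.cong refl) (use assms(2) in force)
  also have "\<dots> = 2 * (\<Sum>v\<in>N. if f v = 1 then 1 else 0) - int (card N)"
    by (simp add: sum_subtractf sum_distrib_left)
  also have "(\<Sum>v\<in>N. if f v = 1 then 1 else 0) = int (card {v \<in> N. f v = 1})"
    using assms(1) by (simp add: sum.If_cases Int_def)
  finally show ?thesis .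
qed

lemma cong_halve: "[2 * a = 2 * b] (mod 2 * (c::int)) \<Longrightarrow> [a = b] (mod c)"
  by (simp add: cong_def mult_mod_right[symmetric])

text \<open>
  Directing the edges of R from A to its complement and all others backwards turns degrees in R into
  net outflows.
\<close>

lemma bipartite_factor:
  fixes adj :: "'v \<Rightarrow> 'v \<Rightarrow> bool" and g :: "'v \<Rightarrow> int"
  assumes fin: "finite J" and AJ: "A \<subseteq> J" and mg: "multigraph (\<lambda>u v. of_bool (adj u v))"
    and conn: "\<And>Y. Y \<subseteq> J \<Longrightarrow> Y \<noteq> {} \<Longrightarrow> Y \<noteq> J \<Longrightarrow> 13 * n + 5 \<le> wcut (cross (\<lambda>u v. of_bool (adj u v)) A) J Y"
    and bal: "[sum g A = sum g (J - A)] (mod int n + 1)"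
  obtains R where "\<And>u v. R u v \<Longrightarrow> u \<in> A \<and> v \<in> J - A \<and> adj u v"
    "\<And>v. v \<in> J \<Longrightarrow> [int (card {w. R v w \<or> R w v}) = g v] (mod int n + 1)"
proof -
  let ?m = "cross (\<lambda>u v. of_bool (adj u v)) A"
  have mg': "multigraph ?m" by (rule multigraph_cross[OF mg])
  \<comment> \<open>A vertex of degree d in R has net outflow 2d - deg inside A and deg - 2d
    outside, where the edges of R arrive. Every edge crosses, so in the sum of
    \<open>\<beta>\<close> the degrees cancel and twice the difference in \<open>bal\<close>
    remains.\<close>
  define \<beta> where "\<beta> u = (if u \<in> A then 2 * g u - int (wdeg ?m J u) else int (wdeg ?m J u) - 2 * g u)" for u
  have spl: "sum h J = sum h A + sum h (J - A)" for h :: "'v \<Rightarrow> 'b::comm_monoid_add"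
    using sum.subset_diff[OF AJ fin, of h] by (simp add: add.commute)
  have degA: "(\<Sum>u\<in>A. wdeg ?m J u) = (\<Sum>u\<in>J - A. wdeg ?m J u)"
  proof -
    have "(\<Sum>u\<in>A. wdeg ?m J u) = (\<Sum>u\<in>A. \<Sum>v\<in>J - A. ?m u v)"
      unfolding wdeg_def spl by (intro sum.cong refl) (simp add: cross_def)
    moreover have "(\<Sum>u\<in>J - A. wdeg ?m J u) = (\<Sum>u\<in>J - A. \<Sum>v\<in>A. ?m u v)"
      unfolding wdeg_def spl by (intro sum.cong refl) (simp add: cross_def)
    ultimately show ?thesis using sum_sym_swap[OF mg', of A "J - A"] by simp
  qed
  have "sum \<beta> J = 2 * (sum g A - sum g (J - A)) - int (\<Sum>u\<in>A. wdeg ?m J u) + int (\<Sum>u\<in>J - A. wdeg ?m J u)"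
    unfolding spl by (simp add: \<beta>_def sum_subtractf sum_distrib_left)
  then have "sum \<beta> J = 2 * (sum g A - sum g (J - A))" using degA by simp
  moreover have "2 * (int n + 1) dvd 2 * (sum g A - sum g (J - A))"
    using bal by (intro mult_dvd_mono) (auto simp: cong_iff_dvd_diff)
  ultimately have "[sum \<beta> J = 0] (mod 2 * (int n + 1))" by (simp add: cong_0_iff)
  then have "solvable n J ?m \<beta>"
    by (intro orientation_mod fin mg' conn) (auto simp: \<beta>_def)
  then obtain f where f: "flow J ?m f" and fs: "\<And>u. u \<in> J \<Longrightarrow> [(\<Sum>v\<in>J. f u v) = \<beta> u] (mod 2 * (int n + 1))"
    unfolding solvable_def by blast
  have anti: "f u v = - f v u" if "u \<in> J" "v \<in> J" for u v using f that unfolding flow_def by blast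
  define N where "N u = {v \<in> J. ((u \<in> A) \<noteq> (v \<in> A)) \<and> adj u v}" for u
  have val: "(v \<in> N u \<longrightarrow> f u v = 1 \<or> f u v = - 1) \<and> (v \<notin> N u \<longrightarrow> f u v = 0)" if "u \<in> J" "v \<in> J" for u v
  proof -
    have "\<bar>f u v\<bar> \<le> int (?m u v)" "even (f u v + int (?m u v))" using f that unfolding flow_def by blast+
    moreover have "?m u v = (if v \<in> N u then 1 else 0)" using that by (simp add: N_def cross_def)
    ultimately have "\<bar>f u v\<bar> \<le> (if v \<in> N u then 1 else 0)" "even (f u v + (if v \<in> N u then 1 else 0))"
      by (simp_all split: if_splits)
    then show ?thesis by (cases "v \<in> N u"; simp) presburger
  qed
  have fN: "finite (N u)" for u using fin by (simp add: N_def)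
  have fsum: "(\<Sum>v\<in>J. f u v) = 2 * int (card {v \<in> N u. f u v = 1}) - int (card (N u))" if u: "u \<in> J" for u
  proof -
    have "(\<Sum>v\<in>J. f u v) = (\<Sum>v\<in>N u. f u v)"
      using fin val u by (intro sum.mono_neutral_right) (auto simp: N_def)
    also have "\<dots> = 2 * int (card {v \<in> N u. f u v = 1}) - int (card (N u))"
      using val u by (intro sum_pm_one fN) (auto simp: N_def)
    finally show ?thesis .
  qed
  have degN: "wdeg ?m J u = card (N u)" for u
  proof -
    have "wdeg ?m J u = (\<Sum>v\<in>N u. 1)"
      unfolding wdeg_def N_def using fin by (intro sum.mono_neutral_cong_right) (auto simp: cross_def)
    then show ?thesis by simp
  qed
  define R where "R u v \<longleftrightarrow> u \<in> A \<and> v \<in> J - A \<and> adj u v \<and> f u v = 1" for u v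
  have adjs: "adj u v = adj v u" for u v using multigraph_sym[OF mg, of u v] by (cases "adj u v"; cases "adj v u") simp_all
  have "[int (card {w. R v w \<or> R w v}) = g v] (mod int n + 1)" if v: "v \<in> J" for v
  proof (cases "v \<in> A")
    case True
    then have "{w. R v w \<or> R w v} = {w \<in> N v. f v w = 1}" by (auto simp: R_def N_def)
    then have "[2 * int (card {w. R v w \<or> R w v}) - int (card (N v)) = 2 * g v - int (card (N v))] (mod 2 * (int n + 1))"
      using fs[OF v] fsum[OF v] True by (simp add: \<beta>_def degN)
    then have "[2 * int (card {w. R v w \<or> R w v}) = 2 * g v] (mod 2 * (int n + 1))"
      by (simp add: cong_iff_dvd_diff)
    then show ?thesis by (rule cong_halve)
  next
    case False
    define S where "S = {w \<in> N v. f v w = 1}"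
    have "{w. R v w \<or> R w v} = N v - S"
    proof -
      have "f w v = 1 \<longleftrightarrow> f v w \<noteq> 1" if "w \<in> N v" for w
        using val[OF v, of w] anti[OF v, of w] that by (auto simp: N_def)
      then show ?thesis using False v AJ adjs by (auto simp: R_def N_def S_def)
    qed
    then have "int (card {w. R v w \<or> R w v}) = int (card (N v)) - int (card S)"
      using fN[of v] by (simp add: card_Diff_subset card_mono of_nat_diff S_def)
    then have "(\<Sum>w\<in>J. f v w) = int (card (N v)) - 2 * int (card {w. R v w \<or> R w v})"
      using fsum[OF v] by (simp add: S_def)
    then have "[int (card (N v)) - 2 * int (card {w. R v w \<or> R w v}) = int (card (N v)) - 2 * g v] (mod 2 * (int n + 1))"
      using fs[OF v] False by (simp add: \<beta>_def degN)
    then have "[2 * int (card {w. R v w \<or> R w v}) = 2 * g v] (mod 2 * (int n + 1))"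
      by (simp add: cong_iff_dvd_diff dvd_diff_commute)
    then show ?thesis by (rule cong_halve)
  qed
  moreover have "u \<in> A \<and> v \<in> J - A \<and> adj u v" if "R u v" for u v using that by (simp add: R_def)
  ultimately show ?thesis by (intro that)
qed

subsection \<open>Maximal edge sets with degrees 1 modulo k\<close>

definition mod_one :: "nat \<Rightarrow> 'a set set \<Rightarrow> bool" where
  "mod_one n H \<longleftrightarrow> (\<forall>v\<in>\<Union>H. [edge_degree H v = 1] (mod n + 1))"

definition adjacent :: "'a set set \<Rightarrow> 'a \<Rightarrow> 'a \<Rightarrow> bool" where
  "adjacent G u v \<longleftrightarrow> u \<noteq> v \<and> {u, v} \<in> G"

abbreviation adj_mult :: "'a set set \<Rightarrow> 'a \<Rightarrow> 'a \<Rightarrow> nat" where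
  "adj_mult G u v \<equiv> of_bool (adjacent G u v)"

lemma adjacent_sym: "adjacent G u v \<longleftrightarrow> adjacent G v u"
  by (auto simp: adjacent_def insert_commute)

lemma multigraph_adjacent: "multigraph (adj_mult G)"
  by (auto simp: multigraph_def adjacent_sym) (simp add: adjacent_def)

lemma wcut_cross_complement:
  assumes "Y \<subseteq> J"
  shows "wcut (cross m (J - A)) J Y = wcut (cross m A) J Y"
  unfolding wcut_def using assms by (intro sum.cong refl) (auto simp: cross_def)

lemma sum_card_fibers:
  assumes "finite S" "finite A" "\<And>x. x \<in> S \<Longrightarrow> p x \<in> A"
  shows "(\<Sum>v\<in>A. card {x \<in> S. p x = v}) = card S"
proof -
  have "S = (\<Union>v\<in>A. {x \<in> S. p x = v})" using assms(3) by auto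
  moreover have "card (\<Union>v\<in>A. {x \<in> S. p x = v}) = (\<Sum>v\<in>A. card {x \<in> S. p x = v})"
    using assms by (intro card_UN_disjoint) auto
  ultimately show ?thesis by simp
qed

text \<open>
  A subset S of X is attached by pendant edges to equalise the degree sums of the two sides; the
  edge pq is put into the factor beforehand only to make it nonempty.
\<close>

lemma mod_one_extension:
  fixes E H :: "'a set set"
  assumes finE: "finite E" and HE: "H \<subseteq> E" and H: "mod_one n H"
    and J: "finite J" "A \<subseteq> J"
    and conn: "\<And>Y. Y \<subseteq> J \<Longrightarrow> Y \<noteq> {} \<Longrightarrow> Y \<noteq> J \<Longrightarrow> 13 * n + 6 \<le> wcut (cross (adj_mult (E - H)) A) J Y"
    and pq: "p \<in> A" "q \<in> J - A" "adjacent (E - H) p q"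
    and X: "finite X" "X \<inter> J = {}" "X \<inter> \<Union>H = {}" "\<And>x. x \<in> X \<Longrightarrow> \<exists>w\<in>A. adjacent (E - H) x w"
    and pool: "n \<le> card X \<or> J \<subseteq> \<Union>H"
  obtains H' where "H' \<subseteq> E" "mod_one n H'" "card H < card H'"
proof -
  let ?adj = "adjacent (E - H)"
  define g0 :: "'a \<Rightarrow> int" where "g0 v = (if v \<in> \<Union>H then 0 else 1)" for v
  \<comment> \<open>The surplus of side A, to be absorbed by pendant edges. As a residue modulo n +
    1 it is at most n; it is 0 when H covers J, which is why \<open>pool\<close> offers these two
    alternatives.\<close>
  define j where "j = nat ((sum g0 A - sum g0 (J - A)) mod (int n + 1))"
  have jn: "j \<le> n" unfolding j_def using pos_mod_bound[of "int n + 1" "sum g0 A - sum g0 (J - A)"] by linarith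
  have jc: "[int j = sum g0 A - sum g0 (J - A)] (mod int n + 1)" unfolding j_def by (simp add: cong_def)
  have "j \<le> card X"
  proof (cases "J \<subseteq> \<Union>H")
    case True
    then have "g0 v = 0" if "v \<in> J" for v
      unfolding g0_def by (rule if_P[OF subsetD]) (rule that)
    then have "sum g0 A = 0" "sum g0 (J - A) = 0" using J(2) by (auto intro!: sum.neutral)
    then show ?thesis by (simp add: j_def)
  next
    case False then show ?thesis using pool jn by linarith
  qed
  then obtain S where S: "S \<subseteq> X" "card S = j" "finite S" by (rule obtain_subset_with_card_n)
  have "\<forall>x\<in>X. \<exists>w. w \<in> A \<and> ?adj x w" using X(4) by blast
  then obtain p' where p': "\<And>x. x \<in> X \<Longrightarrow> p' x \<in> A \<and> ?adj x (p' x)" by metis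
  \<comment> \<open>The edge pq is withheld from the factor and added afterwards; the additional
    edge in \<open>conn\<close>, compared with what the factor needs, pays for it.\<close>
  define adj' where "adj' u v \<longleftrightarrow> ?adj u v \<and> {u, v} \<noteq> {p, q}" for u v
  have pq_ne: "p \<noteq> q" using pq by auto
  have mg': "multigraph (\<lambda>u v. of_bool (adj' u v))"
    using multigraph_adjacent[of "E - H"] by (auto simp: multigraph_def adj'_def insert_commute adjacent_sym)
  have cr: "cross (adj_mult (E - H)) A = (\<lambda>u v. cross (\<lambda>u v. of_bool (adj' u v)) A u v + edge_mult p q u v)"
  proof (intro ext)
    fix u v
    show "cross (adj_mult (E - H)) A u v = cross (\<lambda>u v. of_bool (adj' u v)) A u v + edge_mult p q u v"
    proof (cases "{u, v} = {p, q}")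
      case True
      then have "(u = p \<and> v = q) \<or> (u = q \<and> v = p)" by (auto simp: doubleton_eq_iff)
      then show ?thesis using pq adjacent_sym[of "E - H" p q] by (auto simp: cross_def edge_mult_def adj'_def insert_commute)
    next
      case False
      then have "edge_mult p q u v = 0" by (auto simp: edge_mult_def)
      then show ?thesis using False by (simp add: cross_def adj'_def)
    qed
  qed
  have conn': "13 * n + 5 \<le> wcut (cross (\<lambda>u v. of_bool (adj' u v)) A) J Y" if "Y \<subseteq> J" "Y \<noteq> {}" "Y \<noteq> J" for Y
    using conn[OF that] wcut_edge_mult_le[OF J(1) that(1) pq_ne] unfolding cr wcut_add by linarith
  define fib where "fib v = {x \<in> S. p' x = v}" for v
  have pS: "p' x \<in> A" "?adj x (p' x)" "x \<notin> J" "x \<notin> \<Union>H" if "x \<in> S" for x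
    using that S(1) p'[of x] X(2,3) by blast+
  define g where "g v = g0 v - int (card (fib v)) - (if v = p then 1 else 0) - (if v = q then 1 else 0)" for v
  have fA: "finite A" using J finite_subset by blast
  have "sum g A = sum g0 A - int j - 1"
  proof -
    have "sum g A = sum g0 A - int (\<Sum>v\<in>A. card (fib v)) - (\<Sum>v\<in>A. if v = p then 1 else 0) - (\<Sum>v\<in>A. if v = q then 1 else 0)"
      by (simp add: g_def sum_subtractf)
    moreover have "(\<Sum>v\<in>A. card (fib v)) = j"
      unfolding fib_def using sum_card_fibers[OF S(3) fA, of p'] pS(1) S(2) by simp
    ultimately show ?thesis using fA pq by simp
  qed
  moreover have "sum g (J - A) = sum g0 (J - A) - 1"
  proof -
    have "fib v = {}" if "v \<in> J - A" for v using that pS by (auto simp: fib_def)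
    then have "(\<Sum>v\<in>J - A. int (card (fib v))) = 0" by simp
    moreover have "sum g (J - A) = sum g0 (J - A) - (\<Sum>v\<in>J - A. int (card (fib v))) - (\<Sum>v\<in>J - A. if v = p then 1 else 0) - (\<Sum>v\<in>J - A. if v = q then 1 else 0)"
      by (simp add: g_def sum_subtractf)
    ultimately show ?thesis using J pq by simp
  qed
  moreover have "[sum g0 A - int j - 1 = sum g0 A - (sum g0 A - sum g0 (J - A)) - 1] (mod int n + 1)"
    by (intro cong_diff cong_refl jc)
  ultimately have bal: "[sum g A = sum g (J - A)] (mod int n + 1)" by simp
  obtain R where R: "\<And>u v. R u v \<Longrightarrow> u \<in> A \<and> v \<in> J - A \<and> adj' u v"
    and Rg: "\<And>v. v \<in> J \<Longrightarrow> [int (card {w. R v w \<or> R w v}) = g v] (mod int n + 1)"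
    using bipartite_factor[OF J mg' conn' bal] by blast
  define Q where "Q u v \<longleftrightarrow> R u v \<or> (u \<in> S \<and> v = p' u) \<or> (u = p \<and> v = q)" for u v
  define F where "F = {{u, v} |u v. Q u v}"
  have Qadj: "?adj u v" if "Q u v" for u v
    using that R[of u v] pS(2)[of u] pq(3) unfolding Q_def adj'_def by blast
  have FE: "F \<subseteq> E - H" using Qadj unfolding F_def adjacent_def by blast
  have "{p, q} \<in> F" unfolding F_def Q_def by blast
  have finF: "finite F" "finite H" using FE HE finE finite_subset by blast+
  have degF: "edge_degree F v = card {w. Q v w \<or> Q w v}" for v
    unfolding F_def by (rule edge_degree_rel)
  have degJ: "[int (edge_degree F v) = g0 v] (mod int n + 1)" if v: "v \<in> J" for v
  proof -
    define R1 where "R1 = {w. R v w \<or> R w v}"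
    define P where "P = (if v = p then {q} else {}) \<union> (if v = q then {p} else {})"
    have vS: "v \<notin> S" using pS(3) v by blast
    have R1J: "R1 \<subseteq> J" using R J by (auto simp: R1_def)
    have PJ: "P \<subseteq> J" using pq J by (auto simp: P_def)
    have "{w. Q v w \<or> Q w v} = (R1 \<union> P) \<union> fib v"
      unfolding Q_def R1_def P_def fib_def using vS by auto
    moreover have "(R1 \<union> P) \<inter> fib v = {}" using R1J PJ pS(3) by (auto simp: fib_def)
    moreover have "R1 \<inter> P = {}"
    proof -
      have "\<not> R p q" "\<not> R q p" using R[of p q] R[of q p] unfolding adj'_def by (auto simp: insert_commute)
      then show ?thesis by (auto simp: R1_def P_def)
    qed
    moreover have "finite R1" "finite P" "finite (fib v)"
      using R1J PJ J(1) S(3) finite_subset by (auto simp: fib_def)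
    ultimately have "card {w. Q v w \<or> Q w v} = card R1 + card P + card (fib v)"
      by (simp add: card_Un_disjoint)
    moreover have "int (card P) = (if v = p then 1 else 0) + (if v = q then 1 else 0)"
      using pq_ne by (auto simp: P_def)
    ultimately have "g0 v = g v + int (card P + card (fib v))" "int (edge_degree F v) = int (card R1) + int (card P + card (fib v))"
      unfolding degF g_def by simp_all
    then show ?thesis using Rg[OF v] unfolding R1_def[symmetric] by (simp only: cong_add_rcancel)
  qed
  have degS: "edge_degree F v = 1" if v: "v \<in> S" for v
  proof -
    have vJ: "v \<notin> J" using pS(3) v by blast
    have "{w. Q v w \<or> Q w v} = {p' v}"
      using v vJ R pS(1) pq J unfolding Q_def by auto
    then show ?thesis unfolding degF by simp
  qed
  have supp: "v \<in> J \<or> v \<in> S" if "v \<in> \<Union>F" for v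
    using that R pS pq J unfolding F_def Q_def by auto
  have zero: "edge_degree G v = 0" if "v \<notin> \<Union>G" for G :: "'a set set" and v
    using that unfolding edge_degree_def by (simp add: card_eq_0_iff)
  have degU: "edge_degree (H \<union> F) v = edge_degree H v + edge_degree F v" for v
  proof -
    have "{e \<in> H \<union> F. v \<in> e} = {e \<in> H. v \<in> e} \<union> {e \<in> F. v \<in> e}" by auto
    moreover have "{e \<in> H. v \<in> e} \<inter> {e \<in> F. v \<in> e} = {}" using FE by auto
    ultimately show ?thesis unfolding edge_degree_def using finF by (simp add: card_Un_disjoint)
  qed
  have "mod_one n (H \<union> F)"
    unfolding mod_one_def
  proof
    fix v assume v: "v \<in> \<Union>(H \<union> F)"
    have "[int (edge_degree H v + edge_degree F v) = int 1] (mod int (n + 1))"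
    proof (cases "v \<in> \<Union>H")
      case True
      have 1: "[int (edge_degree H v) = int 1] (mod int (n + 1))"
        using H True unfolding mod_one_def cong_int_iff by blast
      have "[int (edge_degree F v) = 0] (mod int n + 1)"
      proof (cases "v \<in> J")
        case vJ: True
        then show ?thesis using degJ[OF vJ] True by (simp add: g0_def)
      next
        case False
        then have "v \<notin> \<Union>F" using supp[of v] pS(4)[of v] True by blast
        then show ?thesis by (simp add: zero)
      qed
      then show ?thesis using cong_add[OF 1, of "int (edge_degree F v)" 0] by (simp add: add.commute)
    next
      case False
      then have F: "v \<in> \<Union>F" using v by blast
      have "[int (edge_degree F v) = 1] (mod int n + 1)"
      proof (cases "v \<in> J")
        case vJ: True
        then show ?thesis using degJ[OF vJ] False by (simp add: g0_def)
      next
        case vJ: False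
        then show ?thesis using supp[OF F] degS[of v] by simp
      qed
      then show ?thesis using zero[OF False] by (simp add: add.commute)
    qed
    then show "[edge_degree (H \<union> F) v = 1] (mod n + 1)"
      unfolding degU cong_int_iff .
  qed
  moreover have "card H < card (H \<union> F)"
  proof (rule psubset_card_mono)
    show "H \<subset> H \<union> F" using \<open>{p, q} \<in> F\<close> FE by blast
  qed (use finF in simp)
  ultimately show ?thesis using that[of "H \<union> F"] HE FE by blast
qed

text \<open>Either X contains all vertices of W missed by H, so that no correction of degree sums is
  called for, or it has 2n elements, of which n have a neighbour on the same side of the maximum
  cut. The extension treats the sides asymmetrically, hence it is applied to A or to
  \<open>J - A\<close>.\<close>

lemma maximal_mod_one_complement:
  assumes G: "finite_simple_graph V E" and HE: "H \<subseteq> E" and H: "mod_one n H"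
    and max: "\<And>H'. H' \<subseteq> E \<Longrightarrow> mod_one n H' \<Longrightarrow> card H' \<le> card H"
    and W0: "W0 \<subseteq> V" "W0 \<noteq> {}"
  shows "\<exists>v\<in>W0. wdeg (adj_mult (E - H)) W0 v < 56 * n + 24"
proof (rule ccontr)
  assume "\<not> ?thesis"
  then have deg: "56 * n + 24 \<le> wdeg (adj_mult (E - H)) W0 v" if "v \<in> W0" for v
    using that by (meson not_less)
  have finE: "finite E" using G by (rule finite_simple_graph_finite_edges)
  have "finite W0" using G W0 finite_subset unfolding finite_simple_graph_def by blast
  let ?m = "adj_mult (E - H)"
  note mg = multigraph_adjacent[of "E - H"]
  obtain W where W: "W \<subseteq> W0" "4 * n + 2 \<le> card W"
    and conn: "\<And>X Y. X \<subseteq> W \<Longrightarrow> card X \<le> 2 * n \<Longrightarrow> Y \<subseteq> W - X \<Longrightarrow> Y \<noteq> {} \<Longrightarrow> Y \<noteq> W - X \<Longrightarrow> 26 * n + 12 \<le> wcut ?m (W - X) Y"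
    by (rule highly_connected_subgraph[OF mg _ \<open>finite W0\<close> W0(2) deg]) simp_all
  have fW: "finite W" using W(1) \<open>finite W0\<close> finite_subset by blast
  obtain X where X: "X \<subseteq> W - \<Union>H" "card X \<le> 2 * n" "X = W - \<Union>H \<or> card X = 2 * n"
  proof (cases "card (W - \<Union>H) \<le> 2 * n")
    case True then show ?thesis using that by blast
  next
    case False
    then obtain X where "X \<subseteq> W - \<Union>H" "card X = 2 * n" by (metis nat_le_linear obtain_subset_with_card_n)
    then show ?thesis using that by simp
  qed
  define J where "J = W - X"
  have XW: "X \<subseteq> W" "finite X" using X fW finite_subset by blast+
  have fJ: "finite J" using fW by (simp add: J_def)
  have cJ: "2 \<le> card J" using W(2) X(2) XW by (simp add: J_def card_Diff_subset)
  obtain A where A: "A \<subseteq> J" "\<And>Y. Y \<subseteq> J \<Longrightarrow> wcut ?m J Y \<le> 2 * wcut (cross ?m A) J Y"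
    using max_cut[OF mg fJ] by blast
  have connA: "13 * n + 6 \<le> wcut (cross ?m A) J Y" if "Y \<subseteq> J" "Y \<noteq> {}" "Y \<noteq> J" for Y
  proof -
    have "26 * n + 12 \<le> wcut ?m J Y"
      unfolding J_def by (rule conn[OF XW(1) X(2)]) (use that in \<open>simp_all add: J_def\<close>)
    then show ?thesis using A(2)[OF that(1)] by linarith
  qed
  have connB: "13 * n + 6 \<le> wcut (cross ?m (J - A)) J Y" if "Y \<subseteq> J" "Y \<noteq> {}" "Y \<noteq> J" for Y
    using connA[OF that] wcut_cross_complement[OF that(1)] by metis
  obtain p q where pq: "p \<in> A" "q \<in> J - A" "adjacent (E - H) p q"
  proof -
    obtain y where y: "y \<in> J" using cJ by fastforce
    then have "{y} \<noteq> J" using cJ by auto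
    then have "13 * n + 6 \<le> wcut (cross ?m A) J {y}" using y by (intro connA) auto
    then have "(\<Sum>z\<in>J - {y}. cross ?m A y z) \<noteq> 0" by (simp add: wcut_def)
    then obtain z where z: "z \<in> J - {y}" "cross ?m A y z \<noteq> 0" by (rule sum.not_neutral_contains_not_neutral)
    then have "adjacent (E - H) y z" "(y \<in> A) \<noteq> (z \<in> A)" by (auto simp: cross_def split: if_splits)
    then show ?thesis using that[of y z] that[of z y] y z(1) adjacent_sym[of "E - H" y z] by blast
  qed
  \<comment> \<open>Putting x back amounts to deleting \<open>X - {x}\<close>, after which the graph
    is still highly connected; so x cannot be isolated from J.\<close>
  have nbr: "\<exists>w\<in>J. adjacent (E - H) x w" if x: "x \<in> X" for x
  proof -
    have "card (X - {x}) \<le> 2 * n" using X(2) card_mono[OF XW(2), of "X - {x}"] by auto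
    moreover have e: "W - (X - {x}) = insert x J" using x XW by (auto simp: J_def)
    moreover have xJ: "x \<notin> J" using x by (simp add: J_def)
    moreover have Jne: "J \<noteq> {}" using cJ by auto
    ultimately have "26 * n + 12 \<le> wcut ?m (insert x J) {x}"
      using conn[of "X - {x}" "{x}"] XW by auto
    then have "(\<Sum>w\<in>J. ?m x w) \<noteq> 0" using xJ unfolding wcut_def by auto
    then obtain w where "w \<in> J" "?m x w \<noteq> 0" by (rule sum.not_neutral_contains_not_neutral)
    then show ?thesis by (auto split: if_splits)
  qed
  define XA where "XA = {x \<in> X. \<exists>w\<in>A. adjacent (E - H) x w}"
  define XB where "XB = {x \<in> X. \<exists>w\<in>J - A. adjacent (E - H) x w}"
  have XA: "finite XA" "XA \<inter> J = {}" "XA \<inter> \<Union>H = {}" "\<And>x. x \<in> XA \<Longrightarrow> \<exists>w\<in>A. adjacent (E - H) x w"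
    using XW X(1) unfolding XA_def J_def by auto
  have XB: "finite XB" "XB \<inter> J = {}" "XB \<inter> \<Union>H = {}" "\<And>x. x \<in> XB \<Longrightarrow> \<exists>w\<in>J - A. adjacent (E - H) x w"
    using XW X(1) unfolding XB_def J_def by auto
  have "X = XA \<union> XB" unfolding XA_def XB_def using nbr by blast
  then have "card X \<le> card XA + card XB" by (metis card_Un_le)
  then have "(n \<le> card XA \<or> J \<subseteq> \<Union>H) \<or> n \<le> card XB"
    using X(3) unfolding J_def by auto
  then obtain H' where "H' \<subseteq> E" "mod_one n H'" "card H < card H'"
  proof
    assume pool: "n \<le> card XA \<or> J \<subseteq> \<Union>H"
    show ?thesis
      by (rule mod_one_extension[OF finE HE H fJ A(1) _ pq XA pool])
        (rule connA, assumption+, rule that, assumption+)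
  next
    assume pool: "n \<le> card XB"
    have qp: "p \<in> J - (J - A)" using pq(1) A(1) by blast
    show ?thesis
      by (rule mod_one_extension[OF finE HE H fJ _ _ pq(2) qp adjacent_sym[THEN iffD1, OF pq(3)] XB disjI1[OF pool]])
        (rule Diff_subset, rule connB, assumption+, rule that, assumption+)
  qed
  then show False using max[of H'] by linarith
qed

subsection \<open>Colouring degenerate graphs\<close>

definition zero_or_one_mod :: "nat \<Rightarrow> nat \<Rightarrow> bool" where
  "zero_or_one_mod n c \<longleftrightarrow> c = 0 \<or> [c = 1] (mod n + 1)"

lemma greedy_injective_choice:
  assumes "finite U" "\<And>w. w \<in> U \<Longrightarrow> finite (bad w) \<and> card (bad w) + card U \<le> p"
  shows "\<exists>col. inj_on col U \<and> (\<forall>w\<in>U. col w \<in> {q..<q + p} - bad w)"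
  using assms
proof (induction U rule: finite_induct)
  case (insert a U)
  have "\<exists>col. inj_on col U \<and> (\<forall>w\<in>U. col w \<in> {q..<q + p} - bad w)"
  proof (rule insert.IH)
    fix w assume "w \<in> U"
    then have "finite (bad w) \<and> card (bad w) + card (insert a U) \<le> p" by (intro insert.prems) simp
    then show "finite (bad w) \<and> card (bad w) + card U \<le> p" using insert.hyps by simp
  qed
  then obtain col where col: "inj_on col U" "\<And>w. w \<in> U \<Longrightarrow> col w \<in> {q..<q + p} - bad w" by blast
  have a: "finite (bad a)" "card (bad a) + card U < p" using insert.prems[of a] insert.hyps by auto
  have "card (bad a \<union> col ` U) < card {q..<q + p}"
    using card_Un_le[of "bad a" "col ` U"] card_image_le[OF insert.hyps(1), of col] a(2) by simp
  then have "\<not> {q..<q + p} \<subseteq> bad a \<union> col ` U"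
    using card_mono[of "bad a \<union> col ` U" "{q..<q + p}"] a(1) insert.hyps(1) by auto
  then obtain x where x: "x \<in> {q..<q + p}" "x \<notin> bad a" "x \<notin> col ` U" by blast
  have "inj_on (col(a := x)) (insert a U)"
    using col(1) x(3) insert.hyps(2) by (auto simp: inj_on_def)
  moreover have "\<forall>w\<in>insert a U. (col(a := x)) w \<in> {q..<q + p} - bad w"
    using col(2) x insert.hyps(2) by auto
  ultimately show ?case by blast
qed simp

text \<open>N consists of the later neighbours of a centre, \<open>forb w\<close> of the colours
  between w and vertices processed before, and \<open>Bk\<close> of the colours from the centre to
  earlier vertices. The latter are distinct, so each contributes exactly one edge at the centre,
  which the \<open>of_bool\<close> accounts for.\<close>

lemma star_coloring:
  fixes forb :: "'a \<Rightarrow> nat set"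
  assumes N: "finite N" and forb: "\<And>w. w \<in> N \<Longrightarrow> finite (forb w) \<and> card (forb w) \<le> 56 * n + 24"
    and Bk: "finite Bk" "card Bk \<le> 56 * n + 24"
  obtains col where "\<And>w. w \<in> N \<Longrightarrow> col w < 187 * n + 78 \<and> col w \<notin> forb w"
    "\<And>c. zero_or_one_mod n (card {w \<in> N. col w = c} + of_bool (c \<in> Bk))"
proof -
  define cnt where "cnt S col c = card {w \<in> S. col w = c} + of_bool (c \<in> Bk)" for S and col :: "'a \<Rightarrow> nat" and c
  define good where "good S col \<longleftrightarrow> (\<forall>w\<in>S. col w < 70 * n + 30 \<and> col w \<notin> forb w) \<and> (\<forall>c. zero_or_one_mod n (cnt S col c))" for S col
  define Q where "Q = {S. S \<subseteq> N \<and> (\<exists>col. good S col)}"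
  have "finite Q" using N by (simp add: Q_def)
  moreover have "{} \<in> Q" by (simp add: Q_def good_def cnt_def zero_or_one_mod_def)
  ultimately obtain S where S: "S \<in> Q" "Max (card ` Q) = card S"
    using obtains_MAX[of Q card] by blast
  have max: "card S' \<le> card S" if "S' \<in> Q" for S'
    unfolding S(2)[symmetric] using \<open>finite Q\<close> that by (intro Max_ge) auto
  obtain col1 where SN: "S \<subseteq> N" and g1: "good S col1" using S(1) unfolding Q_def by blast
  define U where "U = N - S"
  have fU: "finite U" and fS: "finite S" using N SN finite_subset unfolding U_def by auto
  have avail: "card {w \<in> U. c \<notin> forb w} \<le> n" if c: "c < 70 * n + 30" for c
  proof (rule ccontr)
    define T where "T = {w \<in> U. c \<notin> forb w}"
    assume "\<not> ?thesis"
    then have "(if cnt S col1 c = 0 then 1 else n + 1) \<le> card T" by (simp add: T_def)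
    then obtain T' where T': "T' \<subseteq> T" "card T' = (if cnt S col1 c = 0 then 1 else n + 1)" "finite T'"
      by (rule obtain_subset_with_card_n)
    define col where "col w = (if w \<in> T' then c else col1 w)" for w
    have dis: "T' \<inter> S = {}" "T' \<subseteq> N" using T' by (auto simp: T_def U_def)
    have "{w \<in> S \<union> T'. col w = c'} = {w \<in> S. col1 w = c'} \<union> (if c' = c then T' else {})" for c'
      using dis by (auto simp: col_def)
    moreover have "card ({w \<in> S. col1 w = c'} \<union> (if c' = c then T' else {})) = card {w \<in> S. col1 w = c'} + (if c' = c then card T' else 0)" for c'
      using dis T'(3) fS by (subst card_Un_disjoint) auto
    ultimately have cnt: "cnt (S \<union> T') col c' = cnt S col1 c' + (if c' = c then card T' else 0)" for c'
      unfolding cnt_def by simp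
    have "zero_or_one_mod n (cnt (S \<union> T') col c')" for c'
    proof (cases "c' = c")
      case True
      have "zero_or_one_mod n (cnt S col1 c)" using g1 unfolding good_def by blast
      moreover have "[a + (n + 1) = 1] (mod n + 1)" if "[a = 1] (mod n + 1)" for a
        using that unfolding cong_def by (simp only: mod_add_self2)
      ultimately show ?thesis
        unfolding cnt True T'(2) zero_or_one_mod_def by (cases "cnt S col1 c = 0") simp_all
    next
      case False then show ?thesis unfolding cnt using g1 unfolding good_def by simp
    qed
    moreover have "\<forall>w\<in>S \<union> T'. col w < 70 * n + 30 \<and> col w \<notin> forb w"
      using g1 c T'(1) unfolding good_def col_def T_def by auto
    ultimately have "S \<union> T' \<in> Q" using SN dis unfolding Q_def good_def by blast
    then have "card (S \<union> T') \<le> card S" by (rule max)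
    moreover have "card (S \<union> T') = card S + card T'" using fS T'(3) dis by (intro card_Un_disjoint) auto
    ultimately show False using T'(2) by (auto split: if_splits)
  qed
  \<comment> \<open>Double counting: every uncoloured vertex admits at least (70n + 30) - (56n + 24)
    = 14n + 6 colours, every colour suits at most n of them, and 70n + 30 = 5(14n + 6).\<close>
  have "card U \<le> 5 * n"
  proof -
    have "(14 * n + 6) * card U = (\<Sum>w\<in>U. 14 * n + 6)" by simp
    also have "\<dots> \<le> (\<Sum>w\<in>U. card ({..<70 * n + 30} - forb w))"
    proof (rule sum_mono)
      fix w assume "w \<in> U"
      then have "finite (forb w)" "card (forb w) \<le> 56 * n + 24" using forb[of w] by (auto simp: U_def)
      then show "14 * n + 6 \<le> card ({..<70 * n + 30} - forb w)"
        using diff_card_le_card_Diff[of "forb w" "{..<70 * n + 30}"] by simp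
    qed
    also have "\<dots> = (\<Sum>w\<in>U. \<Sum>c<70 * n + 30. of_bool (c \<notin> forb w))"
      by (intro sum.cong refl) (simp add: set_diff_eq Int_def of_bool_def sum.If_cases)
    also have "\<dots> = (\<Sum>c<70 * n + 30. \<Sum>w\<in>U. of_bool (c \<notin> forb w))" by (rule sum.swap)
    also have "\<dots> = (\<Sum>c<70 * n + 30. card {w \<in> U. c \<notin> forb w})"
      using fU by (intro sum.cong refl) (simp add: Int_def of_bool_def sum.If_cases)
    also have "\<dots> \<le> (\<Sum>c<70 * n + 30. n)" using avail by (intro sum_mono) simp
    also have "\<dots> = (14 * n + 6) * (5 * n)" by (simp add: algebra_simps)
    finally show ?thesis by (subst (asm) mult_le_cancel1) simp
  qed
  \<comment> \<open>The second palette has room for both forbidden sets and all of U: 2(56n + 24) +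
    5n = 117n + 48. Avoiding \<open>Bk\<close> as well keeps each of its classes at the centre of
    size at most one.\<close>
  then have "finite (forb w \<union> Bk) \<and> card (forb w \<union> Bk) + card U \<le> 117 * n + 48" if "w \<in> U" for w
    using forb[of w] Bk card_Un_le[of "forb w" Bk] that by (auto simp: U_def)
  then obtain col2 where inj2: "inj_on col2 U"
    and col2: "\<And>w. w \<in> U \<Longrightarrow> col2 w \<in> {70 * n + 30..<70 * n + 30 + (117 * n + 48)} - (forb w \<union> Bk)"
    using greedy_injective_choice[OF fU, of "\<lambda>w. forb w \<union> Bk" "117 * n + 48" "70 * n + 30"] by metis
  define col where "col w = (if w \<in> S then col1 w else col2 w)" for w
  have "col w < 187 * n + 78 \<and> col w \<notin> forb w" if w: "w \<in> N" for w
  proof (cases "w \<in> S")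
    case True
    then have "col1 w < 70 * n + 30 \<and> col1 w \<notin> forb w" using g1 unfolding good_def by blast
    then show ?thesis using True by (auto simp: col_def)
  next
    case False
    then show ?thesis using col2[of w] w by (auto simp: col_def U_def)
  qed
  moreover have "zero_or_one_mod n (card {w \<in> N. col w = c} + of_bool (c \<in> Bk))" for c
  proof (cases "c < 70 * n + 30")
    case True
    have "{w \<in> N. col w = c} = {w \<in> S. col1 w = c}"
      using SN col2 True by (fastforce simp: col_def U_def)
    then show ?thesis using g1 unfolding good_def cnt_def by metis
  next
    case False
    have eq: "{w \<in> N. col w = c} = {w \<in> U. col2 w = c}"
    proof -
      have "col1 w \<noteq> c" if "w \<in> S" for w using g1 that False unfolding good_def by blast
      then show ?thesis using SN by (auto simp: col_def U_def)
    qed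
    have "card {w \<in> U. col2 w = c} \<le> 1"
      using inj2 by (subst One_nat_def, intro card_le_Suc0_iff_eq[THEN iffD2]) (use fU in \<open>auto simp: inj_on_def\<close>)
    moreover have "card {w \<in> U. col2 w = c} = 0" if "c \<in> Bk"
    proof -
      have "{w \<in> U. col2 w = c} = {}" using col2 that by blast
      then show ?thesis by (simp only: card.empty)
    qed
    ultimately have "card {w \<in> U. col2 w = c} + of_bool (c \<in> Bk) \<le> 1" by (cases "c \<in> Bk") simp_all
    moreover have "zero_or_one_mod n x" if "x \<le> 1" for x
    proof -
      have "x = 0 \<or> x = 1" using that by linarith
      then show ?thesis unfolding zero_or_one_mod_def by (elim disjE) simp_all
    qed
    ultimately show ?thesis unfolding eq by blast
  qed
  ultimately show ?thesis by (rule that)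
qed

section \<open>Colouring along a degeneracy ordering\<close>

lemma degeneracy_ordering:
  assumes "finite V" "\<And>W. W \<subseteq> V \<Longrightarrow> W \<noteq> {} \<Longrightarrow> \<exists>v\<in>W. card {w \<in> W. adj v w} \<le> d"
  shows "\<exists>r :: 'a \<Rightarrow> nat. inj_on r V \<and> (\<forall>v\<in>V. r v < card V) \<and> (\<forall>v\<in>V. card {w \<in> V. adj v w \<and> r w < r v} \<le> d)"
  using assms
proof (induction "card V" arbitrary: V rule: less_induct)
  case less
  show ?case
  proof (cases "V = {}")
    case True then show ?thesis by simp
  next
    case False
    then obtain v where v: "v \<in> V" "card {w \<in> V. adj v w} \<le> d" using less.prems(2)[of V] by blast
    define U where "U = V - {v}"
    have U: "card U < card V" "finite U" "U \<subseteq> V"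
      unfolding U_def using card_Diff1_less[OF less.prems(1) v(1)] less.prems(1) by auto
    have "\<exists>r :: 'a \<Rightarrow> nat. inj_on r U \<and> (\<forall>v\<in>U. r v < card U) \<and> (\<forall>v\<in>U. card {w \<in> U. adj v w \<and> r w < r v} \<le> d)"
      by (rule less.hyps[OF U(1,2)]) (use less.prems(2) U(3) in \<open>meson subset_trans\<close>)
    then obtain r :: "'a \<Rightarrow> nat" where r0: "inj_on r U" "\<forall>v\<in>U. r v < card U"
      "\<forall>v\<in>U. card {w \<in> U. adj v w \<and> r w < r v} \<le> d"
      by (elim exE conjE) (rule that)
    then have r: "inj_on r U" "\<And>u. u \<in> U \<Longrightarrow> r u < card U"
      "\<And>u. u \<in> U \<Longrightarrow> card {w \<in> U. adj u w \<and> r w < r u} \<le> d"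
      by simp_all
    define r' where "r' = r(v := card U)"
    have r'U: "r' u = r u" "r' u < card U" if "u \<in> U" for u using that r(2) by (auto simp: r'_def U_def)
    have r'v: "r' v = card U" by (simp add: r'_def)
    have V: "V = insert v U" "v \<notin> U" using v by (auto simp: U_def)
    have "inj_on r' V"
    proof -
      have "inj_on r' U" using r(1) r'U(1) by (simp add: inj_on_def)
      moreover have "r' v \<notin> r' ` U"
      proof
        assume "r' v \<in> r' ` U"
        then obtain u where "u \<in> U" "r' v = r' u" by blast
        then show False using r'U(2)[of u] r'v by linarith
      qed
      ultimately show ?thesis unfolding V(1) using V(2) by (simp add: inj_on_insert)
    qed
    moreover have "r' u < card V" if "u \<in> V" for u
    proof (cases "u = v")
      case False
      then have "u \<in> U" using that V(1) by blast
      then show ?thesis using r'U(2)[of u] U(1) by linarith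
    qed (use r'v U(1) in simp)
    moreover have "card {w \<in> V. adj u w \<and> r' w < r' u} \<le> d" if u: "u \<in> V" for u
    proof (cases "u = v")
      case True
      have "card {w \<in> V. adj v w \<and> r' w < r' v} \<le> card {w \<in> V. adj v w}"
        using less.prems(1) by (intro card_mono) auto
      then show ?thesis using v(2) True by simp
    next
      case False
      then have uU: "u \<in> U" using u V by blast
      have "{w \<in> V. adj u w \<and> r' w < r' u} = {w \<in> U. adj u w \<and> r w < r u}"
      proof (intro equalityI subsetI)
        fix w assume w: "w \<in> {w \<in> V. adj u w \<and> r' w < r' u}"
        then have "w \<noteq> v" using r'U(2)[OF uU] r'v by auto
        then have "w \<in> U" using w V(1) by blast
        then show "w \<in> {w \<in> U. adj u w \<and> r w < r u}" using w r'U(1)[OF uU] r'U(1)[of w] by simp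
      next
        fix w assume w: "w \<in> {w \<in> U. adj u w \<and> r w < r u}"
        then show "w \<in> {w \<in> V. adj u w \<and> r' w < r' u}"
          using r'U(1)[OF uU] r'U(1)[of w] U(3) by auto
      qed
      then show ?thesis using r(3)[OF uU] by simp
    qed
    ultimately show ?thesis by blast
  qed
qed

text \<open>Stage i has coloured the stars of all vertices of rank below i. Every edge at such a
  vertex has its lower end among them and is final, so its classes stay correct. For the other
  vertices, distinct colours towards processed neighbours are what the next star needs at its
  centre.\<close>

lemma degenerate_coloring:
  fixes G :: "'a set set" and r :: "'a \<Rightarrow> nat"
  assumes V: "finite V" and inj: "inj_on r V"
    and few: "\<forall>v\<in>V. card {w \<in> V. adjacent G v w \<and> r w < r v} \<le> 56 * n + 24"
  shows "\<exists>c :: 'a set \<Rightarrow> nat.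
    (\<forall>u\<in>V. \<forall>v\<in>V. adjacent G u v \<longrightarrow> r u < i \<longrightarrow> r u < r v \<longrightarrow> c {u, v} < 187 * n + 78) \<and>
    (\<forall>v\<in>V. r v < i \<longrightarrow> (\<forall>x. zero_or_one_mod n (card {w \<in> V. adjacent G v w \<and> c {v, w} = x}))) \<and>
    (\<forall>w\<in>V. i \<le> r w \<longrightarrow> inj_on (\<lambda>u. c {u, w}) {u \<in> V. adjacent G w u \<and> r u < i})"
proof (induction i)
  case 0
  show ?case by simp
next
  case (Suc i)
  let ?adj = "adjacent G"
  obtain c :: "'a set \<Rightarrow> nat" where IH:
    "\<forall>u\<in>V. \<forall>v\<in>V. ?adj u v \<longrightarrow> r u < i \<longrightarrow> r u < r v \<longrightarrow> c {u, v} < 187 * n + 78"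
    "\<forall>v\<in>V. r v < i \<longrightarrow> (\<forall>x. zero_or_one_mod n (card {w \<in> V. ?adj v w \<and> c {v, w} = x}))"
    "\<forall>w\<in>V. i \<le> r w \<longrightarrow> inj_on (\<lambda>u. c {u, w}) {u \<in> V. ?adj w u \<and> r u < i}"
    using Suc.IH by (elim exE conjE) (rule that)
  then have
    c0: "\<And>u v. u \<in> V \<Longrightarrow> v \<in> V \<Longrightarrow> ?adj u v \<Longrightarrow> r u < i \<Longrightarrow> r u < r v \<Longrightarrow> c {u, v} < 187 * n + 78"
    and c1: "\<And>v x. v \<in> V \<Longrightarrow> r v < i \<Longrightarrow> zero_or_one_mod n (card {w \<in> V. ?adj v w \<and> c {v, w} = x})"
    and c2: "\<And>w. w \<in> V \<Longrightarrow> i \<le> r w \<Longrightarrow> inj_on (\<lambda>u. c {u, w}) {u \<in> V. ?adj w u \<and> r u < i}"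
    by simp_all
  show ?case
  proof (cases "\<exists>v\<in>V. r v = i")
    case False
    then have "r v < Suc i \<longleftrightarrow> r v < i" "Suc i \<le> r v \<longleftrightarrow> i \<le> r v" if "v \<in> V" for v
      using that by (auto simp: less_Suc_eq Suc_le_eq le_less)
    then have "{u \<in> V. ?adj w u \<and> r u < Suc i} = {u \<in> V. ?adj w u \<and> r u < i}" for w by auto
    then show ?thesis
      using c0 c1 c2 \<open>\<And>v. v \<in> V \<Longrightarrow> r v < Suc i \<longleftrightarrow> r v < i\<close> \<open>\<And>v. v \<in> V \<Longrightarrow> Suc i \<le> r v \<longleftrightarrow> i \<le> r v\<close>
      by (intro exI[of _ c]) simp
  next
    case True
    then obtain v where v: "v \<in> V" "r v = i" by blast
    define N where "N = {w \<in> V. ?adj v w \<and> i < r w}"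
    define B where "B w = {u \<in> V. ?adj w u \<and> r u < i}" for w
    define forb where "forb w = (\<lambda>u. c {u, w}) ` B w" for w
    have fB: "finite (B w)" for w using V by (simp add: B_def)
    have cardB: "card (B w) \<le> 56 * n + 24" if "w \<in> V" "i \<le> r w" for w
    proof -
      have "card (B w) \<le> card {u \<in> V. ?adj w u \<and> r u < r w}"
        using V that by (intro card_mono) (auto simp: B_def)
      then show ?thesis using few that(1) by fastforce
    qed
    have forb: "finite (forb w) \<and> card (forb w) \<le> 56 * n + 24" if "w \<in> V" "i \<le> r w" for w
      using card_image_le[OF fB, of "\<lambda>u. c {u, w}" w] cardB[OF that] fB by (auto simp: forb_def)
    obtain col where col: "\<And>w. w \<in> N \<Longrightarrow> col w < 187 * n + 78 \<and> col w \<notin> forb w"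
      and colc: "\<And>x. zero_or_one_mod n (card {w \<in> N. col w = x} + of_bool (x \<in> forb v))"
    proof (rule star_coloring[of N forb n "forb v"])
      show "finite N" using V by (simp add: N_def)
      show "finite (forb w) \<and> card (forb w) \<le> 56 * n + 24" if "w \<in> N" for w
        using that by (intro forb) (auto simp: N_def)
      show "finite (forb v)" "card (forb v) \<le> 56 * n + 24" using forb[of v] v by auto
    qed (rule that)
    \<comment> \<open>For an edge at v, \<open>the_elem (e - {v})\<close> is the other end. Only
      edges from v to later vertices are recoloured.\<close>
    define c' where "c' e = (if v \<in> e \<and> the_elem (e - {v}) \<in> N then col (the_elem (e - {v})) else c e)" for e
    have c'N: "c' {v, w} = col w" if "w \<in> N" for w
    proof -
      have "w \<noteq> v" using that v by (auto simp: N_def)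
      then have "{v, w} - {v} = {w}" by auto
      then show ?thesis using that by (simp add: c'_def)
    qed
    have c'v: "c' {v, u} = c {v, u}" if "u \<notin> N" "u \<noteq> v" for u
    proof -
      have "{v, u} - {v} = {u}" using that by auto
      then show ?thesis using that by (simp add: c'_def)
    qed
    have c'o: "c' {u, w} = c {u, w}" if "u \<noteq> v" "w \<noteq> v" for u w
      using that by (auto simp: c'_def)
    have c'low: "c' {u, w} = c {u, w}" if "u \<in> V" "r u < i" "u \<noteq> w" for u w
    proof -
      have "u \<notin> N" "u \<noteq> v" using that v by (auto simp: N_def)
      then show ?thesis using c'v[of u] c'o[of u w] by (cases "w = v") (auto simp: insert_commute)
    qed
    show ?thesis
    proof (intro exI[of _ c'] conjI ballI allI impI)
      fix u w assume h: "u \<in> V" "w \<in> V" "?adj u w" "r u < Suc i" "r u < r w"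
      show "c' {u, w} < 187 * n + 78"
      proof (cases "r u < i")
        case True
        have "u \<noteq> w" using h by auto
        then show ?thesis using c'low[OF h(1) True] c0[OF h(1,2,3) True h(5)] by simp
      next
        case False
        then have "u = v" using h v inj by (metis inj_onD less_antisym)
        then have "w \<in> N" using h v by (simp add: N_def)
        then show ?thesis using c'N col \<open>u = v\<close> by simp
      qed
    next
      fix u x assume h: "u \<in> V" "r u < Suc i"
      show "zero_or_one_mod n (card {w \<in> V. ?adj u w \<and> c' {u, w} = x})"
      proof (cases "r u < i")
        case True
        have "{w \<in> V. ?adj u w \<and> c' {u, w} = x} = {w \<in> V. ?adj u w \<and> c {u, w} = x}"
          using c'low[OF h(1) True] by (auto simp: adjacent_def)
        then show ?thesis using c1[OF h(1) True] by simp
      next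
        case False
        then have uv: "u = v" using h v inj by (metis inj_onD less_antisym)
        have part: "w \<in> N \<or> w \<in> B v" if "w \<in> V" "?adj v w" for w
        proof -
          have "r w \<noteq> i" using inj_onD[OF inj, of w v] that v by (auto simp: adjacent_def)
          then show ?thesis using that by (auto simp: N_def B_def)
        qed
        have "{w \<in> V. ?adj v w \<and> c' {v, w} = x} = {w \<in> N. col w = x} \<union> {w \<in> B v. c {w, v} = x}"
        proof -
          have c'B: "c' {v, w} = c {w, v}" if "w \<in> B v" for w
            using c'v[of w] that v by (auto simp: B_def N_def insert_commute adjacent_def)
          have NB: "w \<in> V \<and> ?adj v w" if "w \<in> N \<or> w \<in> B v" for w using that by (auto simp: N_def B_def)
          show ?thesis
          proof (intro set_eqI iffI)
            fix w assume "w \<in> {w \<in> V. ?adj v w \<and> c' {v, w} = x}"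
            then have w: "w \<in> V" "?adj v w" "c' {v, w} = x" by auto
            from part[OF w(1,2)] show "w \<in> {w \<in> N. col w = x} \<union> {w \<in> B v. c {w, v} = x}"
              using w(3) c'N c'B by auto
          next
            fix w assume "w \<in> {w \<in> N. col w = x} \<union> {w \<in> B v. c {w, v} = x}"
            then show "w \<in> {w \<in> V. ?adj v w \<and> c' {v, w} = x}" using NB c'N c'B by auto
          qed
        qed
        moreover have "card ({w \<in> N. col w = x} \<union> {w \<in> B v. c {w, v} = x}) = card {w \<in> N. col w = x} + card {w \<in> B v. c {w, v} = x}"
          using fB[of v] V by (intro card_Un_disjoint) (auto simp: N_def B_def)
        moreover have "card {w \<in> B v. c {w, v} = x} = of_bool (x \<in> forb v)"
        proof (cases "x \<in> forb v")
          case True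
          then obtain w0 where w0: "w0 \<in> B v" "c {w0, v} = x" by (auto simp: forb_def)
          have "inj_on (\<lambda>u. c {u, v}) (B v)" using c2[of v] v by (simp add: B_def)
          then have "{w \<in> B v. c {w, v} = x} = {w0}" using w0 by (auto simp: inj_on_def)
          then show ?thesis using True by simp
        next
          case False
          then have "{w \<in> B v. c {w, v} = x} = {}" by (auto simp: forb_def)
          then show ?thesis using False by (simp only: card.empty of_bool_eq)
        qed
        ultimately show ?thesis using colc[of x] uv by simp
      qed
    next
      fix w assume w: "w \<in> V" "Suc i \<le> r w"
      have wv: "w \<noteq> v" using w v by auto
      have old: "inj_on (\<lambda>u. c {u, w}) (B w)" using c2[of w] w by (simp add: B_def)
      have same: "c' {u, w} = c {u, w}" if "u \<in> B w" for u
        using that v wv by (intro c'o) (auto simp: B_def)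
      have inj': "inj_on (\<lambda>u. c' {u, w}) (B w)"
        using old same by (simp add: inj_on_def)
      show "inj_on (\<lambda>u. c' {u, w}) {u \<in> V. ?adj w u \<and> r u < Suc i}"
      proof (cases "?adj w v")
        case True
        have "{u \<in> V. ?adj w u \<and> r u < Suc i} = insert v (B w)"
        proof -
          have uv: "r u = i \<longleftrightarrow> u = v" if "u \<in> V" for u using inj_onD[OF inj, of u v] that v by auto
          show ?thesis
          proof (intro equalityI subsetI)
            fix u assume u: "u \<in> {u \<in> V. ?adj w u \<and> r u < Suc i}"
            then show "u \<in> insert v (B w)" using uv[of u] by (cases "r u = i") (simp_all add: B_def)
          next
            fix u assume "u \<in> insert v (B w)"
            then show "u \<in> {u \<in> V. ?adj w u \<and> r u < Suc i}" using True v by (elim insertE) (simp_all add: B_def)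
          qed
        qed
        moreover have "w \<in> N" using True w by (simp add: N_def adjacent_sym[of G v w])
        then have "c' {v, w} \<notin> (\<lambda>u. c' {u, w}) ` B w"
          using col[of w] c'N[of w] same unfolding forb_def by (metis (no_types, lifting) image_cong)
        ultimately show ?thesis using inj' by (simp only: inj_on_insert) blast
      next
        case False
        have "{u \<in> V. ?adj w u \<and> r u < Suc i} = B w"
        proof -
          have "r u < Suc i \<longleftrightarrow> r u < i" if "u \<in> V" "?adj w u" for u
          proof -
            have "r u \<noteq> i" using inj_onD[OF inj, of u v] that v False by auto
            then show ?thesis by linarith
          qed
          then show ?thesis unfolding B_def by blast
        qed
        then show ?thesis using inj' by simp
      qed
    qed
  qed
qed

section \<open>Assembling the colouring\<close>

theorem theorem5:
  fixes k :: nat and V :: "'a set" and E :: "'a set set"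
  assumes "k \<ge> 2"
    and "finite_simple_graph V E"
  shows "chi'_index k E \<le> 198 * k - 101"
proof -
  obtain n where k: "k = n + 1" using assms(1) by (metis add.commute le_Suc_ex add_2_eq_Suc Suc_eq_plus1)
  have fV: "finite V" and EV: "\<And>e. e \<in> E \<Longrightarrow> e \<subseteq> V \<and> card e = 2"
    using assms(2) unfolding finite_simple_graph_def by blast+
  have finE: "finite E" using assms(2) by (rule finite_simple_graph_finite_edges)
  define M where "M = {H. H \<subseteq> E \<and> mod_one n H}"
  have fM: "finite M" using finE by (simp add: M_def)
  moreover have "{} \<in> M" by (simp add: M_def mod_one_def)
  ultimately obtain H where H: "H \<in> M" "Max (card ` M) = card H" using obtains_MAX[of M card] by blast
  have max: "card H' \<le> card H" if "H' \<subseteq> E" "mod_one n H'" for H'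
    unfolding H(2)[symmetric] using fM that by (intro Max_ge) (auto simp: M_def)
  have HE: "H \<subseteq> E" and H1: "mod_one n H" using H(1) by (auto simp: M_def)
  let ?adj = "adjacent (E - H)"
  have "\<exists>v\<in>W. card {w \<in> W. ?adj v w} \<le> 56 * n + 24" if W: "W \<subseteq> V" "W \<noteq> {}" for W
  proof -
    have fW: "finite W" using W fV finite_subset by blast
    obtain v where v: "v \<in> W" "wdeg (adj_mult (E - H)) W v < 56 * n + 24"
      using maximal_mod_one_complement[OF assms(2) HE H1 max W] by blast
    have "wdeg (adj_mult (E - H)) W v = card {w \<in> W. ?adj v w}"
      unfolding wdeg_def using fW by (simp add: of_bool_def sum.If_cases Int_def)
    then show ?thesis using v by (intro bexI[of _ v]) auto
  qed
  then obtain r :: "'a \<Rightarrow> nat" where r: "inj_on r V" "\<forall>v\<in>V. r v < card V"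
    "\<forall>v\<in>V. card {w \<in> V. ?adj v w \<and> r w < r v} \<le> 56 * n + 24"
    using degeneracy_ordering[OF fV, of ?adj "56 * n + 24"] by blast
  obtain c :: "'a set \<Rightarrow> nat" where
    "\<forall>u\<in>V. \<forall>v\<in>V. ?adj u v \<longrightarrow> r u < card V \<longrightarrow> r u < r v \<longrightarrow> c {u, v} < 187 * n + 78"
    "\<forall>v\<in>V. r v < card V \<longrightarrow> (\<forall>x. zero_or_one_mod n (card {w \<in> V. ?adj v w \<and> c {v, w} = x}))"
    using degenerate_coloring[OF fV r(1,3), of "card V"] by (elim exE conjE) (rule that)
  then have
    c0: "\<And>u v. u \<in> V \<Longrightarrow> v \<in> V \<Longrightarrow> ?adj u v \<Longrightarrow> r u < r v \<Longrightarrow> c {u, v} < 187 * n + 78"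
    and c1: "\<And>v x. v \<in> V \<Longrightarrow> zero_or_one_mod n (card {w \<in> V. ?adj v w \<and> c {v, w} = x})"
    using r(2) by simp_all
  have edge: "\<exists>u v. e = {u, v} \<and> u \<in> V \<and> v \<in> V \<and> u \<noteq> v" if "e \<in> E" for e
    using EV[OF that] by (auto simp: card_2_iff)
  have cE: "c e < 187 * n + 78" if e: "e \<in> E - H" for e
  proof -
    obtain u v where uv: "e = {u, v}" "u \<in> V" "v \<in> V" "u \<noteq> v" using edge e by blast
    then have "r u \<noteq> r v" using r(1) by (auto simp: inj_on_def)
    moreover have "?adj u v" "?adj v u" using uv e by (auto simp: adjacent_def insert_commute)
    ultimately show ?thesis using c0[of u v] c0[of v u] uv by (cases "r u < r v") (auto simp: insert_commute)
  qed
  \<comment> \<open>\<open>187 * n + 78\<close> is the first colour outside both palettes and is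
    reserved for H.\<close>
  define d where "d e = (if e \<in> H then 187 * n + 78 else c e)" for e
  have "chi'_coloring k E d"
    unfolding chi'_coloring_def k
  proof (intro ballI)
    fix i v assume v: "v \<in> \<Union>(color_class E d i)"
    show "[edge_degree (color_class E d i) v = 1] (mod n + 1)"
    proof (cases "i = 187 * n + 78")
      case True
      have "d e = i \<longleftrightarrow> e \<in> H" if "e \<in> E" for e
        using cE[of e] that True by (cases "e \<in> H") (simp_all add: d_def)
      then have cls: "color_class E d i = H" using HE unfolding color_class_def by blast
      show ?thesis using H1 v unfolding mod_one_def cls by blast
    next
      case False
      have cls: "color_class E d i = {e \<in> E - H. c e = i}"
        using False by (auto simp: color_class_def d_def)
      have vV: "v \<in> V" using v EV unfolding cls by blast
      have eq: "{e \<in> color_class E d i. v \<in> e} = (\<lambda>w. {v, w}) ` {w \<in> V. ?adj v w \<and> c {v, w} = i}"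
      proof (intro equalityI subsetI)
        fix e assume "e \<in> {e \<in> color_class E d i. v \<in> e}"
        then have e: "e \<in> E - H" "c e = i" "v \<in> e" unfolding cls by auto
        obtain a b where ab: "e = {a, b}" "a \<in> V" "b \<in> V" "a \<noteq> b" using edge e(1) by blast
        then obtain w where "e = {v, w}" "w \<in> V" "v \<noteq> w" using e(3) by (auto simp: insert_commute)
        then show "e \<in> (\<lambda>w. {v, w}) ` {w \<in> V. ?adj v w \<and> c {v, w} = i}"
          using e by (auto simp: adjacent_def)
      next
        fix e assume "e \<in> (\<lambda>w. {v, w}) ` {w \<in> V. ?adj v w \<and> c {v, w} = i}"
        then show "e \<in> {e \<in> color_class E d i. v \<in> e}" unfolding cls by (auto simp: adjacent_def)
      qed
      have "edge_degree (color_class E d i) v = card {w \<in> V. ?adj v w \<and> c {v, w} = i}"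
        unfolding edge_degree_def eq by (intro card_image) (auto simp: inj_on_def doubleton_eq_iff)
      \<comment> \<open>v is covered by the class, which excludes the alternative 0 in
        \<open>zero_or_one_mod\<close>.\<close>
      moreover have "edge_degree (color_class E d i) v \<noteq> 0"
      proof -
        have "finite (color_class E d i)" using finE by (simp add: color_class_def)
        then show ?thesis using v unfolding edge_degree_def by auto
      qed
      ultimately show ?thesis using c1[OF vV, of i] unfolding zero_or_one_mod_def by simp
    qed
  qed
  then have "chi'_index k E \<le> card (d ` E)"
    unfolding chi'_index_def by (intro Least_le) blast
  also have "\<dots> \<le> card {..<187 * n + 79}"
  proof (intro card_mono subsetI)
    fix x assume "x \<in> d ` E"
    then obtain e where "e \<in> E" "x = d e" by blast
    then show "x \<in> {..<187 * n + 79}" using cE[of e] by (cases "e \<in> H") (auto simp: d_def)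
  qed simp
  \<comment> \<open>With k = n + 1 the number 187n + 79 equals 187k - 108.\<close>
  also have "\<dots> \<le> 198 * k - 101" using assms(1) unfolding k by simp
  finally show ?thesis .
qed

end
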